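(* Fix $m\ge2$, a bounded open connected subset $\Omega\subset\mathbb{R}^m$, integers $d\ge5$ and $l\ge1$. For $i=1,\ldots,d$ let $V_i(x,z)$, $x\in\mathbb{R}^m$, $z\in\mathbb{R}^l$, be vector fields whose components $(x,z)\mapsto V_i^j(x,z)$ are real analytic in a neighborhood of $\mathrm{cl}(\Omega)\times\mathbb{R}^l$ (and multiplied by a smooth compactly supported function $\varphi(x)$ equal to one on $\Omega$, so that for each fixed $z$ they are globally bounded on $\mathbb{R}^m$). Let $Z$ be a random vector in $\mathbb{R}^l$ and set $V_i=V_i(\cdot,Z)$. Assume: (1) the law of $Z$ admits a probability density on $\mathbb{R}^l$; (2) for some $\widehat z\in\mathbb{R}^l$, the Lie algebra generated by $\widehat V_i=V_i(\cdot,\widehat z)$, $i=1,\ldots,d$, contains all polynomial vector fields. Then with probability one (over $Z$) the following holds: for every $N\in\mathbb{N}$, every training set $\{(x_i,y_i)\in\Omega\times\Omega: i=1,\ldots,N\}$ in which $(x_1,\ldots,x_N)$ is drawn from an arbitrary probability density on $(\mathbb{R}^m)^N$ and $y_1,\ldots,y_N$ are pairwise distinct but otherwise arbitrary, with probability one there exist controls $u^1,\ldots,u^d$ and a constant $\lambda>0$ such that $y_i=\lambda(X^{x_i}_1-x_i)$ for all $i=1,\ldots,N$, where $X^x_t$ denotes the solution of $\frac{d}{dt}X_t=\sum_{i=1}^d u^i_tV_i(X_t)$, $X_0=x$, $t\in[0,1]$.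
   Context: Controls are real-valued (square-integrable) functions on $[0,1]$. For smooth vector fields $U,V$, the Lie bracket is $[U,V](x)=DV(x)U(x)-DU(x)V(x)$; the Lie algebra generated by $U_1,\ldots,U_d$ is the smallest linear space of vector fields containing them and closed under Lie brackets. A polynomial vector field on $\mathbb{R}^m$ has polynomial components. $\mathrm{cl}(\Omega)$ is the closure of $\Omega$. *)

theory Defs
  imports "HOL-Analysis.Analysis" "HOL-Probability.Probability"
begin

fun C_k :: "nat \<Rightarrow> ('a::real_normed_vector \<Rightarrow> 'b::real_normed_vector) \<Rightarrow> bool" where
  "C_k 0 f = continuous_on UNIV f"
| "C_k (Suc k) f = ((\<forall>x. f differentiable (at x)) \<and>
      (\<forall>v. C_k k (\<lambda>x. frechet_derivative f (at x) v)))"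

definition smooth :: "('a::real_normed_vector \<Rightarrow> 'b::real_normed_vector) \<Rightarrow> bool" where
  "smooth f \<longleftrightarrow> (\<forall>k. C_k k f)"

definition real_analytic_at ::
  "((real^'m::finite) \<times> (real^'l::finite) \<Rightarrow> real) \<Rightarrow> (real^'m) \<times> (real^'l) \<Rightarrow> bool" where
  "real_analytic_at f p \<longleftrightarrow>
     (\<exists>e>0. \<exists>c :: ('m \<Rightarrow> nat) \<times> ('l \<Rightarrow> nat) \<Rightarrow> real.
        \<forall>q. dist q p < e \<longrightarrow>
          ((\<lambda>(\<alpha>, \<beta>). c (\<alpha>, \<beta>) * (\<Prod>i\<in>UNIV. (fst q $ i - fst p $ i) ^ \<alpha> i)
                            * (\<Prod>j\<in>UNIV. (snd q $ j - snd p $ j) ^ \<beta> j))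
             has_sum f q) UNIV)"

definition lie_bracket ::
  "(real^'m \<Rightarrow> real^'m) \<Rightarrow> (real^'m \<Rightarrow> real^'m) \<Rightarrow> real^'m \<Rightarrow> real^'m" where
  "lie_bracket U V x = frechet_derivative V (at x) (U x) - frechet_derivative U (at x) (V x)"

inductive_set lie_algebra_gen :: "('d \<Rightarrow> real^'m \<Rightarrow> real^'m) \<Rightarrow> (real^'m \<Rightarrow> real^'m) set"
  for G :: "'d \<Rightarrow> real^'m \<Rightarrow> real^'m" where
  gen: "G i \<in> lie_algebra_gen G"
| add: "U \<in> lie_algebra_gen G \<Longrightarrow> W \<in> lie_algebra_gen G \<Longrightarrow> (\<lambda>x. U x + W x) \<in> lie_algebra_gen G"
| scale: "U \<in> lie_algebra_gen G \<Longrightarrow> (\<lambda>x. c *\<^sub>R U x) \<in> lie_algebra_gen G"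
| bracket: "U \<in> lie_algebra_gen G \<Longrightarrow> W \<in> lie_algebra_gen G \<Longrightarrow> lie_bracket U W \<in> lie_algebra_gen G"

definition polynomial_function_m :: "(real^'m \<Rightarrow> real) \<Rightarrow> bool" where
  "polynomial_function_m f \<longleftrightarrow>
     (\<exists>c :: ('m \<Rightarrow> nat) \<Rightarrow> real. finite {\<alpha>. c \<alpha> \<noteq> 0} \<and>
        (\<forall>x. f x = (\<Sum>\<alpha>\<in>{\<alpha>. c \<alpha> \<noteq> 0}. c \<alpha> * (\<Prod>i\<in>UNIV. (x $ i) ^ \<alpha> i))))"

definition polynomial_vector_field :: "(real^'m \<Rightarrow> real^'m) \<Rightarrow> bool" where
  "polynomial_vector_field P \<longleftrightarrow> (\<forall>j. polynomial_function_m (\<lambda>x. P x $ j))"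

definition square_integrable_control :: "(real \<Rightarrow> real) \<Rightarrow> bool" where
  "square_integrable_control v \<longleftrightarrow>
     set_borel_measurable lborel {0..1} v \<and> set_integrable lborel {0..1} (\<lambda>t. (v t)^2)"

text \<open>(Caratheodory) solution of dX/dt = sum_i u^i_t V_i(X_t), X_0 = x, on [0,1].\<close>
definition is_control_solution ::
  "('d::finite \<Rightarrow> real \<Rightarrow> real) \<Rightarrow> ('d \<Rightarrow> real^'m \<Rightarrow> real^'m) \<Rightarrow> real^'m \<Rightarrow> (real \<Rightarrow> real^'m) \<Rightarrow> bool" where
  "is_control_solution u V x X \<longleftrightarrow>
     continuous_on {0..1} X \<and> X 0 = x \<and>
     (\<lambda>s. \<Sum>i\<in>UNIV. u i s *\<^sub>R V i (X s)) absolutely_integrable_on {0..1} \<and>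
     (\<forall>t\<in>{0..1}. X t = x + integral {0..t} (\<lambda>s. \<Sum>i\<in>UNIV. u i s *\<^sub>R V i (X s)))"

end

theory Submission
  imports Defs
begin

text \<open>
  Since only the direction \<open>X 1 - x\<close> matters and \<open>lam\<close> is free, it suffices to reach the points
  \<open>x k + \<epsilon> * y k\<close> simultaneously for one small \<open>\<epsilon>\<close>. A commutator of flows approximates the flow of a Lie
  bracket uniformly in space, so the flow of every field in the Lie algebra is a uniform limit of
  compositions of flows of the \<open>V i\<close>, continuously in time. If the Lie algebra contains fields which
  at the points \<open>x k\<close> form a basis of the tangent space of the product, these approximate flows give a map
  close to the identity on a cube, and Brouwer's theorem turns approximate into exact reachability.

  For the parameter \<open>zh\<close> such fields exist by polynomial interpolation. The condition is the
  non-vanishing of an analytic function, and the zero set of an analytic function on a connected open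
  set is everything or null; applying this first to the parameter and then to one point at a time
  (Fubini) gives the claim for almost every parameter and almost every training set.
\<close>

section \<open>Flows of bounded Lipschitz fields\<close>

text \<open>Brouwer's theorem, rather than an inverse function theorem, is forced by the quality of
  the approximation: the commutator scheme runs its flows for times of order
  \<open>sqrt \<bar>h\<bar>\<close> and is iterated many times, so only uniform closeness to the
  target flow and continuity in time survive, without control of derivatives in time. Uniformity
  over the whole space comes from the compact support of the fields. A single map of the space moves
  all training points at once, so no fields on the product space are formed: duality at the points,
  \<open>interpolates\<close>, plays the role of the basis. That property mentions neither the
  targets nor the density of the points, and only countably many \<open>N\<close> occur; hence one
  null set of parameters serves every training problem. Away from \<open>zh\<close> the Lie algebra
  need not contain polynomials; only the finitely many bracket expressions that interpolate at
  \<open>zh\<close> are followed to other parameters, and the analytic function whose zeros are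
  excluded is a product of elimination pivots.\<close>

lemma ex_antiderivative:
  fixes f :: "real \<Rightarrow> 'a::euclidean_space"
  assumes f: "continuous_on UNIV f"
  shows "\<exists>F. F 0 = 0 \<and> (\<forall>t. (F has_vector_derivative f t) (at t))"
proof -
  \<comment> \<open>For negative \<open>t\<close> the interval from 0 to \<open>t\<close> is empty
    and its integral is 0. A lower end to the left of both 0 and \<open>t\<close> avoids this, and
    \<open>F_eq\<close> shows that its position does not matter.\<close>
  define F where "F = (\<lambda>t. integral {-(\<bar>t\<bar>+1)..t} f - integral {-(\<bar>t\<bar>+1)..0} f)"
  have int: "f integrable_on {a..b}" for a b
    using f by (intro integrable_continuous_interval) (auto intro: continuous_on_subset)
  have F_eq: "F t = integral {-n..t} f - integral {-n..0} f" if t: "\<bar>t\<bar> + 1 \<le> n" for t n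
  proof -
    have "integral {-n..-(\<bar>t\<bar>+1)} f + integral {-(\<bar>t\<bar>+1)..t} f = integral {-n..t} f"
      using t by (intro Henstock_Kurzweil_Integration.integral_combine int) auto
    moreover have "integral {-n..-(\<bar>t\<bar>+1)} f + integral {-(\<bar>t\<bar>+1)..0} f = integral {-n..0} f"
      using t by (intro Henstock_Kurzweil_Integration.integral_combine int) auto
    ultimately show ?thesis unfolding F_def by (metis add_diff_cancel_left)
  qed
  have "(F has_vector_derivative f t) (at t)" for t
  proof -
    define n where "n = \<bar>t\<bar> + 2"
    have "((\<lambda>u. integral {-n..u} f) has_vector_derivative f t) (at t within {-n..n})"
      using f by (intro integral_has_vector_derivative) (auto simp: n_def intro: continuous_on_subset)
    then have "((\<lambda>u. integral {-n..u} f) has_vector_derivative f t) (at t)"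
      by (subst (asm) at_within_interior) (auto simp: n_def)
    then have "((\<lambda>u. integral {-n..u} f - integral {-n..0} f) has_vector_derivative f t) (at t)"
      using has_vector_derivative_diff[OF _ has_vector_derivative_const, of _ "f t"] by fastforce
    then show ?thesis
    proof (rule has_vector_derivative_transform_within_open)
      show "open (ball t 1)" "t \<in> ball t 1" by auto
      fix u assume "u \<in> ball t 1"
      then have "\<bar>u\<bar> + 1 \<le> n" unfolding n_def dist_real_def mem_ball by linarith
      then show "integral {-n..u} f - integral {-n..0} f = F u" by (simp add: F_eq)
    qed
  qed
  moreover have "F 0 = 0" by (simp add: F_def)
  ultimately show ?thesis by blast
qed

lemma has_vector_derivative_reflect:
  assumes "(X has_vector_derivative d) (at (-t))"
  shows "((\<lambda>s. X (- s)) has_vector_derivative - d) (at (t::real))"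
proof -
  have "(uminus has_vector_derivative (-1)) (at t)"
    using has_vector_derivative_minus[OF has_vector_derivative_id, of "at t"] by (simp add: o_def)
  from vector_diff_chain_at[OF this assms] show ?thesis by (simp add: o_def)
qed

text \<open>Mean value inequality against a scalar majorant, with negative times reduced to positive
  ones by reflection. With \<open>g\<close> a known bound and \<open>G\<close> its antiderivative it
  yields the displacement and Taylor estimates for flows.\<close>

lemma norm_le_of_derivative_bound:
  fixes D :: "real \<Rightarrow> 'a::real_normed_vector"
  assumes D: "D 0 = 0" "\<And>t. (D has_vector_derivative D' t) (at t)"
    and G: "G 0 = 0" "\<And>t. (G has_real_derivative g t) (at t)"
    and bnd: "\<And>t. norm (D' t) \<le> g \<bar>t\<bar>"
  shows "norm (D t) \<le> G \<bar>t\<bar>"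
proof -
  have *: "norm (E t) \<le> G t" if "t \<ge> 0" "E 0 = 0" "\<And>t. (E has_vector_derivative E' t) (at t)"
    "\<And>t. norm (E' t) \<le> g \<bar>t\<bar>" for E E' :: "real \<Rightarrow> 'a" and t :: real
  proof (cases "t = 0")
    case False
    have "norm (E t - E 0) \<le> G t - G 0"
    proof (rule differentiable_bound_general[of 0 t E G E' g])
      show "continuous_on {0..t} E"
        using that(3) by (meson continuous_at_imp_continuous_on has_vector_derivative_continuous)
      show "continuous_on {0..t} G"
        using G(2) by (meson DERIV_isCont continuous_at_imp_continuous_on)
      show "norm (E' x) \<le> g x" if "0 < x" "x < t" for x
        using \<open>\<And>t. norm (E' t) \<le> g \<bar>t\<bar>\<close>[of x] that by simp
      show "(G has_vector_derivative g x) (at x)" for x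
        using G(2)[of x] by (simp add: has_real_derivative_iff_has_vector_derivative)
    qed (use that False in auto)
    then show ?thesis using that G by simp
  qed (use that G in simp)
  show ?thesis
  proof (cases "t \<ge> 0")
    case True
    then show ?thesis using *[OF True D bnd] by simp
  next
    case False
    have "norm ((\<lambda>s. D (-s)) (-t)) \<le> G (-t)"
    proof (rule *[where E'="\<lambda>s. - D' (-s)"])
      show "((\<lambda>s. D (- s)) has_vector_derivative - D' (- s)) (at s)" for s
        by (rule has_vector_derivative_reflect[OF D(2)])
      show "norm (- D' (- s)) \<le> g \<bar>s\<bar>" for s using bnd[of "-s"] by simp
    qed (use False D in simp_all)
    then show ?thesis using False by simp
  qed
qed

text \<open>One constant serves as sup bound and as Lipschitz constant; \<open>K \<ge> 1\<close>
  makes its powers comparable, so estimates that mix both uses stay in powers of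
  \<open>K\<close>.\<close>

definition bounded_lipschitz :: "real \<Rightarrow> ('a::real_normed_vector \<Rightarrow> 'a) \<Rightarrow> bool" where
  "bounded_lipschitz K V \<longleftrightarrow> K \<ge> 1 \<and> (\<forall>x. norm (V x) \<le> K) \<and> (\<forall>x y. norm (V x - V y) \<le> K * norm (x - y))"

definition integral_curve :: "('a::real_normed_vector \<Rightarrow> 'a) \<Rightarrow> (real \<Rightarrow> 'a) \<Rightarrow> bool" where
  "integral_curve V X \<longleftrightarrow> (\<forall>t. (X has_vector_derivative V (X t)) (at t))"

text \<open>The choice is made once for a whole curve, not separately for each time.
  \<open>integral_curve_exists\<close> and \<open>flow_unique\<close> make it the usual global flow
  for \<open>bounded_lipschitz\<close> fields.\<close>

definition flow :: "('a::euclidean_space \<Rightarrow> 'a) \<Rightarrow> real \<Rightarrow> 'a \<Rightarrow> 'a" where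
  "flow V t x = (SOME X. X 0 = x \<and> integral_curve V X) t"

lemma bounded_lipschitzD:
  assumes "bounded_lipschitz K V"
  shows "K \<ge> 1" "K > 0" "K \<ge> 0" "norm (V x) \<le> K" "norm (V x - V y) \<le> K * norm (x - y)"
  using assms by (auto simp: bounded_lipschitz_def)

lemma bounded_lipschitz_continuous:
  assumes "bounded_lipschitz K V" shows "continuous_on S V"
proof (rule lipschitz_on_continuous_on[of K])
  show "K-lipschitz_on S V"
    using bounded_lipschitzD[OF assms] by (intro lipschitz_onI) (auto simp: dist_norm)
qed

lemma linear_le_exp: "K * \<bar>t\<bar> \<le> exp (2 * K * \<bar>t\<bar>)" if "K \<ge> 0" for K t :: real
proof -
  have "K * \<bar>t\<bar> \<le> 1 + 2 * K * \<bar>t\<bar>" using that by (simp add: algebra_simps)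
  also have "\<dots> \<le> exp (2 * K * \<bar>t\<bar>)" by (rule exp_ge_add_one_self)
  finally show ?thesis .
qed

text \<open>Picard iteration is a contraction globally in time for the sup norm weighted by
  \<open>exp (- 2 * K * \<bar>t\<bar>)\<close>.\<close>
lemma integral_curve_exists:
  fixes V :: "'a::euclidean_space \<Rightarrow> 'a"
  assumes V: "bounded_lipschitz K V"
  shows "\<exists>X. X 0 = x \<and> integral_curve V X"
proof -
  note K = bounded_lipschitzD[OF V]
  define e where "e = (\<lambda>t::real. exp (2 * K * \<bar>t\<bar>))"
  have e: "e t > 0" "continuous_on UNIV e" for t unfolding e_def by (auto intro!: continuous_intros)
  \<comment> \<open>The unknown is \<open>Y\<close>, where the curve is
    \<open>x + e s *\<^sub>R Y s\<close>: dividing the displacement by the weight makes it a bounded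
    continuous function, an element of a complete space.\<close>
  define f where "f = (\<lambda>(Y :: real \<Rightarrow>\<^sub>C 'a) s. V (x + e s *\<^sub>R apply_bcontfun Y s))"
  have "continuous_on UNIV (f Y)" for Y
    unfolding f_def
    by (rule continuous_on_compose2[OF bounded_lipschitz_continuous[OF V, of UNIV]])
      (auto intro!: continuous_intros e)
  then have "\<forall>Y. \<exists>F. F 0 = 0 \<and> (\<forall>t. (F has_vector_derivative f Y t) (at t))"
    using ex_antiderivative by blast
  from choice[OF this] obtain A where A: "\<And>Y. A Y 0 = 0" "\<And>Y t. (A Y has_vector_derivative f Y t) (at t)"
    by blast
  have A_bound: "norm (A Y t) \<le> K * \<bar>t\<bar>" for Y t
    by (rule norm_le_of_derivative_bound[OF A(1,2), where g="\<lambda>_. K" and G="\<lambda>t. K * t"])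
      (auto intro!: derivative_eq_intros simp: f_def K)
  have A_cont: "continuous_on UNIV (A Y)" for Y
    using A(2) by (meson continuous_at_imp_continuous_on has_vector_derivative_continuous)
  define P where "P = (\<lambda>Y t. inverse (e t) *\<^sub>R A Y t)"
  have P_bcont: "P Y \<in> bcontfun" for Y
  proof (rule bcontfun_normI[where b=1])
    show "continuous_on UNIV (P Y)"
      unfolding P_def using e(1) by (intro continuous_intros e A_cont) (auto simp: less_imp_neq[symmetric])
    have "K * \<bar>t\<bar> \<le> e t" for t unfolding e_def using linear_le_exp K(3) by blast
    then have "norm (A Y t) \<le> e t" for t using A_bound[of Y t] order_trans by blast
    then show "norm (P Y t) \<le> 1" for t
      unfolding P_def using e(1)[of t] by (simp add: field_simps)
  qed
  define \<Psi> where "\<Psi> = (\<lambda>Y. Bcontfun (P Y))"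
  have \<Psi>: "apply_bcontfun (\<Psi> Y) = P Y" for Y
    unfolding \<Psi>_def using P_bcont by (simp add: Bcontfun_inverse)
  have "\<exists>!Y. \<Psi> Y = Y"
  proof (rule banach_fix_type[of "1/2"])
    show "\<forall>Y Z. dist (\<Psi> Y) (\<Psi> Z) \<le> 1/2 * dist Y Z"
    proof (intro allI dist_bound)
      fix Y Z :: "real \<Rightarrow>\<^sub>C 'a" and t
      define d where "d = dist Y Z"
      have d: "norm (Y s - Z s) \<le> d" for s
        unfolding d_def dist_norm[symmetric] by (rule dist_bounded)
      \<comment> \<open>Integrating \<open>K * exp (2 * K * s) * d\<close> gives
        \<open>d / 2\<close> times the weight minus one; the 2 in the exponent is the source of the
        contraction factor 1/2.\<close>
      have "norm (A Y t - A Z t) \<le> d / 2 * (exp (2 * K * \<bar>t\<bar>) - 1)"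
      proof (rule norm_le_of_derivative_bound[where D'="\<lambda>t. f Y t - f Z t" and
            G="\<lambda>t. d / 2 * (exp (2 * K * t) - 1)" and g="\<lambda>t. K * exp (2 * K * t) * d"])
        show "norm (f Y s - f Z s) \<le> K * exp (2 * K * \<bar>s\<bar>) * d" for s
        proof -
          have "norm (f Y s - f Z s) \<le> K * norm (e s *\<^sub>R Y s - e s *\<^sub>R Z s)"
            unfolding f_def using K(5)[of "x + e s *\<^sub>R Y s" "x + e s *\<^sub>R Z s"] by simp
          also have "\<dots> = K * e s * norm (Y s - Z s)"
            using e(1)[of s] by (simp flip: scaleR_diff_right)
          also have "\<dots> \<le> K * e s * d" using e(1)[of s] K d by (intro mult_left_mono) auto
          finally show ?thesis by (simp add: e_def)
        qed
      qed (auto intro!: derivative_eq_intros A simp: A)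
      also have "\<dots> \<le> e t * (1/2 * d)"
      proof -
        have "d \<ge> 0" by (simp add: d_def)
        then show ?thesis by (simp add: e_def algebra_simps)
      qed
      finally have "norm (A Y t - A Z t) \<le> e t * (1/2 * d)" .
      then have "inverse (e t) * norm (A Y t - A Z t) \<le> 1/2 * d"
        using e(1)[of t] by (simp add: field_simps)
      then show "dist (\<Psi> Y t) (\<Psi> Z t) \<le> 1/2 * dist Y Z"
        unfolding \<Psi> P_def using e(1)[of t]
        by (simp add: dist_norm d_def flip: scaleR_diff_right)
    qed
  qed auto
  then obtain Y where Y: "\<Psi> Y = Y" by blast
  then have "apply_bcontfun Y = P Y" using \<Psi> by metis
  then have "e t *\<^sub>R Y t = A Y t" for t unfolding P_def using e(1)[of t] by simp
  then have f_eq: "f Y t = V (x + A Y t)" for t unfolding f_def by simp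
  have "((\<lambda>t. x + A Y t) has_vector_derivative V (x + A Y t)) (at t)" for t
    using has_vector_derivative_add[OF has_vector_derivative_const A(2)[of Y t], of x] by (simp add: f_eq)
  then show ?thesis using A(1) by (intro exI[of _ "\<lambda>t. x + A Y t"]) (auto simp: integral_curve_def)
qed

lemma integral_curve_reflect:
  "integral_curve V X \<Longrightarrow> integral_curve (\<lambda>x. - V x) (\<lambda>t. X (- t))"
  unfolding integral_curve_def
proof
  fix t assume *: "\<forall>t. (X has_vector_derivative V (X t)) (at t)"
  show "((\<lambda>t. X (- t)) has_vector_derivative - V (X (- t))) (at t)"
    by (rule has_vector_derivative_reflect[OF *[rule_format]])
qed

text \<open>Gronwall in differential form: the squared distance, differentiable even where the norm
  is not, becomes nonincreasing after multiplication by \<open>exp (- 2 * K * t)\<close>. Negative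
  times use the reflected curves, which belong to the field \<open>- V\<close> with the same
  \<open>K\<close>.\<close>

lemma integral_curves_dist:
  fixes V :: "'a::euclidean_space \<Rightarrow> 'a"
  assumes V: "bounded_lipschitz K V" and X: "integral_curve V X" and Y: "integral_curve V Y"
  shows "norm (X t - Y t) \<le> exp (K * \<bar>t\<bar>) * norm (X 0 - Y 0)"
proof -
  have *: "norm (X t - Y t) \<le> exp (K * t) * norm (X 0 - Y 0)"
    if V: "bounded_lipschitz K V" and X: "integral_curve V X" and Y: "integral_curve V Y" and t: "t \<ge> 0"
    for V :: "'a \<Rightarrow> 'a" and X Y t
  proof -
    note K = bounded_lipschitzD[OF V]
    define D where "D = (\<lambda>t. X t - Y t)"
    define E where "E = (\<lambda>t. (D t \<bullet> D t) * exp (- 2 * K * t))"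
    have D: "(D has_vector_derivative V (X s) - V (Y s)) (at s)" for s
      using X Y unfolding D_def integral_curve_def by (auto intro!: derivative_eq_intros)
    have DD: "((\<lambda>s. D s \<bullet> D s) has_real_derivative 2 * (D s \<bullet> (V (X s) - V (Y s)))) (at s)" for s
      using has_derivative_inner[OF D[of s, unfolded has_vector_derivative_def] D[of s, unfolded has_vector_derivative_def]]
      unfolding has_field_derivative_def
      by (rule has_derivative_eq_rhs) (auto simp: fun_eq_iff inner_commute algebra_simps)
    have "E t \<le> E 0"
    proof (rule DERIV_nonpos_imp_nonincreasing[OF t])
      fix s
      have "(E has_real_derivative (2 * (D s \<bullet> (V (X s) - V (Y s))) * exp (- 2 * K * s)
          + (D s \<bullet> D s) * (exp (- 2 * K * s) * (- 2 * K)))) (at s)"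
        unfolding E_def by (rule DERIV_mult'[THEN DERIV_cong, OF DD]) (auto intro!: derivative_eq_intros)
      moreover have "2 * (D s \<bullet> (V (X s) - V (Y s))) * exp (- 2 * K * s)
          + (D s \<bullet> D s) * (exp (- 2 * K * s) * (- 2 * K)) \<le> 0"
      proof -
        have "D s \<bullet> (V (X s) - V (Y s)) \<le> norm (D s) * norm (V (X s) - V (Y s))"
          by (rule norm_cauchy_schwarz)
        also have "\<dots> \<le> norm (D s) * (K * norm (D s))"
          unfolding D_def by (intro mult_left_mono K) auto
        also have "\<dots> = K * (D s \<bullet> D s)" by (simp add: dot_square_norm power2_eq_square)
        finally have "(D s \<bullet> (V (X s) - V (Y s)) - K * (D s \<bullet> D s)) * (2 * exp (- 2 * K * s)) \<le> 0"
          by (intro mult_nonpos_nonneg) auto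
        then show ?thesis by (simp add: algebra_simps)
      qed
      ultimately show "\<exists>y. (E has_real_derivative y) (at s) \<and> y \<le> 0" by blast
    qed
    then have "(norm (D t))\<^sup>2 \<le> (norm (D 0))\<^sup>2 * exp (2 * K * t)"
      by (simp add: E_def exp_minus field_simps dot_square_norm)
    also have "\<dots> = (exp (K * t) * norm (D 0))\<^sup>2"
      by (simp add: power_mult_distrib flip: exp_double)
    finally show ?thesis unfolding D_def by (rule power2_le_imp_le) simp
  qed
  show ?thesis
  proof (cases "t \<ge> 0")
    case True then show ?thesis using *[OF V X Y] by simp
  next
    case False
    have "bounded_lipschitz K (\<lambda>x. - V x)"
      using V unfolding bounded_lipschitz_def by (simp add: norm_minus_commute)
    from *[OF this integral_curve_reflect[OF X] integral_curve_reflect[OF Y], of "-t"] False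
    show ?thesis by simp
  qed
qed

section \<open>The global flow: group law, Lipschitz dependence and joint continuity\<close>

lemma flow_curve:
  assumes "bounded_lipschitz K V"
  shows "flow V 0 x = x" "integral_curve V (\<lambda>t. flow V t x)"
proof -
  have "(SOME X. X 0 = x \<and> integral_curve V X) 0 = x \<and> integral_curve V (SOME X. X 0 = x \<and> integral_curve V X)"
    by (rule someI_ex[OF integral_curve_exists[OF assms]])
  then show "flow V 0 x = x" "integral_curve V (\<lambda>t. flow V t x)" by (auto simp: flow_def)
qed

lemma flow_has_derivative:
  "bounded_lipschitz K V \<Longrightarrow> ((\<lambda>t. flow V t x) has_vector_derivative V (flow V t x)) (at t)"
  using flow_curve(2) unfolding integral_curve_def by blast

lemma flow_unique:
  assumes V: "bounded_lipschitz K V" and X: "integral_curve V X" "X 0 = x"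
  shows "X t = flow V t x"
  using integral_curves_dist[OF V X(1) flow_curve(2)[OF V, of x], of t] X(2) flow_curve(1)[OF V] by simp

lemma flow_add:
  assumes V: "bounded_lipschitz K V"
  shows "flow V (s + t) x = flow V s (flow V t x)"
proof (rule flow_unique[OF V, of "\<lambda>s. flow V (s + t) x"])
  show "integral_curve V (\<lambda>s. flow V (s + t) x)"
    unfolding integral_curve_def
  proof
    fix s
    have "((\<lambda>s. s + t) has_vector_derivative 1) (at s)"
      by (auto intro!: derivative_eq_intros)
    from vector_diff_chain_at[OF this flow_has_derivative[OF V, of x "s + t"]]
    show "((\<lambda>s. flow V (s + t) x) has_vector_derivative V (flow V (s + t) x)) (at s)"
      by (simp add: o_def)
  qed
qed simp

lemma flow_minus:
  assumes V: "bounded_lipschitz K V"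
  shows "flow V t (flow V (- t) x) = x" "flow V (- t) (flow V t x) = x"
  using flow_add[OF V, of t "-t" x] flow_add[OF V, of "-t" t x] flow_curve(1)[OF V] by simp_all

lemma flow_scale:
  assumes V: "bounded_lipschitz K V" and W: "bounded_lipschitz L (\<lambda>x. c *\<^sub>R V x)"
  shows "flow (\<lambda>x. c *\<^sub>R V x) t x = flow V (c * t) x"
proof (rule flow_unique[OF W, symmetric, of "\<lambda>t. flow V (c * t) x"])
  show "integral_curve (\<lambda>x. c *\<^sub>R V x) (\<lambda>t. flow V (c * t) x)"
    unfolding integral_curve_def
  proof
    fix s
    have "((\<lambda>s. c * s) has_vector_derivative c) (at s)"
      by (auto intro!: derivative_eq_intros)
    from vector_diff_chain_at[OF this flow_has_derivative[OF V, of x "c * s"]]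
    show "((\<lambda>s. flow V (c * s) x) has_vector_derivative c *\<^sub>R V (flow V (c * s) x)) (at s)"
      by (simp add: o_def)
  qed
qed (use flow_curve(1)[OF V] in simp)

lemma flow_lipschitz:
  assumes V: "bounded_lipschitz K V"
  shows "norm (flow V t x - flow V t y) \<le> exp (K * \<bar>t\<bar>) * norm (x - y)"
  using integral_curves_dist[OF V flow_curve(2)[OF V, of x] flow_curve(2)[OF V, of y], of t] flow_curve(1)[OF V] by simp

lemma flow_displacement:
  assumes V: "bounded_lipschitz K V"
  shows "norm (flow V t x - x) \<le> K * \<bar>t\<bar>"
proof (rule norm_le_of_derivative_bound[where D="\<lambda>t. flow V t x - x" and G="\<lambda>t. K * t" and g="\<lambda>_. K"])
  show "((\<lambda>t. flow V t x - x) has_vector_derivative V (flow V t x)) (at t)" for t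
    using has_vector_derivative_diff[OF flow_has_derivative[OF V, of x t] has_vector_derivative_const, of x] by simp
qed (use flow_curve(1)[OF V] bounded_lipschitzD[OF V] in \<open>auto intro!: derivative_eq_intros\<close>)

text \<open>In a composition the point fed to a later map depends on the earlier times, so
  continuity in time alone would not pass to compositions.\<close>

definition jointly_continuous :: "(real \<Rightarrow> 'a::euclidean_space \<Rightarrow> 'a) \<Rightarrow> bool" where
  "jointly_continuous F \<longleftrightarrow> continuous_on UNIV (\<lambda>p. F (fst p) (snd p))"

lemma jointly_continuous_compose:
  assumes "jointly_continuous F" "continuous_on S a" "continuous_on S b"
  shows "continuous_on S (\<lambda>s. F (a s) (b s))"
  using continuous_on_compose2[OF assms(1)[unfolded jointly_continuous_def] continuous_on_Pair[OF assms(2,3)]] by simp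

lemma jointly_continuous_flow:
  assumes V: "bounded_lipschitz K V"
  shows "jointly_continuous (flow V)"
  unfolding jointly_continuous_def continuous_on_eq_continuous_at[OF open_UNIV] isCont_def LIM_def
proof (intro ballI allI impI)
  fix p :: "real \<times> 'a" and e :: real assume e: "e > 0"
  obtain s y where p: "p = (s, y)" by (cases p)
  note K = bounded_lipschitzD[OF V]
  have "((\<lambda>q. exp (K * \<bar>fst q\<bar>) * norm (snd q - y) + K * \<bar>fst q - s\<bar>) \<longlongrightarrow>
      exp (K * \<bar>fst p\<bar>) * norm (snd p - y) + K * \<bar>fst p - s\<bar>) (at p)"
    by (intro tendsto_intros)
  then have "((\<lambda>q. exp (K * \<bar>fst q\<bar>) * norm (snd q - y) + K * \<bar>fst q - s\<bar>) \<longlongrightarrow> 0) (at p)"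
    by (simp add: p)
  then have "eventually (\<lambda>q. exp (K * \<bar>fst q\<bar>) * norm (snd q - y) + K * \<bar>fst q - s\<bar> < e) (at p)"
    using e by (rule order_tendstoD)
  then obtain d where d: "d > 0" "\<And>q. q \<noteq> p \<Longrightarrow> dist q p < d \<Longrightarrow>
      exp (K * \<bar>fst q\<bar>) * norm (snd q - y) + K * \<bar>fst q - s\<bar> < e"
    unfolding eventually_at by blast
  have "dist (flow V (fst q) (snd q)) (flow V (fst p) (snd p)) < e" if "q \<noteq> p" "dist q p < d" for q
  proof -
    obtain t x where q: "q = (t, x)" by (cases q)
    have "norm (flow V t x - flow V s y) \<le> norm (flow V t x - flow V t y) + norm (flow V t y - flow V s y)"
      by norm
    also have "\<dots> \<le> exp (K * \<bar>t\<bar>) * norm (x - y) + K * \<bar>t - s\<bar>"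
      using flow_displacement[OF V, of "t - s" "flow V s y"] flow_add[OF V, of "t - s" s y]
      by (intro add_mono flow_lipschitz[OF V]) simp
    also have "\<dots> < e" using d(2)[OF that] by (simp add: q)
    finally show ?thesis by (simp add: p q dist_norm)
  qed
  then show "\<exists>d>0. \<forall>x. x \<noteq> p \<and> dist x p < d \<longrightarrow> dist (flow V (fst x) (snd x)) (flow V (fst p) (snd p)) < e"
    using d(1) by blast
qed

text \<open>Quantitative version of a bounded field with bounded first and second derivatives: the
  quadratic remainder and the Lipschitz bound on \<open>DV\<close> stand in for the second
  derivative.\<close>

definition c2_field :: "real \<Rightarrow> ('a::real_normed_vector \<Rightarrow> 'a) \<Rightarrow> ('a \<Rightarrow> 'a \<Rightarrow> 'a) \<Rightarrow> bool" where
  "c2_field K V DV \<longleftrightarrow> bounded_lipschitz K V \<and> (\<forall>x. linear (DV x)) \<and>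
     (\<forall>x y. norm (V y - V x - DV x (y - x)) \<le> K * (norm (y - x))\<^sup>2) \<and>
     (\<forall>x v. norm (DV x v) \<le> K * norm v) \<and>
     (\<forall>x y v. norm (DV x v - DV y v) \<le> K * norm (x - y) * norm v)"

lemma c2_fieldD:
  assumes "c2_field K V DV"
  shows "bounded_lipschitz K V" "linear (DV x)" "norm (V y - V x - DV x (y - x)) \<le> K * (norm (y - x))\<^sup>2"
    "norm (DV x v) \<le> K * norm v" "norm (DV x v - DV y v) \<le> K * norm (x - y) * norm v"
  using assms by (auto simp: c2_field_def)

section \<open>Taylor expansions of flows, of their compositions and commutators\<close>

lemma flow_expansion1:
  assumes V: "bounded_lipschitz K V"
  shows "norm (flow V t x - x - t *\<^sub>R V x) \<le> K\<^sup>2 / 2 * \<bar>t\<bar>\<^sup>2"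
proof (rule norm_le_of_derivative_bound[where D="\<lambda>t. flow V t x - x - t *\<^sub>R V x"
      and G="\<lambda>t. K\<^sup>2 / 2 * t\<^sup>2" and g="\<lambda>t. K\<^sup>2 * t" and D'="\<lambda>t. V (flow V t x) - V x"])
  show "((\<lambda>t. flow V t x - x - t *\<^sub>R V x) has_vector_derivative V (flow V t x) - V x) (at t)" for t
    by (auto intro!: derivative_eq_intros flow_has_derivative[OF V])
  fix t
  have "norm (V (flow V t x) - V x) \<le> K * norm (flow V t x - x)" by (rule bounded_lipschitzD[OF V])
  also have "\<dots> \<le> K * (K * \<bar>t\<bar>)" by (intro mult_left_mono flow_displacement[OF V] bounded_lipschitzD[OF V])
  finally show "norm (V (flow V t x) - V x) \<le> K\<^sup>2 * \<bar>t\<bar>" by (simp add: power2_eq_square)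
qed (use flow_curve(1)[OF V] in \<open>auto intro!: derivative_eq_intros\<close>)

text \<open>The derivative of the remainder is the quadratic remainder of \<open>V\<close> over the
  displacement, at most \<open>K ^ 3 * t\<^sup>2\<close>, plus \<open>DV x\<close> of the
  first-order remainder, at most half of that. The sum integrates to the cubic bound.\<close>

lemma flow_expansion2:
  assumes V: "c2_field K V DV"
  shows "norm (flow V t x - x - t *\<^sub>R V x - (t\<^sup>2 / 2) *\<^sub>R DV x (V x)) \<le> K ^ 3 / 2 * \<bar>t\<bar> ^ 3"
proof (rule norm_le_of_derivative_bound[where D="\<lambda>t. flow V t x - x - t *\<^sub>R V x - (t\<^sup>2 / 2) *\<^sub>R DV x (V x)"
      and G="\<lambda>t. K ^ 3 / 2 * t ^ 3" and g="\<lambda>t. K ^ 3 / 2 * (3 * t\<^sup>2)"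
      and D'="\<lambda>t. V (flow V t x) - V x - t *\<^sub>R DV x (V x)"])
  note V1 = c2_fieldD(1)[OF V] and K = bounded_lipschitzD[OF c2_fieldD(1)[OF V]]
  show "((\<lambda>t. flow V t x - x - t *\<^sub>R V x - (t\<^sup>2 / 2) *\<^sub>R DV x (V x)) has_vector_derivative
      V (flow V t x) - V x - t *\<^sub>R DV x (V x)) (at t)" for t
    by (auto intro!: derivative_eq_intros flow_has_derivative[OF V1])
  fix t
  define d where "d = flow V t x - x"
  have d: "norm d \<le> K * \<bar>t\<bar>" unfolding d_def by (rule flow_displacement[OF V1])
  have "V (flow V t x) - V x - t *\<^sub>R DV x (V x) = (V (flow V t x) - V x - DV x d) + DV x (d - t *\<^sub>R V x)"
    using c2_fieldD(2)[OF V, of x] by (simp add: linear_diff linear_scale)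
  also have "norm \<dots> \<le> K * (norm d)\<^sup>2 + K * norm (d - t *\<^sub>R V x)"
    unfolding d_def by (intro norm_triangle_le add_mono c2_fieldD[OF V])
  also have "\<dots> \<le> K * (K * \<bar>t\<bar>)\<^sup>2 + K * (K\<^sup>2 / 2 * \<bar>t\<bar>\<^sup>2)"
    using d flow_expansion1[OF V1, of t x] K(3)
    by (intro add_mono mult_left_mono power_mono) (auto simp: d_def)
  also have "\<dots> = K ^ 3 / 2 * (3 * \<bar>t\<bar>\<^sup>2)"
    by (simp add: power2_eq_square power3_eq_cube algebra_simps)
  finally show "norm (V (flow V t x) - V x - t *\<^sub>R DV x (V x)) \<le> K ^ 3 / 2 * (3 * \<bar>t\<bar>\<^sup>2)" .
qed (use flow_curve(1)[OF c2_fieldD(1)[OF V]] in \<open>auto intro!: derivative_eq_intros\<close>)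

text \<open>The mixed term \<open>(p * q) *\<^sub>R DW x (U x)\<close> is the only second-order term
  that depends on the order of the two flows; the bracket will be its antisymmetrization.\<close>

lemma flow_flow_expansion:
  assumes U: "c2_field K U DU" and W: "c2_field K W DW"
  shows "norm (flow W q (flow U p x) - (x + p *\<^sub>R U x + q *\<^sub>R W x + (p * q) *\<^sub>R DW x (U x)
      + (p\<^sup>2 / 2) *\<^sub>R DU x (U x) + (q\<^sup>2 / 2) *\<^sub>R DW x (W x))) \<le> 4 * K ^ 3 * (\<bar>p\<bar> + \<bar>q\<bar>) ^ 3"
proof -
  note U1 = c2_fieldD(1)[OF U] and W1 = c2_fieldD(1)[OF W] and K = bounded_lipschitzD[OF c2_fieldD(1)[OF W]]
  note UB = bounded_lipschitzD(4)[OF U1]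
  define r where "r = \<bar>p\<bar> + \<bar>q\<bar>"
  have r: "\<bar>p\<bar> \<le> r" "\<bar>q\<bar> \<le> r" "r \<ge> 0" by (auto simp: r_def)
  define y where "y = flow U p x"
  \<comment> \<open>\<open>R1\<close> and \<open>R2\<close> are the remainders of the two legs,
    \<open>R3\<close> and \<open>R4\<close> come from expanding \<open>W y\<close> at
    \<open>x\<close> along the first leg, and \<open>R5\<close> is the change of the second-order
    term of \<open>W\<close> from \<open>x\<close> to \<open>y\<close>.\<close>
  define R1 where "R1 = flow W q y - y - q *\<^sub>R W y - (q\<^sup>2 / 2) *\<^sub>R DW y (W y)"
  define R2 where "R2 = y - x - p *\<^sub>R U x - (p\<^sup>2 / 2) *\<^sub>R DU x (U x)"
  define R3 where "R3 = W y - W x - DW x (y - x)"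
  define R4 where "R4 = DW x (y - x - p *\<^sub>R U x)"
  define R5 where "R5 = DW y (W y) - DW x (W x)"
  have d: "norm (y - x) \<le> K * \<bar>p\<bar>" unfolding y_def by (rule flow_displacement[OF U1])
  have R1: "norm R1 \<le> K ^ 3 / 2 * \<bar>q\<bar> ^ 3" unfolding R1_def by (rule flow_expansion2[OF W])
  have R2: "norm R2 \<le> K ^ 3 / 2 * \<bar>p\<bar> ^ 3" unfolding R2_def y_def by (rule flow_expansion2[OF U])
  have "norm R3 \<le> K * (norm (y - x))\<^sup>2" unfolding R3_def by (rule c2_fieldD[OF W])
  also have "\<dots> \<le> K * (K * \<bar>p\<bar>)\<^sup>2" using K(3) d by (intro mult_left_mono power_mono) auto
  finally have R3: "norm R3 \<le> K ^ 3 * \<bar>p\<bar>\<^sup>2" by (simp add: power2_eq_square power3_eq_cube algebra_simps)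
  have "norm R4 \<le> K * norm (y - x - p *\<^sub>R U x)" unfolding R4_def by (rule c2_fieldD[OF W])
  also have "\<dots> \<le> K * (K\<^sup>2 / 2 * \<bar>p\<bar>\<^sup>2)"
    unfolding y_def using K(3) by (intro mult_left_mono flow_expansion1[OF U1])
  finally have R4: "norm R4 \<le> K ^ 3 / 2 * \<bar>p\<bar>\<^sup>2" by (simp add: power2_eq_square power3_eq_cube algebra_simps)
  have "R5 = (DW y (W y) - DW x (W y)) + DW x (W y - W x)"
    using c2_fieldD(2)[OF W, of x] unfolding R5_def by (simp add: linear_diff)
  also have "norm \<dots> \<le> K * norm (y - x) * norm (W y) + K * norm (W y - W x)"
    by (intro norm_triangle_le add_mono c2_fieldD[OF W])
  also have "\<dots> \<le> K * (K * \<bar>p\<bar>) * K + K * (K * (K * \<bar>p\<bar>))"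
    using K d by (intro add_mono mult_mono mult_left_mono order_trans[OF K(5)]) auto
  finally have R5: "norm R5 \<le> 2 * K ^ 3 * \<bar>p\<bar>" by (simp add: power3_eq_cube algebra_simps)
  have "flow W q (flow U p x) - (x + p *\<^sub>R U x + q *\<^sub>R W x + (p * q) *\<^sub>R DW x (U x)
      + (p\<^sup>2 / 2) *\<^sub>R DU x (U x) + (q\<^sup>2 / 2) *\<^sub>R DW x (W x)) =
      R1 + R2 + q *\<^sub>R R3 + q *\<^sub>R R4 + (q\<^sup>2 / 2) *\<^sub>R R5"
    using c2_fieldD(2)[OF W, of x]
    unfolding R1_def R2_def R3_def R4_def R5_def y_def[symmetric]
    by (simp add: algebra_simps linear_add linear_diff linear_scale)
  also have "norm \<dots> \<le> K ^ 3 / 2 * \<bar>q\<bar> ^ 3 + K ^ 3 / 2 * \<bar>p\<bar> ^ 3 + \<bar>q\<bar> * (K ^ 3 * \<bar>p\<bar>\<^sup>2)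
      + \<bar>q\<bar> * (K ^ 3 / 2 * \<bar>p\<bar>\<^sup>2) + \<bar>q\<bar>\<^sup>2 / 2 * (2 * K ^ 3 * \<bar>p\<bar>)"
  proof (intro norm_triangle_le add_mono R1 R2)
    show "norm (q *\<^sub>R R3) \<le> \<bar>q\<bar> * (K ^ 3 * \<bar>p\<bar>\<^sup>2)" "norm (q *\<^sub>R R4) \<le> \<bar>q\<bar> * (K ^ 3 / 2 * \<bar>p\<bar>\<^sup>2)"
      unfolding norm_scaleR by (intro mult_left_mono R3 R4 abs_ge_zero)+
    have "norm ((q\<^sup>2 / 2) *\<^sub>R R5) = \<bar>q\<bar>\<^sup>2 / 2 * norm R5" by simp
    also have "\<dots> \<le> \<bar>q\<bar>\<^sup>2 / 2 * (2 * K ^ 3 * \<bar>p\<bar>)" by (intro mult_left_mono R5) auto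
    finally show "norm ((q\<^sup>2 / 2) *\<^sub>R R5) \<le> \<bar>q\<bar>\<^sup>2 / 2 * (2 * K ^ 3 * \<bar>p\<bar>)" .
  qed
  also have "\<dots> \<le> K ^ 3 / 2 * r ^ 3 + K ^ 3 / 2 * r ^ 3 + r * (K ^ 3 * r\<^sup>2)
      + r * (K ^ 3 / 2 * r\<^sup>2) + r\<^sup>2 / 2 * (2 * K ^ 3 * r)"
    using r K(3) by (intro add_mono mult_mono mult_left_mono power_mono divide_right_mono) auto
  \<comment> \<open>The coefficients 1/2, 1/2, 1, 1/2 and 1 add up to 7/2.\<close>
  also have "\<dots> \<le> 4 * K ^ 3 * r ^ 3"
    using K(3) r(3) by (simp add: power2_eq_square power3_eq_cube algebra_simps)
  finally show ?thesis unfolding r_def .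
qed

text \<open>Only two flows have to be expanded. From the point \<open>y\<close> reached after the
  two backward flows, running \<open>W\<close> and then \<open>U\<close> forward leads back to
  \<open>x\<close>, so the commutator minus the identity compares the two orders of composition at
  the common base \<open>y\<close>. All terms except the mixed ones cancel, and moving the bracket
  from \<open>y\<close> to \<open>x\<close> costs one more factor of order \<open>r\<close>.\<close>

lemma commutator_expansion:
  assumes U: "c2_field K U DU" and W: "c2_field K W DW"
    and B: "\<And>x. B x = DW x (U x) - DU x (W x)" "bounded_lipschitz L B"
  shows "norm (flow W q (flow U p (flow W (- q) (flow U (- p) x))) - x - (p * q) *\<^sub>R B x)
      \<le> (8 * K ^ 3 + L * K) * (\<bar>p\<bar> + \<bar>q\<bar>) ^ 3"
proof -
  note U1 = c2_fieldD(1)[OF U] and W1 = c2_fieldD(1)[OF W] and K = bounded_lipschitzD[OF c2_fieldD(1)[OF W]]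
  define r where "r = \<bar>p\<bar> + \<bar>q\<bar>"
  have r: "r \<ge> 0" "\<bar>p * q\<bar> \<le> r\<^sup>2"
  proof -
    have "\<bar>p\<bar> * \<bar>q\<bar> \<le> r * r" by (intro mult_mono) (auto simp: r_def)
    then show "\<bar>p * q\<bar> \<le> r\<^sup>2" by (simp add: abs_mult power2_eq_square)
  qed (simp add: r_def)
  define y where "y = flow W (- q) (flow U (- p) x)"
  have undo: "flow U p (flow W q y) = x"
    unfolding y_def by (simp add: flow_minus[OF U1] flow_minus[OF W1])
  define S where "S = y + p *\<^sub>R U y + q *\<^sub>R W y + (p\<^sup>2 / 2) *\<^sub>R DU y (U y) + (q\<^sup>2 / 2) *\<^sub>R DW y (W y)"
  have one: "norm (flow W q (flow U p y) - (S + (p * q) *\<^sub>R DW y (U y))) \<le> 4 * K ^ 3 * r ^ 3"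
    using flow_flow_expansion[OF U W, of q p y] unfolding S_def r_def by (simp add: algebra_simps)
  have two: "norm (flow U p (flow W q y) - (S + (p * q) *\<^sub>R DU y (W y))) \<le> 4 * K ^ 3 * r ^ 3"
    using flow_flow_expansion[OF W U, of p q y] unfolding S_def r_def by (simp add: algebra_simps)
  have "norm (y - x) = norm (flow U p (flow W q y) - y)" by (simp add: undo norm_minus_commute)
  also have "\<dots> \<le> norm (flow U p (flow W q y) - flow W q y) + norm (flow W q y - y)" by norm
  also have "\<dots> \<le> K * \<bar>p\<bar> + K * \<bar>q\<bar>" by (intro add_mono flow_displacement U1 W1)
  finally have yx: "norm (y - x) \<le> K * r" by (simp add: r_def algebra_simps)
  have "norm ((p * q) *\<^sub>R (B y - B x)) \<le> r\<^sup>2 * (L * (K * r))"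
    using r yx bounded_lipschitzD[OF B(2)]
    by (auto intro!: mult_mono intro: order_trans[OF bounded_lipschitzD(5)[OF B(2)]])
  then have three: "norm ((p * q) *\<^sub>R (B y - B x)) \<le> L * K * r ^ 3"
    by (simp add: power2_eq_square power3_eq_cube algebra_simps)
  have "flow W q (flow U p y) - x - (p * q) *\<^sub>R B x =
     (flow W q (flow U p y) - (S + (p * q) *\<^sub>R DW y (U y))) -
     (flow U p (flow W q y) - (S + (p * q) *\<^sub>R DU y (W y))) + (p * q) *\<^sub>R (B y - B x)"
    by (simp add: undo B(1) algebra_simps)
  also have "norm \<dots> \<le> 4 * K ^ 3 * r ^ 3 + 4 * K ^ 3 * r ^ 3 + L * K * r ^ 3"
    by (intro norm_triangle_le add_mono three norm_triangle_le_diff one two)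
  finally show ?thesis unfolding y_def r_def by (simp add: algebra_simps)
qed

text \<open>Two first-order remainders, plus the cost of evaluating \<open>W\<close> at the end of
  the first leg instead of at \<open>x\<close>.\<close>

lemma sum_expansion:
  assumes U: "c2_field K U DU" and W: "c2_field K W DW"
  shows "norm (flow W h (flow U h x) - x - h *\<^sub>R (U x + W x)) \<le> 2 * K\<^sup>2 * \<bar>h\<bar>\<^sup>2"
proof -
  note U1 = c2_fieldD(1)[OF U] and W1 = c2_fieldD(1)[OF W] and K = bounded_lipschitzD[OF c2_fieldD(1)[OF W]]
  define y where "y = flow U h x"
  have "norm (h *\<^sub>R (W y - W x)) \<le> \<bar>h\<bar> * (K * (K * \<bar>h\<bar>))"
    using K flow_displacement[OF U1, of h x] unfolding y_def
    by (auto intro!: mult_left_mono intro: order_trans[OF K(5)])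
  then have three: "norm (h *\<^sub>R (W y - W x)) \<le> K\<^sup>2 * \<bar>h\<bar>\<^sup>2"
    by (simp add: power2_eq_square algebra_simps)
  have "flow W h y - x - h *\<^sub>R (U x + W x) =
     (flow W h y - y - h *\<^sub>R W y) + (flow U h x - x - h *\<^sub>R U x) + h *\<^sub>R (W y - W x)"
    by (simp add: y_def algebra_simps)
  also have "norm \<dots> \<le> K\<^sup>2 / 2 * \<bar>h\<bar>\<^sup>2 + K\<^sup>2 / 2 * \<bar>h\<bar>\<^sup>2 + K\<^sup>2 * \<bar>h\<bar>\<^sup>2"
    by (intro norm_triangle_le add_mono three flow_expansion1 U1 W1)
  finally show ?thesis unfolding y_def by (simp add: algebra_simps)
qed

section \<open>Brouwer's theorem with the dimension as a number\<close>

lemma tendsto_fun_iff: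
  fixes f :: "'b \<Rightarrow> 'i \<Rightarrow> 'a::topological_space"
  shows "(f \<longlongrightarrow> l) F \<longleftrightarrow> (\<forall>i. ((\<lambda>x. f x i) \<longlongrightarrow> l i) F)"
  using limitin_componentwise[of "\<lambda>_. euclidean" UNIV f l F]
  by (simp add: euclidean_product_topology)

text \<open>The library version fixes the dimension by a type, whereas here it depends on the number of
  training points; hence the detour through Kuhn's lemma.\<close>
lemma brouwer_unit_cube:
  fixes g :: "(nat \<Rightarrow> real) \<Rightarrow> nat \<Rightarrow> real"
  assumes cont: "\<And>i. i < n \<Longrightarrow> continuous_on UNIV (\<lambda>x. g x i)"
    and maps: "\<And>x i. (\<forall>j. 0 \<le> x j \<and> x j \<le> 1) \<Longrightarrow> i < n \<Longrightarrow> 0 \<le> g x i \<and> g x i \<le> 1"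
  obtains x where "\<forall>i. 0 \<le> x i \<and> x i \<le> 1" "\<forall>i<n. g x i = x i"
proof -
  \<comment> \<open>Vertices of the grid of mesh \<open>1 / p\<close>. Capping at \<open>p\<close>
    and filling the coordinates from \<open>n\<close> on with 0 keeps every vertex in the cube to
    which \<open>maps\<close> applies.\<close>
  define pt where "pt = (\<lambda>(p::nat) (q::nat \<Rightarrow> nat) i. if i < n then real (min (q i) p) / real p else 0)"
  have pt01: "0 \<le> pt p q j \<and> pt p q j \<le> 1" for p q j
    by (auto simp: pt_def divide_le_eq_1)
  \<comment> \<open>The first two branches are the boundary conditions of Kuhn's lemma. In all cases
    label 0 implies \<open>pt p q i \<le> g (pt p q) i\<close> and label 1 the reverse inequality,
    since \<open>g\<close> maps into the cube.\<close>
  define label :: "nat \<Rightarrow> (nat \<Rightarrow> nat) \<Rightarrow> nat \<Rightarrow> nat" where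
    "label = (\<lambda>p q i. if q i = 0 then 0 else if q i \<ge> p then 1 else if pt p q i \<le> g (pt p q) i then 0 else 1)"
  have lab0: "label p q i = 0" if "q i = 0" for p q i using that by (simp add: label_def)
  have lab1: "label (Suc p) q i = 1" if "q i = Suc p" for p q i using that by (simp add: label_def)
  have lab01: "label p q i = 0 \<or> label p q i = 1" for p q i by (simp add: label_def)
  define near where "near = (\<lambda>(q::nat \<Rightarrow> nat) r. \<forall>j<n. q j \<le> r j \<and> r j \<le> q j + 1)"
  have "\<exists>q r s. \<forall>i<n. q i < Suc p \<and> near q (r i) \<and> near q (s i) \<and>
      label (Suc p) (r i) i = 0 \<and> label (Suc p) (s i) i = 1" for p
  proof -
    obtain q where q: "\<forall>i<n. q i < Suc p"
      and rs: "\<forall>i<n. \<exists>r s. (\<forall>j<n. q j \<le> r j \<and> r j \<le> q j + 1) \<and>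
        (\<forall>j<n. q j \<le> s j \<and> s j \<le> q j + 1) \<and> label (Suc p) r i \<noteq> label (Suc p) s i"
    proof (rule kuhn_lemma[of "Suc p" n "label (Suc p)"])
      show "\<forall>x. (\<forall>i<n. x i \<le> Suc p) \<longrightarrow> (\<forall>i<n. label (Suc p) x i = (0::nat) \<or> label (Suc p) x i = 1)"
        using lab01 by blast
    qed (use lab0 lab1 in simp_all)
    have "\<forall>i. \<exists>r s. i < n \<longrightarrow> near q r \<and> near q s \<and> label (Suc p) r i = 0 \<and> label (Suc p) s i = 1"
    proof
      fix i
      show "\<exists>r s. i < n \<longrightarrow> near q r \<and> near q s \<and> label (Suc p) r i = 0 \<and> label (Suc p) s i = 1"
      proof (cases "i < n")
        case True
        then obtain r s where *: "near q r" "near q s" "label (Suc p) r i \<noteq> label (Suc p) s i"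
          using rs unfolding near_def by blast
        show ?thesis
        proof (cases "label (Suc p) r i = 0")
          case True
          then show ?thesis using * lab01[of "Suc p" s i] by force
        next
          case False
          then show ?thesis using * lab01[of "Suc p" r i] lab01[of "Suc p" s i] by force
        qed
      qed simp
    qed
    from choice[OF this] obtain r where "\<forall>i. \<exists>s. i < n \<longrightarrow> near q (r i) \<and> near q s \<and>
        label (Suc p) (r i) i = 0 \<and> label (Suc p) s i = 1" by blast
    from choice[OF this] q show ?thesis by blast
  qed
  then have "\<forall>p. \<exists>q r s. \<forall>i<n. q i < Suc p \<and> near q (r i) \<and> near q (s i) \<and>
      label (Suc p) (r i) i = 0 \<and> label (Suc p) (s i) i = 1" by blast
  from choice[OF this] obtain q where "\<forall>p. \<exists>r s. \<forall>i<n. q p i < Suc p \<and> near (q p) (r i) \<and> near (q p) (s i) \<and>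
      label (Suc p) (r i) i = 0 \<and> label (Suc p) (s i) i = 1" by blast
  from choice[OF this] obtain r where "\<forall>p. \<exists>s. \<forall>i<n. q p i < Suc p \<and> near (q p) (r p i) \<and> near (q p) (s i) \<and>
      label (Suc p) (r p i) i = 0 \<and> label (Suc p) (s i) i = 1" by blast
  from choice[OF this] obtain s where qrs: "\<forall>p. \<forall>i<n. q p i < Suc p \<and> near (q p) (r p i) \<and> near (q p) (s p i) \<and>
      label (Suc p) (r p i) i = 0 \<and> label (Suc p) (s p i) i = 1" by blast
  have r: "\<And>p i j. i < n \<Longrightarrow> j < n \<Longrightarrow> q p j \<le> r p i j \<and> r p i j \<le> q p j + 1"
    and s: "\<And>p i j. i < n \<Longrightarrow> j < n \<Longrightarrow> q p j \<le> s p i j \<and> s p i j \<le> q p j + 1"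
    using qrs unfolding near_def by blast+
  have lr: "\<And>p i. i < n \<Longrightarrow> label (Suc p) (r p i) i = 0" and ls: "\<And>p i. i < n \<Longrightarrow> label (Suc p) (s p i) i = 1"
    using qrs by blast+
  define K :: "(nat \<Rightarrow> real) set" where "K = Pi\<^sub>E UNIV (\<lambda>_. {0..1})"
  have "compactin (product_topology (\<lambda>_. euclidean) UNIV) K"
    unfolding K_def by (subst compactin_PiE) auto
  then have "seq_compact K"
    unfolding euclidean_product_topology compactin_euclidean_iff by (rule compact_imp_seq_compact)
  moreover have "\<forall>p. pt (Suc p) (q p) \<in> K" using pt01 by (auto simp: K_def)
  ultimately obtain z \<sigma> where z: "z \<in> K" "strict_mono \<sigma>" "((\<lambda>p. pt (Suc p) (q p)) \<circ> \<sigma>) \<longlonglongrightarrow> z"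
    unfolding seq_compact_def by metis
  have zi: "(\<lambda>p. pt (Suc (\<sigma> p)) (q (\<sigma> p)) j) \<longlonglongrightarrow> z j" for j
    using z(3) by (simp add: tendsto_fun_iff o_def)
  \<comment> \<open>All vertices of a cell differ from its corner by at most one mesh width, so they
    share the limit of the corners.\<close>
  have lim_near: "(\<lambda>p. pt (Suc (\<sigma> p)) (a p)) \<longlonglongrightarrow> z"
    if a: "\<And>p j. j < n \<Longrightarrow> q (\<sigma> p) j \<le> a p j \<and> a p j \<le> q (\<sigma> p) j + 1" for a
  proof (rule tendsto_fun_iff[THEN iffD2, rule_format])
    fix j
    have "\<bar>pt (Suc (\<sigma> p)) (a p) j - pt (Suc (\<sigma> p)) (q (\<sigma> p)) j\<bar> \<le> inverse (real (Suc p))" for p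
    proof (cases "j < n")
      case True
      have "\<bar>real (min (a p j) (Suc (\<sigma> p))) - real (min (q (\<sigma> p) j) (Suc (\<sigma> p)))\<bar> \<le> 1"
        using a[OF True, of p] by auto
      then have "\<bar>pt (Suc (\<sigma> p)) (a p) j - pt (Suc (\<sigma> p)) (q (\<sigma> p)) j\<bar> \<le> 1 / real (Suc (\<sigma> p))"
        using True unfolding pt_def by (auto simp flip: diff_divide_distrib simp: abs_div divide_right_mono simp del: of_nat_Suc)
      also have "\<dots> \<le> inverse (real (Suc p))"
        using seq_suble[OF z(2), of p] by (simp add: divide_simps)
      finally show ?thesis .
    qed (auto simp: pt_def)
    then have "(\<lambda>p. pt (Suc (\<sigma> p)) (a p) j - pt (Suc (\<sigma> p)) (q (\<sigma> p)) j) \<longlonglongrightarrow> 0"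
      by (intro Lim_null_comparison[OF _ LIMSEQ_inverse_real_of_nat]) auto
    from tendsto_add[OF this zi[of j]] show "(\<lambda>p. pt (Suc (\<sigma> p)) (a p) j) \<longlonglongrightarrow> z j" by simp
  qed
  \<comment> \<open>Each direction \<open>i\<close> has a vertex of label 0 and one of label 1 in
    every cell; their opposite inequalities meet in the limit.\<close>
  have fix_eq: "g z i = z i" if i: "i < n" for i
  proof (rule antisym)
    have c: "isCont (\<lambda>x. g x i - x i) z"
      using continuous_on_diff[OF cont[OF i] continuous_on_product_coordinates[of i]]
      by (simp add: continuous_on_eq_continuous_at)
    have "(\<lambda>p. g (pt (Suc (\<sigma> p)) (r (\<sigma> p) i)) i - pt (Suc (\<sigma> p)) (r (\<sigma> p) i) i) \<longlonglongrightarrow> g z i - z i"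
      using isCont_tendsto_compose[OF c lim_near[of "\<lambda>p. r (\<sigma> p) i"]] r[OF i] by auto
    moreover have "0 \<le> g (pt (Suc p) (r p i)) i - pt (Suc p) (r p i) i" for p
      using lr[OF i, of p] maps[OF _ i, of "pt (Suc p) (r p i)"] pt01 i
      by (auto simp: label_def split: if_splits) (auto simp: pt_def)
    ultimately show "z i \<le> g z i" using LIMSEQ_le_const by fastforce
    have "(\<lambda>p. g (pt (Suc (\<sigma> p)) (s (\<sigma> p) i)) i - pt (Suc (\<sigma> p)) (s (\<sigma> p) i) i) \<longlonglongrightarrow> g z i - z i"
      using isCont_tendsto_compose[OF c lim_near[of "\<lambda>p. s (\<sigma> p) i"]] s[OF i] by auto
    moreover have "g (pt (Suc p) (s p i)) i - pt (Suc p) (s p i) i \<le> 0" for p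
      using ls[OF i, of p] maps[OF _ i, of "pt (Suc p) (s p i)"] pt01 i
      by (auto simp: label_def split: if_splits) (auto simp: pt_def min_def)
    ultimately show "g z i \<le> z i" using LIMSEQ_le_const2 by fastforce
  qed
  have "\<forall>i. 0 \<le> z i \<and> z i \<le> 1" using z(1) by (auto simp: K_def PiE_def Pi_iff)
  with fix_eq show thesis by (intro that) auto
qed

text \<open>A solution of \<open>G t = w\<close> is a fixed point of the map sending
  \<open>t\<close> to \<open>w - (G t - t)\<close>. This map preserves the cube of half-width
  \<open>\<delta>\<close>, as \<open>w\<close> and \<open>G t - t\<close> are each at most
  \<open>\<delta> / 2\<close>; the rest is rescaling to the unit cube.\<close>

lemma near_identity_hits:
  fixes G :: "(nat \<Rightarrow> real) \<Rightarrow> nat \<Rightarrow> real"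
  assumes d: "\<delta> > 0" and cont: "\<And>i. i < n \<Longrightarrow> continuous_on UNIV (\<lambda>t. G t i)"
    and near: "\<And>t i. (\<forall>j. \<bar>t j\<bar> \<le> \<delta>) \<Longrightarrow> i < n \<Longrightarrow> \<bar>G t i - t i\<bar> \<le> \<delta> / 2"
    and w: "\<And>i. i < n \<Longrightarrow> \<bar>w i\<bar> \<le> \<delta> / 2"
  obtains t where "\<forall>j. \<bar>t j\<bar> \<le> \<delta>" "\<forall>i<n. G t i = w i"
proof -
  define S where "S = (\<lambda>(x::nat \<Rightarrow> real) j. \<delta> * (2 * x j - 1))"
  have S: "\<bar>S x j\<bar> \<le> \<delta>" if "0 \<le> x j \<and> x j \<le> 1" for x j
  proof -
    have "\<bar>2 * x j - 1\<bar> \<le> 1" using that by auto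
    then have "\<delta> * \<bar>2 * x j - 1\<bar> \<le> \<delta> * 1" using d by (intro mult_left_mono) auto
    then show ?thesis using d by (simp add: S_def abs_mult)
  qed
  have contS: "continuous_on UNIV S"
    unfolding S_def
    by (intro continuous_on_coordinatewise_then_product continuous_intros continuous_on_product_coordinates)
  obtain x where x: "\<forall>i. 0 \<le> x i \<and> x i \<le> 1"
      "\<forall>i<n. (w i - (G (S x) i - S x i)) / (2 * \<delta>) + 1/2 = x i"
  proof (rule brouwer_unit_cube[of n "\<lambda>x i. (w i - (G (S x) i - S x i)) / (2 * \<delta>) + 1/2"])
    fix i assume i: "i < n"
    have "continuous_on UNIV (\<lambda>x. S x i)"
      unfolding S_def by (intro continuous_intros continuous_on_product_coordinates)
    then show "continuous_on UNIV (\<lambda>x. (w i - (G (S x) i - S x i)) / (2 * \<delta>) + 1/2)"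
      using d by (intro continuous_intros continuous_on_compose2[OF cont[OF i] contS]) auto
    fix x :: "nat \<Rightarrow> real" assume "\<forall>j. 0 \<le> x j \<and> x j \<le> 1"
    then have "\<bar>G (S x) i - S x i\<bar> \<le> \<delta> / 2" using S by (intro near) (auto simp: i)
    with w[OF i] have "\<bar>w i - (G (S x) i - S x i)\<bar> \<le> \<delta>" by linarith
    then show "0 \<le> (w i - (G (S x) i - S x i)) / (2 * \<delta>) + 1/2 \<and> (w i - (G (S x) i - S x i)) / (2 * \<delta>) + 1/2 \<le> 1"
      using d by (auto simp: field_simps abs_le_iff)
  qed (use that in auto)
  have "G (S x) i = w i" if i: "i < n" for i
  proof -
    have "S x i = \<delta> * (2 * ((w i - (G (S x) i - S x i)) / (2 * \<delta>) + 1/2) - 1)"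
      using x(2) i unfolding S_def by auto
    also have "\<dots> = w i - (G (S x) i - S x i)" using d by (simp add: field_simps)
    finally show ?thesis by simp
  qed
  then show thesis using that[of "S x"] S x(1) by auto
qed

section \<open>Compositions of flows and the Lie algebra\<close>

text \<open>The endpoint maps of piecewise constant controls with one active field at a time;
  negative times correspond to negative controls.\<close>

inductive_set flow_group :: "('d \<Rightarrow> 'a::euclidean_space \<Rightarrow> 'a) \<Rightarrow> ('a \<Rightarrow> 'a) set"
  for V :: "'d \<Rightarrow> 'a \<Rightarrow> 'a" where
  id: "(\<lambda>x. x) \<in> flow_group V"
| step: "g \<in> flow_group V \<Longrightarrow> (\<lambda>x. flow (V i) t (g x)) \<in> flow_group V"

lemma flow_group_compose:
  assumes "f \<in> flow_group V" "g \<in> flow_group V"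
  shows "(\<lambda>x. f (g x)) \<in> flow_group V"
  using assms by (induction rule: flow_group.induct) (auto intro: flow_group.intros)

lemma flow_group_funpow: "f \<in> flow_group V \<Longrightarrow> (f ^^ n) \<in> flow_group V"
  by (induction n) (auto intro: flow_group.id[unfolded id_def[symmetric]] flow_group_compose[unfolded o_def[symmetric]] simp: id_def[symmetric])

text \<open>The error is uniform in space because approximations are iterated at moving points, and
  the family is continuous in time because the times are the unknowns of Brouwer's theorem.\<close>

definition approximable :: "('d \<Rightarrow> 'a::euclidean_space \<Rightarrow> 'a) \<Rightarrow> ('a \<Rightarrow> 'a) \<Rightarrow> bool" where
  "approximable V L \<longleftrightarrow> (\<forall>T>0. \<forall>e>0. \<exists>F. jointly_continuous F \<and> (\<forall>t. F t \<in> flow_group V) \<and>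
     (\<forall>t x. \<bar>t\<bar> \<le> T \<longrightarrow> norm (F t x - flow L t x) \<le> e))"

lemma approximableE:
  assumes "approximable V L" "T > 0" "e > 0"
  obtains F where "jointly_continuous F" "\<And>t. F t \<in> flow_group V"
    "\<And>t x. \<bar>t\<bar> \<le> T \<Longrightarrow> norm (F t x - flow L t x) \<le> e"
  using assms unfolding approximable_def by blast

lemma norm_diff_via: "norm (a - c) \<le> norm (a - b) + norm (b - c :: 'a::real_normed_vector)"
  using norm_triangle_ineq[of "a - b" "b - c"] by simp

text \<open>Error propagation of a one-step method: each step adds a local error
  \<open>\<delta>\<close>, and the exact flow stretches the earlier errors by at most
  \<open>exp (K * \<bar>h\<bar>)\<close>.\<close>

lemma funpow_flow_error:
  assumes L: "bounded_lipschitz K L" and \<psi>: "\<And>x. norm (\<psi> x - flow L h x) \<le> \<delta>"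
  shows "norm ((\<psi> ^^ n) x - flow L (n * h) x) \<le> n * \<delta> * exp (K * (n * \<bar>h\<bar>))"
proof (induction n)
  case 0
  then show ?case by (simp add: flow_curve(1)[OF L])
next
  case (Suc n)
  have \<delta>: "\<delta> \<ge> 0" using \<psi>[of 0] norm_ge_zero order_trans by blast
  have "flow L (Suc n * h) x = flow L h (flow L (n * h) x)"
    using flow_add[OF L, of h "n * h" x] by (simp add: algebra_simps)
  then have "norm ((\<psi> ^^ Suc n) x - flow L (Suc n * h) x) \<le>
      norm (\<psi> ((\<psi> ^^ n) x) - flow L h ((\<psi> ^^ n) x)) + norm (flow L h ((\<psi> ^^ n) x) - flow L h (flow L (n * h) x))"
    by (simp only: funpow.simps o_apply) (rule norm_diff_via)
  also have "\<dots> \<le> \<delta> + exp (K * \<bar>h\<bar>) * (n * \<delta> * exp (K * (n * \<bar>h\<bar>)))"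
    by (intro add_mono \<psi> order_trans[OF flow_lipschitz[OF L]] mult_left_mono Suc.IH) auto
  also have "\<dots> = \<delta> + n * \<delta> * exp (K * (Suc n * \<bar>h\<bar>))"
    by (simp add: algebra_simps exp_add)
  also have "\<dots> \<le> \<delta> * exp (K * (Suc n * \<bar>h\<bar>)) + n * \<delta> * exp (K * (Suc n * \<bar>h\<bar>))"
  proof -
    have "0 \<le> K * (Suc n * \<bar>h\<bar>)" using bounded_lipschitzD(3)[OF L] by simp
    then have "1 \<le> exp (K * (Suc n * \<bar>h\<bar>))" by simp
    from mult_left_mono[OF this \<delta>] show ?thesis by simp
  qed
  finally show ?case by (simp add: algebra_simps)
qed

lemma jointly_continuous_funpow:
  fixes \<psi> :: "real \<Rightarrow> 'a::euclidean_space \<Rightarrow> 'a"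
  assumes "jointly_continuous \<psi>"
  shows "jointly_continuous (\<lambda>t. \<psi> (t / c) ^^ n)"
proof (induction n)
  case 0
  show ?case by (auto simp: jointly_continuous_def intro!: continuous_intros)
next
  case (Suc n)
  have "continuous_on UNIV (\<lambda>p. \<psi> (fst p / c) ((\<psi> (fst p / c) ^^ n) (snd p)))"
  proof (rule jointly_continuous_compose[OF assms])
    show "continuous_on UNIV (\<lambda>p::real \<times> 'a. fst p / c)"
      unfolding divide_inverse by (intro continuous_intros)
  qed (use Suc in \<open>simp add: jointly_continuous_def\<close>)
  then show ?case by (simp add: jointly_continuous_def)
qed

text \<open>Consistency implies convergence: a local error \<open>o(h)\<close> per step is summed
  over about \<open>T / h\<close> steps. \<open>\<psi>\<close> may depend on \<open>h1\<close>,
  because the flows entering it are themselves only approximated, with an accuracy fixed after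
  \<open>h1\<close>.\<close>

lemma approximable_by_scheme:
  assumes L: "bounded_lipschitz K L"
    and scheme: "\<And>\<eta>. \<eta> > 0 \<Longrightarrow> \<exists>h0>0. \<forall>h1. 0 < h1 \<and> h1 \<le> h0 \<longrightarrow>
      (\<exists>\<psi>. jointly_continuous \<psi> \<and> (\<forall>h. \<psi> h \<in> flow_group V) \<and>
        (\<forall>h x. \<bar>h\<bar> \<le> h1 \<longrightarrow> norm (\<psi> h x - flow L h x) \<le> \<eta> * h1))"
  shows "approximable V L"
  unfolding approximable_def
proof (intro allI impI)
  fix T e :: real assume T: "T > 0" and e: "e > 0"
  note K = bounded_lipschitzD[OF L]
  \<comment> \<open>The local errors of \<open>n\<close> steps add up to
    \<open>n * \<eta> * h1 = \<eta> * T\<close>, enlarged by at most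
    \<open>exp (K * T)\<close>.\<close>
  define \<eta> where "\<eta> = e / (T * exp (K * T))"
  have \<eta>: "\<eta> > 0" using T e by (simp add: \<eta>_def)
  obtain h0 where h0: "h0 > 0" "\<And>h1. 0 < h1 \<Longrightarrow> h1 \<le> h0 \<Longrightarrow>
      (\<exists>\<psi>. jointly_continuous \<psi> \<and> (\<forall>h. \<psi> h \<in> flow_group V) \<and>
        (\<forall>h x. \<bar>h\<bar> \<le> h1 \<longrightarrow> norm (\<psi> h x - flow L h x) \<le> \<eta> * h1))"
    using scheme[OF \<eta>] by blast
  \<comment> \<open>The number of steps depends on \<open>T\<close> and not on \<open>t\<close>;
    only the step size \<open>t / n\<close> varies, which keeps the iterate continuous in
    \<open>t\<close>.\<close>
  define n where "n = nat \<lceil>T / h0\<rceil> + 1"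
  have n: "n > 0" "T / h0 \<le> n" unfolding n_def by linarith+
  define h1 where "h1 = T / n"
  have h1: "h1 > 0" "h1 \<le> h0" "n * h1 = T" using n T h0(1) by (auto simp: h1_def field_simps)
  obtain \<psi> where \<psi>: "jointly_continuous \<psi>" "\<And>h. \<psi> h \<in> flow_group V"
      "\<And>h x. \<bar>h\<bar> \<le> h1 \<Longrightarrow> norm (\<psi> h x - flow L h x) \<le> \<eta> * h1"
    using h0(2)[OF h1(1,2)] by blast
  show "\<exists>F. jointly_continuous F \<and> (\<forall>t. F t \<in> flow_group V) \<and>
     (\<forall>t x. \<bar>t\<bar> \<le> T \<longrightarrow> norm (F t x - flow L t x) \<le> e)"
  proof (intro exI conjI allI impI)
    show "jointly_continuous (\<lambda>t. \<psi> (t / n) ^^ n)" by (rule jointly_continuous_funpow[OF \<psi>(1)])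
    show "\<psi> (t / n) ^^ n \<in> flow_group V" for t by (rule flow_group_funpow[OF \<psi>(2)])
    fix t x assume t: "\<bar>t\<bar> \<le> T"
    have nt: "n * (t / n) = t" "n * \<bar>t / n\<bar> = \<bar>t\<bar>" using n by (auto simp: abs_divide)
    have "\<bar>t / n\<bar> \<le> h1" using t n by (simp add: h1_def abs_divide divide_right_mono)
    from funpow_flow_error[OF L \<psi>(3)[OF this], of n x]
    have "norm ((\<psi> (t / n) ^^ n) x - flow L t x) \<le> n * (\<eta> * h1) * exp (K * \<bar>t\<bar>)"
      unfolding nt .
    also have "n * (\<eta> * h1) = \<eta> * T" using h1(3) by simp
    also have "\<eta> * T * exp (K * \<bar>t\<bar>) \<le> \<eta> * T * exp (K * T)"
      using \<eta> T t K by (intro mult_left_mono) auto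
    also have "\<dots> = e" using T by (simp add: \<eta>_def)
    finally show "norm ((\<psi> (t / n) ^^ n) x - flow L t x) \<le> e" .
  qed
qed

section \<open>Approximability under scaling, sums and brackets\<close>

lemma approximable_generator:
  assumes "bounded_lipschitz K (V i)"
  shows "approximable V (V i)"
  unfolding approximable_def
proof (intro allI impI)
  fix T e :: real assume "e > 0"
  then show "\<exists>F. jointly_continuous F \<and> (\<forall>t. F t \<in> flow_group V) \<and>
     (\<forall>t x. \<bar>t\<bar> \<le> T \<longrightarrow> norm (F t x - flow (V i) t x) \<le> e)"
    using jointly_continuous_flow[OF assms] flow_group.step[OF flow_group.id, of V i]
    by (intro exI[of _ "flow (V i)"]) auto
qed

lemma approximable_scale:
  assumes A: "approximable V L" and L: "bounded_lipschitz K L" "bounded_lipschitz K' (\<lambda>x. c *\<^sub>R L x)"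
  shows "approximable V (\<lambda>x. c *\<^sub>R L x)"
  unfolding approximable_def
proof (intro allI impI)
  fix T e :: real assume T: "T > 0" and e: "e > 0"
  \<comment> \<open>The 1 keeps the time horizon positive when \<open>c = 0\<close>.\<close>
  have "\<bar>c\<bar> * T + 1 > 0" using T by (simp add: add_nonneg_pos)
  then obtain F where F: "jointly_continuous F" "\<And>t. F t \<in> flow_group V"
    "\<And>t x. \<bar>t\<bar> \<le> \<bar>c\<bar> * T + 1 \<Longrightarrow> norm (F t x - flow L t x) \<le> e"
    using approximableE[OF A _ e] by metis
  show "\<exists>F. jointly_continuous F \<and> (\<forall>t. F t \<in> flow_group V) \<and>
     (\<forall>t x. \<bar>t\<bar> \<le> T \<longrightarrow> norm (F t x - flow (\<lambda>x. c *\<^sub>R L x) t x) \<le> e)"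
  proof (intro exI conjI allI impI)
    show "jointly_continuous (\<lambda>t. F (c * t))"
      unfolding jointly_continuous_def
      by (intro jointly_continuous_compose[OF F(1)] continuous_intros)
    show "F (c * t) \<in> flow_group V" for t by (rule F)
    fix t x assume "\<bar>t\<bar> \<le> T"
    then have "\<bar>c * t\<bar> \<le> \<bar>c\<bar> * T + 1"
      by (simp add: abs_mult mult_left_mono add_increasing2)
    then show "norm (F (c * t) x - flow (\<lambda>x. c *\<^sub>R L x) t x) \<le> e"
      unfolding flow_scale[OF L] by (rule F)
  qed
qed

lemma norm_compose_diff_le:
  assumes "\<And>x. norm (f x - f' x) \<le> a" "norm (u - v) \<le> b" "\<And>x y. norm (f' x - f' y) \<le> M * norm (x - y)" "M \<ge> 0"
  shows "norm (f u - f' v) \<le> a + M * b"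
proof -
  have "norm (f u - f' v) \<le> norm (f u - f' u) + norm (f' u - f' v)" by (rule norm_diff_via)
  also have "\<dots> \<le> a + M * b"
    using assms by (intro add_mono) (auto intro!: order_trans[OF assms(3)] mult_left_mono)
  finally show ?thesis .
qed

lemma flow_lipschitz_short:
  assumes V: "bounded_lipschitz K V" and t: "\<bar>t\<bar> \<le> 1"
  shows "norm (flow V t x - flow V t y) \<le> exp K * norm (x - y)"
proof -
  have "exp (K * \<bar>t\<bar>) \<le> exp K" using bounded_lipschitzD(3)[OF V] t by (simp add: mult_left_le)
  then show ?thesis
    using flow_lipschitz[OF V, of t x y] by (meson mult_right_mono norm_ge_zero order_trans)
qed

text \<open>Lie-Trotter splitting: composing the two flows for time \<open>h\<close> misses the flow
  of the sum by a multiple of the square of \<open>h\<close>.\<close>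

lemma approximable_add:
  assumes U: "c2_field K U DU" "approximable V U" and W: "c2_field K W DW" "approximable V W"
    and L: "bounded_lipschitz L (\<lambda>x. U x + W x)"
  shows "approximable V (\<lambda>x. U x + W x)"
proof (rule approximable_by_scheme[OF L])
  note U1 = c2_fieldD(1)[OF U(1)] and W1 = c2_fieldD(1)[OF W(1)]
  fix \<eta> :: real assume \<eta>: "\<eta> > 0"
  define C where "C = 2 * K\<^sup>2 + L\<^sup>2 / 2"
  have C: "C > 0" using bounded_lipschitzD(2)[OF L] by (simp add: C_def add_nonneg_pos)
  define h0 where "h0 = min 1 (\<eta> / (2 * C))"
  have h0: "h0 > 0" "h0 \<le> 1" "C * h0 \<le> \<eta> / 2"
  proof -
    have "C * h0 \<le> C * (\<eta> / (2 * C))" unfolding h0_def using C by (intro mult_left_mono) auto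
    then show "C * h0 \<le> \<eta> / 2" using C by simp
  qed (use C \<eta> in \<open>auto simp: h0_def\<close>)
  show "\<exists>h0>0. \<forall>h1. 0 < h1 \<and> h1 \<le> h0 \<longrightarrow>
      (\<exists>\<psi>. jointly_continuous \<psi> \<and> (\<forall>h. \<psi> h \<in> flow_group V) \<and>
        (\<forall>h x. \<bar>h\<bar> \<le> h1 \<longrightarrow> norm (\<psi> h x - flow (\<lambda>x. U x + W x) h x) \<le> \<eta> * h1))"
  proof (rule exI[of _ h0], intro conjI allI impI h0(1))
    fix h1 assume h1: "0 < h1 \<and> h1 \<le> h0"
    define m where "m = 1 + exp K"
    \<comment> \<open>Half of the allowed local error pays for replacing the flows of
      \<open>U\<close> and \<open>W\<close> by approximations, the inner error being stretched by
      \<open>exp K\<close>; the other half pays for the splitting.\<close>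
    define e where "e = \<eta> * h1 / (2 * m)"
    have e: "e > 0" "e + exp K * e = \<eta> * h1 / 2"
    proof -
      have m: "m > 0" by (simp add: m_def add_pos_pos)
      then show "e > 0" using \<eta> h1 by (simp add: e_def)
      have "e + exp K * e = e * m" by (simp add: m_def algebra_simps)
      then show "e + exp K * e = \<eta> * h1 / 2" using m by (simp add: e_def)
    qed
    obtain F where F: "jointly_continuous F" "\<And>t. F t \<in> flow_group V"
      "\<And>t x. \<bar>t\<bar> \<le> h1 \<Longrightarrow> norm (F t x - flow U t x) \<le> e"
      using approximableE[OF U(2) _ e(1), of h1] h1 by metis
    obtain G where G: "jointly_continuous G" "\<And>t. G t \<in> flow_group V"
      "\<And>t x. \<bar>t\<bar> \<le> h1 \<Longrightarrow> norm (G t x - flow W t x) \<le> e"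
      using approximableE[OF W(2) _ e(1), of h1] h1 by metis
    show "\<exists>\<psi>. jointly_continuous \<psi> \<and> (\<forall>h. \<psi> h \<in> flow_group V) \<and>
        (\<forall>h x. \<bar>h\<bar> \<le> h1 \<longrightarrow> norm (\<psi> h x - flow (\<lambda>x. U x + W x) h x) \<le> \<eta> * h1)"
    proof (intro exI conjI allI impI)
      show "jointly_continuous (\<lambda>h x. G h (F h x))"
        unfolding jointly_continuous_def
        by (intro jointly_continuous_compose[OF G(1)] jointly_continuous_compose[OF F(1)] continuous_intros)
      show "(\<lambda>x. G h (F h x)) \<in> flow_group V" for h by (rule flow_group_compose[OF G(2) F(2)])
      fix h x assume h: "\<bar>h\<bar> \<le> h1"
      have h': "\<bar>h\<bar> \<le> 1" using h h1 h0 by linarith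
      have step1: "norm (G h (F h x) - flow W h (flow U h x)) \<le> \<eta> * h1 / 2"
        unfolding e(2)[symmetric] using h
        by (intro norm_compose_diff_le G(3) F(3) flow_lipschitz_short[OF W1 h']) auto
      have step2: "norm (flow W h (flow U h x) - x - h *\<^sub>R (U x + W x)) \<le> 2 * K\<^sup>2 * \<bar>h\<bar>\<^sup>2"
        by (rule sum_expansion[OF U(1) W(1)])
      have step3: "norm (flow (\<lambda>x. U x + W x) h x - x - h *\<^sub>R (U x + W x)) \<le> L\<^sup>2 / 2 * \<bar>h\<bar>\<^sup>2"
        by (rule flow_expansion1[OF L])
      have "norm (flow W h (flow U h x) - flow (\<lambda>x. U x + W x) h x) \<le> C * \<bar>h\<bar>\<^sup>2"
        using norm_triangle_le_diff[OF add_mono[OF step2 step3]] by (simp add: C_def algebra_simps)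
      also have "\<dots> \<le> C * (h0 * h1)"
        unfolding power2_eq_square using C h h1 by (intro mult_left_mono mult_mono) auto
      also have "\<dots> \<le> \<eta> / 2 * h1" using mult_right_mono[OF h0(3), of h1] h1 by (simp add: mult.assoc)
      finally have step4: "norm (flow W h (flow U h x) - flow (\<lambda>x. U x + W x) h x) \<le> \<eta> / 2 * h1" .
      show "norm (G h (F h x) - flow (\<lambda>x. U x + W x) h x) \<le> \<eta> * h1"
        using norm_triangle_mono[OF step1 step4] by simp
    qed
  qed
qed

text \<open>The group commutator with times whose product is \<open>h\<close> moves by
  \<open>h *\<^sub>R B x\<close> up to an error of order 3/2 in \<open>\<bar>h\<bar>\<close>, still
  \<open>o(h)\<close>.\<close>

lemma approximable_bracket:
  assumes U: "c2_field K U DU" "approximable V U" and W: "c2_field K W DW" "approximable V W"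
    and B: "\<And>x. B x = DW x (U x) - DU x (W x)" "bounded_lipschitz L B"
  shows "approximable V B"
proof (rule approximable_by_scheme[OF B(2)])
  note U1 = c2_fieldD(1)[OF U(1)] and W1 = c2_fieldD(1)[OF W(1)]
  note K = bounded_lipschitzD[OF U1] and L = bounded_lipschitzD[OF B(2)]
  fix \<eta> :: real assume \<eta>: "\<eta> > 0"
  \<comment> \<open>The 8 is that of \<open>(s + s) ^ 3\<close> with
    \<open>s = sqrt \<bar>h\<bar>\<close>. The last summand is the second-order error of the exact
    flow of \<open>B\<close>, where \<open>\<bar>h\<bar>\<^sup>2 \<le> s ^ 3\<close> for short
    times.\<close>
  define C where "C = (8 * K ^ 3 + L * K) * 8 + L\<^sup>2 / 2"
  have C: "C > 0" using K(2) L(2) by (simp add: C_def add_nonneg_pos)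
  define h0 where "h0 = min 1 ((\<eta> / (2 * C))\<^sup>2)"
  have h0: "h0 > 0" "h0 \<le> 1" "C * sqrt h0 \<le> \<eta> / 2"
  proof -
    have "sqrt h0 \<le> sqrt ((\<eta> / (2 * C))\<^sup>2)" unfolding h0_def by (intro real_sqrt_le_mono) auto
    also have "\<dots> = \<eta> / (2 * C)" using C \<eta> by simp
    finally have "C * sqrt h0 \<le> C * (\<eta> / (2 * C))" using C by (intro mult_left_mono) auto
    then show "C * sqrt h0 \<le> \<eta> / 2" using C by simp
  qed (use C \<eta> in \<open>auto simp: h0_def\<close>)
  show "\<exists>h0>0. \<forall>h1. 0 < h1 \<and> h1 \<le> h0 \<longrightarrow>
      (\<exists>\<psi>. jointly_continuous \<psi> \<and> (\<forall>h. \<psi> h \<in> flow_group V) \<and>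
        (\<forall>h x. \<bar>h\<bar> \<le> h1 \<longrightarrow> norm (\<psi> h x - flow B h x) \<le> \<eta> * h1))"
  proof (rule exI[of _ h0], intro conjI allI impI h0(1))
    fix h1 assume h1: "0 < h1 \<and> h1 \<le> h0"
    define M where "M = exp K"
    have M: "M \<ge> 0" by (simp add: M_def)
    \<comment> \<open>An error in any of the four approximate flows passes through the later exact
      flows, each with Lipschitz constant at most \<open>M\<close> as all times are at most 1;
      \<open>m\<close> is the resulting total amplification.\<close>
    define m where "m = 1 + M * (1 + M * (1 + M))"
    have m: "m > 0" using M by (simp add: m_def add_pos_nonneg)
    define e where "e = \<eta> * h1 / (2 * m)"
    have e: "e > 0" "e + M * (e + M * (e + M * e)) = \<eta> * h1 / 2"
    proof -
      show "e > 0" using m \<eta> h1 by (simp add: e_def)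
      have "e + M * (e + M * (e + M * e)) = e * m" by (simp add: m_def algebra_simps)
      then show "e + M * (e + M * (e + M * e)) = \<eta> * h1 / 2" using m by (simp add: e_def)
    qed
    obtain F where F: "jointly_continuous F" "\<And>t. F t \<in> flow_group V"
      "\<And>t x. \<bar>t\<bar> \<le> 1 \<Longrightarrow> norm (F t x - flow U t x) \<le> e"
      using approximableE[OF U(2) _ e(1), of 1] by (metis zero_less_one)
    obtain G where G: "jointly_continuous G" "\<And>t. G t \<in> flow_group V"
      "\<And>t x. \<bar>t\<bar> \<le> 1 \<Longrightarrow> norm (G t x - flow W t x) \<le> e"
      using approximableE[OF W(2) _ e(1), of 1] by (metis zero_less_one)
    \<comment> \<open>The function \<open>sqrt\<close> is odd, so \<open>q\<close> carries the sign
      of \<open>h\<close>: the product is \<open>h\<close> for both signs, and both times stay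
      continuous at 0.\<close>
    define p where "p = (\<lambda>h::real. sqrt \<bar>h\<bar>)"
    define q where "q = (\<lambda>h::real. sqrt h)"
    have pq: "p h * q h = h" "\<bar>p h\<bar> = sqrt \<bar>h\<bar>" "\<bar>q h\<bar> = sqrt \<bar>h\<bar>" for h
    proof -
      show "p h * q h = h"
      proof (cases "h \<ge> 0")
        case False
        then have "p h * q h = - (sqrt (-h) * sqrt (-h))" by (simp add: p_def q_def real_sqrt_minus)
        then show ?thesis using False by simp
      qed (simp add: p_def q_def)
      show "\<bar>p h\<bar> = sqrt \<bar>h\<bar>" by (simp add: p_def)
      show "\<bar>q h\<bar> = sqrt \<bar>h\<bar>"
        by (cases "h \<ge> 0") (simp_all add: q_def real_sqrt_minus[symmetric] abs_of_neg)
    qed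
    define \<psi> where "\<psi> = (\<lambda>h x. G (q h) (F (p h) (G (- q h) (F (- p h) x))))"
    show "\<exists>\<psi>. jointly_continuous \<psi> \<and> (\<forall>h. \<psi> h \<in> flow_group V) \<and>
        (\<forall>h x. \<bar>h\<bar> \<le> h1 \<longrightarrow> norm (\<psi> h x - flow B h x) \<le> \<eta> * h1)"
    proof (intro exI conjI allI impI)
      show "jointly_continuous \<psi>"
        unfolding jointly_continuous_def \<psi>_def p_def q_def
        by (intro jointly_continuous_compose[OF G(1)] jointly_continuous_compose[OF F(1)] continuous_intros)
      show "\<psi> h \<in> flow_group V" for h
        unfolding \<psi>_def
        by (rule flow_group_compose[OF G(2) flow_group_compose[OF F(2) flow_group_compose[OF G(2) F(2)]]])
      fix h x assume h: "\<bar>h\<bar> \<le> h1"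
      define s where "s = sqrt \<bar>h\<bar>"
      have h': "\<bar>h\<bar> \<le> 1" using h h1 h0 by linarith
      have s: "s \<ge> 0" "s \<le> 1" "s\<^sup>2 = \<bar>h\<bar>" "s \<le> sqrt h0" using h' h h1 by (auto simp: s_def)
      have pq1: "\<bar>p h\<bar> \<le> 1" "\<bar>q h\<bar> \<le> 1" "\<bar>- p h\<bar> \<le> 1" "\<bar>- q h\<bar> \<le> 1" using s(2) by (auto simp: pq s_def)
      have step1: "norm (\<psi> h x - flow W (q h) (flow U (p h) (flow W (- q h) (flow U (- p h) x)))) \<le> \<eta> * h1 / 2"
        unfolding e(2)[symmetric] \<psi>_def M_def
        by (intro norm_compose_diff_le[OF G(3)] norm_compose_diff_le[OF F(3)] F(3) pq1
            flow_lipschitz_short[OF W1] flow_lipschitz_short[OF U1]) auto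
      have step2: "norm (flow W (q h) (flow U (p h) (flow W (- q h) (flow U (- p h) x))) - x - h *\<^sub>R B x)
          \<le> (8 * K ^ 3 + L * K) * (s + s) ^ 3"
        using commutator_expansion[OF U(1) W(1) B, of "q h" "p h" x] unfolding pq s_def[symmetric] .
      have step3: "norm (flow B h x - x - h *\<^sub>R B x) \<le> L\<^sup>2 / 2 * \<bar>h\<bar>\<^sup>2"
        by (rule flow_expansion1[OF B(2)])
      have "\<bar>h\<bar>\<^sup>2 = s ^ 3 * s" by (simp add: s(3)[symmetric] power2_eq_square power3_eq_cube)
      also have "\<dots> \<le> s ^ 3 * 1" using s by (intro mult_left_mono) auto
      finally have h2: "\<bar>h\<bar>\<^sup>2 \<le> s ^ 3" by simp
      have "norm (flow W (q h) (flow U (p h) (flow W (- q h) (flow U (- p h) x))) - flow B h x)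
          \<le> (8 * K ^ 3 + L * K) * (s + s) ^ 3 + L\<^sup>2 / 2 * \<bar>h\<bar>\<^sup>2"
        using norm_triangle_le_diff[OF add_mono[OF step2 step3]] by (simp add: algebra_simps)
      also have "\<dots> \<le> (8 * K ^ 3 + L * K) * (s + s) ^ 3 + L\<^sup>2 / 2 * s ^ 3"
        by (intro add_left_mono mult_left_mono h2) auto
      also have "\<dots> = C * s * \<bar>h\<bar>"
        unfolding s(3)[symmetric] C_def by (simp add: power2_eq_square power3_eq_cube algebra_simps)
      also have "\<dots> \<le> C * sqrt h0 * h1"
        using C s h h1 h0 by (intro mult_left_mono mult_mono) auto
      also have "\<dots> \<le> \<eta> / 2 * h1" using h0(3) h1 by (intro mult_right_mono) auto
      finally have step4: "norm (flow W (q h) (flow U (p h) (flow W (- q h) (flow U (- p h) x))) - flow B h x)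
          \<le> \<eta> / 2 * h1" .
      show "norm (\<psi> h x - flow B h x) \<le> \<eta> * h1"
        using norm_triangle_mono[OF step1 step4] by simp
    qed
  qed
qed

section \<open>From approximate flows to exact reachability\<close>

lemma approximable_linear:
  assumes A: "approximable V L" and L: "bounded_lipschitz K L" and \<delta>: "\<delta> > 0"
  obtains F where "jointly_continuous F" "\<And>t. F t \<in> flow_group V"
    "\<And>t x. \<bar>t\<bar> \<le> \<delta> \<Longrightarrow> norm (F t x - x - t *\<^sub>R L x) \<le> K\<^sup>2 * \<delta>\<^sup>2"
proof -
  have "K\<^sup>2 / 2 * \<delta>\<^sup>2 > 0" using \<delta> bounded_lipschitzD(2)[OF L] by simp
  then obtain F where F: "jointly_continuous F" "\<And>t. F t \<in> flow_group V"
    "\<And>t x. \<bar>t\<bar> \<le> \<delta> \<Longrightarrow> norm (F t x - flow L t x) \<le> K\<^sup>2 / 2 * \<delta>\<^sup>2"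
    using approximableE[OF A \<delta>] by metis
  have "norm (F t x - x - t *\<^sub>R L x) \<le> K\<^sup>2 * \<delta>\<^sup>2" if t: "\<bar>t\<bar> \<le> \<delta>" for t x
  proof -
    have "norm (flow L t x - x - t *\<^sub>R L x) \<le> K\<^sup>2 / 2 * \<bar>t\<bar>\<^sup>2" by (rule flow_expansion1[OF L])
    also have "\<dots> \<le> K\<^sup>2 / 2 * \<delta>\<^sup>2" using t by (intro mult_left_mono power_mono) auto
    finally have "norm (flow L t x - (x + t *\<^sub>R L x)) \<le> K\<^sup>2 / 2 * \<delta>\<^sup>2" by (simp add: algebra_simps)
    from norm_triangle_mono[OF F(3)[OF t, of x] this] show ?thesis by (simp add: algebra_simps)
  qed
  then show thesis using that F by blast
qed

text \<open>Composing the \<open>n\<close> approximate flows for small times \<open>t c\<close>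
  displaces \<open>x k\<close> by the sum of the \<open>t c *\<^sub>R E c (x k)\<close> up to second
  order. By duality the coordinates of all displacements are then the times themselves up to second
  order, a perturbation of the identity to which \<open>near_identity_hits\<close> applies.\<close>

lemma flow_group_hits:
  fixes x y :: "nat \<Rightarrow> 'a::euclidean_space" and n N :: nat
  assumes E: "\<And>c. c < n \<Longrightarrow> bounded_lipschitz K (E c)" "\<And>c. c < n \<Longrightarrow> approximable V (E c)"
    and bij: "bij_betw \<iota> {..<n} ({..<N} \<times> Basis)"
    and dual: "\<And>c k. c < n \<Longrightarrow> k < N \<Longrightarrow> E c (x k) = (if k = fst (\<iota> c) then snd (\<iota> c) else 0)"
  shows "\<exists>\<epsilon>>0. \<exists>g\<in>flow_group V. \<forall>k<N. g (x k) = x k + \<epsilon> *\<^sub>R y k"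
\<comment> \<open>The bound \<open>K \<ge> 1\<close> is only available through some
  \<open>E c\<close>, so the empty family is treated apart; it forces \<open>N = 0\<close>.\<close>
proof (cases "n = 0")
  case True
  then have "{..<N} \<times> (Basis :: 'a set) = {}" using bij by (simp add: bij_betw_def)
  then have "N = 0" by auto
  then show ?thesis using flow_group.id by (auto intro: exI[of _ 1])
next
  case False
  then have K: "K \<ge> 1" using E(1)[of 0] bounded_lipschitzD(1) by blast
  \<comment> \<open>Error per factor, in units of \<open>\<delta>\<^sup>2\<close>:
    \<open>K\<^sup>2\<close> for linearizing the approximate flow, and \<open>2 * K ^ 3 * n\<close>
    because the field is evaluated at a point already moved by up to
    \<open>n * (2 * K\<^sup>2 * \<delta>)\<close>.\<close>
  define S where "S = K\<^sup>2 + 2 * K ^ 3 * n"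
  have S: "S > 0" using K by (simp add: S_def add_pos_nonneg)
  \<comment> \<open>Makes the accumulated error of the \<open>n\<close> factors at most
    \<open>\<delta> / 2\<close>, the slack in \<open>near_identity_hits\<close>.\<close>
  define \<delta> where "\<delta> = min 1 (1 / (2 * (n * S)))"
  have nS: "n * S > 0" using S False by simp
  have \<delta>: "\<delta> > 0" "\<delta> \<le> 1" "n * S * \<delta>\<^sup>2 \<le> \<delta> / 2"
  proof -
    show \<delta>0: "\<delta> > 0" "\<delta> \<le> 1" using nS by (auto simp: \<delta>_def)
    have "n * S * \<delta> \<le> n * S * (1 / (2 * (n * S)))" using nS by (intro mult_left_mono) (auto simp: \<delta>_def)
    also have "\<dots> = 1 / 2" using nS by (metis nonzero_mult_divide_mult_cancel_right mult.right_neutral mult_1 times_divide_eq_right less_irrefl mult.commute)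
    finally have "n * S * \<delta> * \<delta> \<le> 1 / 2 * \<delta>" using \<delta>0(1) by (intro mult_right_mono) auto
    then show "n * S * \<delta>\<^sup>2 \<le> \<delta> / 2" by (simp add: power2_eq_square)
  qed
  have "\<forall>c. \<exists>F. c < n \<longrightarrow> jointly_continuous F \<and> (\<forall>t. F t \<in> flow_group V) \<and>
    (\<forall>t x. \<bar>t\<bar> \<le> \<delta> \<longrightarrow> norm (F t x - x - t *\<^sub>R E c x) \<le> K\<^sup>2 * \<delta>\<^sup>2)"
    using approximable_linear[OF E(2,1) \<delta>(1)] by metis
  from choice[OF this] obtain F where F: "\<And>c. c < n \<Longrightarrow> jointly_continuous (F c)"
    "\<And>c t. c < n \<Longrightarrow> F c t \<in> flow_group V"
    "\<And>c t x. c < n \<Longrightarrow> \<bar>t\<bar> \<le> \<delta> \<Longrightarrow> norm (F c t x - x - t *\<^sub>R E c x) \<le> K\<^sup>2 * \<delta>\<^sup>2"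
    by blast
  define G where "G = rec_nat (\<lambda>(t::nat\<Rightarrow>real) x. x) (\<lambda>c g t x. F c (t c) (g t x))"
  have G0: "G 0 t z = z" and GSuc: "G (Suc c) t z = F c (t c) (G c t z)" for t c z
    by (simp_all add: G_def)
  have Ggrp: "c \<le> n \<Longrightarrow> G c t \<in> flow_group V" for c t
  proof (induction c)
    case 0 then show ?case using flow_group.id by (simp add: G_def)
  next
    case (Suc c)
    then have "(\<lambda>z. F c (t c) (G c t z)) \<in> flow_group V"
      using flow_group_compose[OF F(2), of c "G c t" "t c"] by simp
    also have "(\<lambda>z. F c (t c) (G c t z)) = G (Suc c) t" by (simp add: GSuc fun_eq_iff)
    finally show ?case .
  qed
  have Gcont: "c \<le> n \<Longrightarrow> continuous_on UNIV (\<lambda>t. G c t z)" for c z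
  proof (induction c)
    case 0 then show ?case by (simp add: G0)
  next
    case (Suc c)
    then show ?case unfolding GSuc
      by (intro jointly_continuous_compose[OF F(1)] continuous_on_product_coordinates) auto
  qed
  \<comment> \<open>The crude displacement bound is carried along because it controls the change of
    \<open>E c\<close> between \<open>z\<close> and the current point.\<close>
  have Gest: "c \<le> n \<Longrightarrow> norm (G c t z - z) \<le> c * (2 * K\<^sup>2 * \<delta>) \<and>
      norm (G c t z - z - (\<Sum>b<c. t b *\<^sub>R E b z)) \<le> c * (S * \<delta>\<^sup>2)"
    if t: "\<And>j. \<bar>t j\<bar> \<le> \<delta>" for c t z
  proof (induction c)
    case 0 then show ?case by (simp add: G0)
  next
    case (Suc c)
    then have c: "c < n" by simp
    define w where "w = G c t z"
    have IH: "norm (w - z) \<le> c * (2 * K\<^sup>2 * \<delta>)" "norm (w - z - (\<Sum>b<c. t b *\<^sub>R E b z)) \<le> c * (S * \<delta>\<^sup>2)"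
      using Suc unfolding w_def by auto
    note El = bounded_lipschitzD[OF E(1)[OF c]]
    have Fw: "norm (F c (t c) w - w - t c *\<^sub>R E c w) \<le> K\<^sup>2 * \<delta>\<^sup>2" by (rule F(3)[OF c t])
    have "norm (F c (t c) w - w) \<le> norm (F c (t c) w - w - t c *\<^sub>R E c w) + norm (t c *\<^sub>R E c w)"
      using norm_triangle_ineq[of "F c (t c) w - w - t c *\<^sub>R E c w" "t c *\<^sub>R E c w"] by simp
    also have "\<dots> \<le> K\<^sup>2 * \<delta>\<^sup>2 + \<delta> * K"
      using El t[of c] by (intro add_mono Fw) (auto intro!: mult_mono simp: \<delta>)
    also have "\<dots> \<le> K\<^sup>2 * (\<delta> * 1) + \<delta> * K\<^sup>2"
      using K \<delta> unfolding power2_eq_square by (intro add_mono mult_left_mono) auto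
    finally have one: "norm (F c (t c) w - w) \<le> 2 * K\<^sup>2 * \<delta>" by (simp add: algebra_simps)
    have "norm (t c *\<^sub>R (E c w - E c z)) \<le> \<delta> * (K * (c * (2 * K\<^sup>2 * \<delta>)))"
      using t[of c] \<delta> K IH(1) El(3) unfolding norm_scaleR
      by (intro mult_mono order_trans[OF El(5)] mult_left_mono) auto
    also have "\<dots> \<le> \<delta> * (K * (n * (2 * K\<^sup>2 * \<delta>)))"
      using c \<delta> K by (intro mult_left_mono mult_right_mono) auto
    finally have two: "norm (t c *\<^sub>R (E c w - E c z)) \<le> 2 * K ^ 3 * n * \<delta>\<^sup>2"
      by (simp add: power2_eq_square power3_eq_cube algebra_simps)
    have "norm (G (Suc c) t z - z) \<le> norm (F c (t c) w - w) + norm (w - z)"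
      unfolding GSuc w_def[symmetric] by (rule norm_diff_via)
    also have "\<dots> \<le> 2 * K\<^sup>2 * \<delta> + c * (2 * K\<^sup>2 * \<delta>)" by (intro add_mono one IH)
    finally have "norm (G (Suc c) t z - z) \<le> Suc c * (2 * K\<^sup>2 * \<delta>)" by (simp add: algebra_simps)
    moreover
    have "G (Suc c) t z - z - (\<Sum>b<Suc c. t b *\<^sub>R E b z) =
        (F c (t c) w - w - t c *\<^sub>R E c w) + t c *\<^sub>R (E c w - E c z) + (w - z - (\<Sum>b<c. t b *\<^sub>R E b z))"
      unfolding GSuc w_def[symmetric] by (simp add: algebra_simps)
    then have "norm (G (Suc c) t z - z - (\<Sum>b<Suc c. t b *\<^sub>R E b z)) \<le>
        K\<^sup>2 * \<delta>\<^sup>2 + 2 * K ^ 3 * n * \<delta>\<^sup>2 + c * (S * \<delta>\<^sup>2)"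
      by (metis norm_triangle_mono[OF norm_triangle_mono[OF Fw two] IH(2)])
    then have "norm (G (Suc c) t z - z - (\<Sum>b<Suc c. t b *\<^sub>R E b z)) \<le> Suc c * (S * \<delta>\<^sup>2)"
      by (simp add: S_def algebra_simps)
    ultimately show ?case by blast
  qed
  have \<iota>: "fst (\<iota> c) < N" "snd (\<iota> c) \<in> Basis" if "c < n" for c
    using bij_betwE[OF bij, rule_format, of c] that by (auto simp: mem_Times_iff)
  \<comment> \<open>The displacement of point \<open>fst (\<iota> c)\<close> in direction
    \<open>snd (\<iota> c)\<close>; its linear part is exactly \<open>t c\<close>.\<close>
  define A where "A = (\<lambda>t c. (G n t (x (fst (\<iota> c))) - x (fst (\<iota> c))) \<bullet> snd (\<iota> c))"
  \<comment> \<open>One factor brings all target displacements below \<open>\<delta> / 2\<close>;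
    the 1 prevents division by zero.\<close>
  define \<epsilon> where "\<epsilon> = \<delta> / (2 * (1 + (\<Sum>k<N. norm (y k))))"
  have ysum: "(\<Sum>k<N. norm (y k)) \<ge> 0" by (intro sum_nonneg) auto
  have \<epsilon>: "\<epsilon> > 0" using \<delta> ysum by (simp add: \<epsilon>_def)
  obtain t where t: "\<forall>c<n. A t c = \<epsilon> * (y (fst (\<iota> c)) \<bullet> snd (\<iota> c))"
  proof (rule near_identity_hits[OF \<delta>(1), of n A "\<lambda>c. \<epsilon> * (y (fst (\<iota> c)) \<bullet> snd (\<iota> c))"])
    show "continuous_on UNIV (\<lambda>t. A t c)" if "c < n" for c
      unfolding A_def by (intro continuous_intros Gcont) auto
    show "\<bar>A t c - t c\<bar> \<le> \<delta> / 2" if t: "\<forall>j. \<bar>t j\<bar> \<le> \<delta>" and c: "c < n" for t c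
    proof -
      define k where "k = fst (\<iota> c)"
      have "(\<Sum>b<n. t b *\<^sub>R E b (x k)) \<bullet> snd (\<iota> c) = (\<Sum>b<n. t b * (E b (x k) \<bullet> snd (\<iota> c)))"
        by (simp add: inner_sum_left)
      also have "\<dots> = (\<Sum>b<n. if b = c then t b else 0)"
      proof (intro sum.cong refl)
        fix b assume "b \<in> {..<n}"
        then have b: "b < n" by simp
        show "t b * (E b (x k) \<bullet> snd (\<iota> c)) = (if b = c then t b else 0)"
        proof (cases "b = c")
          case True
          then show ?thesis using \<iota>[OF c] dual[OF c, of k] by (simp add: k_def)
        next
          case False
          then have "\<iota> b \<noteq> \<iota> c" using bij b c by (auto simp: bij_betw_def inj_on_def)
          then show ?thesis using False dual[OF b, of k] \<iota>[OF c] \<iota>[OF b]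
            by (auto simp: k_def inner_Basis prod_eq_iff)
        qed
      qed
      also have "\<dots> = t c" using c by simp
      finally have "A t c - t c = (G n t (x k) - x k - (\<Sum>b<n. t b *\<^sub>R E b (x k))) \<bullet> snd (\<iota> c)"
        by (simp add: A_def k_def inner_diff_left)
      also have "\<bar>\<dots>\<bar> \<le> norm (G n t (x k) - x k - (\<Sum>b<n. t b *\<^sub>R E b (x k)))"
        by (rule Basis_le_norm[OF \<iota>(2)[OF c]])
      also have "\<dots> \<le> n * (S * \<delta>\<^sup>2)" using Gest[of t n "x k"] t by blast
      finally show ?thesis using \<delta>(3) by (simp add: mult.assoc)
    qed
    show "\<bar>\<epsilon> * (y (fst (\<iota> c)) \<bullet> snd (\<iota> c))\<bar> \<le> \<delta> / 2" if c: "c < n" for c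
    proof -
      have "\<bar>y (fst (\<iota> c)) \<bullet> snd (\<iota> c)\<bar> \<le> norm (y (fst (\<iota> c)))"
        by (rule Basis_le_norm[OF \<iota>(2)[OF c]])
      also have "\<dots> \<le> (\<Sum>k<N. norm (y k))"
        using \<iota>(1)[OF c] by (intro member_le_sum) auto
      also have "\<dots> \<le> 1 + (\<Sum>k<N. norm (y k))" by simp
      finally have "\<epsilon> * \<bar>y (fst (\<iota> c)) \<bullet> snd (\<iota> c)\<bar> \<le> \<epsilon> * (1 + (\<Sum>k<N. norm (y k)))"
        using \<epsilon> by (intro mult_left_mono) auto
      also have "\<dots> = \<delta> / 2" using ysum unfolding \<epsilon>_def by (simp add: field_simps)
      finally show ?thesis using \<epsilon> by (simp add: abs_mult)
    qed
  qed (use that in blast)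
  have "G n t (x k) = x k + \<epsilon> *\<^sub>R y k" if k: "k < N" for k
  proof -
    have "(G n t (x k) - x k) \<bullet> b = (\<epsilon> *\<^sub>R y k) \<bullet> b" if b: "b \<in> Basis" for b
    proof -
      have "(k, b) \<in> \<iota> ` {..<n}" using bij k b by (auto simp: bij_betw_def)
      then obtain c where c: "c < n" "\<iota> c = (k, b)" by auto
      have "A t c = \<epsilon> * (y (fst (\<iota> c)) \<bullet> snd (\<iota> c))" using t c(1) by blast
      then show ?thesis by (simp add: A_def c(2))
    qed
    then have "G n t (x k) - x k = \<epsilon> *\<^sub>R y k" by (rule euclidean_eqI)
    then show ?thesis by (simp add: diff_eq_eq add.commute)
  qed
  then have "\<forall>k<N. G n t (x k) = x k + \<epsilon> *\<^sub>R y k" by blast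
  then show ?thesis using \<epsilon> Ggrp[OF order_refl, of t] by (intro exI[of _ \<epsilon>] conjI bexI[of _ "G n t"])
qed

section \<open>Realization by controls\<close>

text \<open>The control precedes the quantifier over \<open>x\<close>, as it has to steer all points
  at once. The existing path is run at double speed on the first half of the interval and the new
  flow fills the second half; the corners accumulate in the finite set \<open>S\<close>.\<close>

lemma flow_group_control:
  fixes V :: "'d::finite \<Rightarrow> real^'m \<Rightarrow> real^'m"
  assumes V: "\<And>i. bounded_lipschitz K (V i)" and g: "g \<in> flow_group V"
  shows "\<exists>u C. (\<forall>i. u i \<in> borel_measurable borel \<and> (\<forall>s. \<bar>u i s\<bar> \<le> C)) \<and>
    (\<forall>x. \<exists>X S. X 0 = x \<and> X 1 = g x \<and> continuous_on {0..1} X \<and> finite S \<and>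
      (\<forall>t\<in>{0<..<1} - S. (X has_vector_derivative (\<Sum>i\<in>UNIV. u i t *\<^sub>R V i (X t))) (at t)))"
  using g
proof (induction rule: flow_group.induct)
  case id
  show ?case
  proof (intro exI conjI allI)
    fix x :: "real^'m"
    show "\<forall>t\<in>{0<..<1} - {}. ((\<lambda>t. x) has_vector_derivative (\<Sum>i\<in>UNIV. (\<lambda>i t. 0) i t *\<^sub>R V i x)) (at t)"
      by simp
  qed auto
next
  case (step g j t)
  then obtain u C where u: "\<And>i. u i \<in> borel_measurable borel" "\<And>i s. \<bar>u i s\<bar> \<le> C"
    and sol: "\<And>x. \<exists>X S. X 0 = x \<and> X 1 = g x \<and> continuous_on {0..1} X \<and> finite S \<and>
      (\<forall>t\<in>{0<..<1} - S. (X has_vector_derivative (\<Sum>i\<in>UNIV. u i t *\<^sub>R V i (X t))) (at t))"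
    by blast
  define v where "v = (\<lambda>i s. if s \<le> 1/2 then 2 * u i (2 * s) else if i = j then 2 * t else 0)"
  show ?case
  proof (intro exI[of _ v] exI[of _ "2 * C + 2 * \<bar>t\<bar>"] conjI allI)
    fix i
    have [measurable]: "u i \<in> borel_measurable borel" by (rule u)
    show "v i \<in> borel_measurable borel" unfolding v_def by measurable
    show "\<bar>v i s\<bar> \<le> 2 * C + 2 * \<bar>t\<bar>" for s
      using u(2)[of i "2 * s"] u(2)[of i 0] by (auto simp: v_def abs_mult)
  next
    fix x
    obtain X S where X: "X 0 = x" "X 1 = g x" "continuous_on {0..1} X" "finite S"
      "\<And>t. t \<in> {0<..<1} - S \<Longrightarrow> (X has_vector_derivative (\<Sum>i\<in>UNIV. u i t *\<^sub>R V i (X t))) (at t)"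
      using sol[of x] by blast
    define Y where "Y = (\<lambda>s. if s \<le> 1/2 then X (2 * s) else flow (V j) ((2 * s - 1) * t) (g x))"
    show "\<exists>Y S. Y 0 = x \<and> Y 1 = flow (V j) t (g x) \<and> continuous_on {0..1} Y \<and> finite S \<and>
      (\<forall>t\<in>{0<..<1} - S. (Y has_vector_derivative (\<Sum>i\<in>UNIV. v i t *\<^sub>R V i (Y t))) (at t))"
    proof (intro exI[of _ Y] exI[of _ "insert (1/2) ((\<lambda>s. s / 2) ` S)"] conjI ballI)
      show "Y 0 = x" "Y 1 = flow (V j) t (g x)" by (simp_all add: Y_def X)
      show "continuous_on {0..1} Y"
        unfolding Y_def
      proof (rule continuous_on_cases_le)
        show "continuous_on {s \<in> {0..1}. s \<le> 1 / 2} (\<lambda>s. X (2 * s))"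
          by (rule continuous_on_compose2[OF X(3)]) (auto intro!: continuous_intros)
        show "continuous_on {s \<in> {0..1}. 1 / 2 \<le> s} (\<lambda>s. flow (V j) ((2 * s - 1) * t) (g x))"
          by (intro jointly_continuous_compose[OF jointly_continuous_flow[OF V]] continuous_intros)
        show "X (2 * s) = flow (V j) ((2 * s - 1) * t) (g x)" if "s \<in> {0..1}" "s = 1/2" for s
          using flow_curve(1)[OF V] unfolding that(2) by (simp add: X)
      qed (auto intro!: continuous_intros)
      fix s assume s: "s \<in> {0<..<1} - insert (1/2) ((\<lambda>s. s / 2) ` S)"
      show "(Y has_vector_derivative (\<Sum>i\<in>UNIV. v i s *\<^sub>R V i (Y s))) (at s)"
      proof (cases "s < 1/2")
        case True
        have "2 * s \<notin> S"
        proof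
          assume "2 * s \<in> S"
          then have "2 * s / 2 \<in> (\<lambda>s. s / 2) ` S" by (rule imageI)
          then show False using s by simp
        qed
        then have "2 * s \<in> {0<..<1} - S" using s True by simp
        note * = X(5)[OF this]
        have "((\<lambda>s. 2 * s) has_vector_derivative 2) (at s)" by (auto intro!: derivative_eq_intros)
        from vector_diff_chain_at[OF this *]
        have "((\<lambda>s. X (2 * s)) has_vector_derivative (2 *\<^sub>R (\<Sum>i\<in>UNIV. u i (2 * s) *\<^sub>R V i (X (2 * s))))) (at s)"
          by (simp add: o_def)
        then have "(Y has_vector_derivative (2 *\<^sub>R (\<Sum>i\<in>UNIV. u i (2 * s) *\<^sub>R V i (X (2 * s))))) (at s)"
          by (rule has_vector_derivative_transform_within_open[of _ _ _ "{..<1/2}"]) (use True in \<open>auto simp: Y_def\<close>)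
        moreover have "2 *\<^sub>R (\<Sum>i\<in>UNIV. u i (2 * s) *\<^sub>R V i (X (2 * s))) = (\<Sum>i\<in>UNIV. v i s *\<^sub>R V i (Y s))"
          using True by (simp add: v_def Y_def scaleR_sum_right)
        ultimately show ?thesis by simp
      next
        case False
        then have s2: "s > 1/2" using s by auto
        have "((\<lambda>s. (2 * s - 1) * t) has_vector_derivative 2 * t) (at s)" by (auto intro!: derivative_eq_intros)
        from vector_diff_chain_at[OF this flow_has_derivative[OF V]]
        have "((\<lambda>s. flow (V j) ((2 * s - 1) * t) (g x)) has_vector_derivative
            (2 * t) *\<^sub>R V j (flow (V j) ((2 * s - 1) * t) (g x))) (at s)"
          by (simp add: o_def)
        then have "(Y has_vector_derivative (2 * t) *\<^sub>R V j (flow (V j) ((2 * s - 1) * t) (g x))) (at s)"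
          by (rule has_vector_derivative_transform_within_open[of _ _ _ "{1/2<..}"]) (use s2 in \<open>auto simp: Y_def\<close>)
        moreover have "(2 * t) *\<^sub>R V j (flow (V j) ((2 * s - 1) * t) (g x)) = (\<Sum>i\<in>UNIV. v i s *\<^sub>R V i (Y s))"
          using s2 by (simp add: v_def Y_def if_distrib[of "\<lambda>c. c *\<^sub>R _"] cong: if_cong)
        ultimately show ?thesis by simp
      qed
    qed (use X in auto)
  qed
qed

text \<open>Gronwall in integral form, because the controls are not continuous and solutions satisfy
  only the integral equation: the integral \<open>E\<close> of the distance satisfies
  \<open>e s \<le> L * E s\<close>, so \<open>E s * exp (- L * s)\<close> is nonincreasing and
  starts at 0.\<close>

lemma control_solution_unique:
  fixes V :: "'d::finite \<Rightarrow> real^'m \<Rightarrow> real^'m"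
  assumes V: "\<And>i. bounded_lipschitz K (V i)" and C: "\<And>i s. \<bar>u i s\<bar> \<le> C"
    and X: "is_control_solution u V x X" and Y: "is_control_solution u V x Y" and t: "t \<in> {0..1}"
  shows "X t = Y t"
proof -
  define f where "f = (\<lambda>X s. \<Sum>i\<in>UNIV. u i s *\<^sub>R V i (X s))"
  define L where "L = real CARD('d) * (C * K)"
  have C0: "C \<ge> 0" using C[of undefined 0] by linarith
  have K0: "K \<ge> 0" using bounded_lipschitzD(3)[OF V[of undefined]] .
  have f_diff: "norm (f X s - f Y s) \<le> L * norm (X s - Y s)" for s
  proof -
    have "norm (f X s - f Y s) \<le> (\<Sum>i\<in>(UNIV::'d set). norm (u i s *\<^sub>R (V i (X s) - V i (Y s))))"
      unfolding f_def sum_subtractf[symmetric] scaleR_diff_right[symmetric] by (rule norm_sum)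
    also have "\<dots> \<le> (\<Sum>i\<in>(UNIV::'d set). C * (K * norm (X s - Y s)))"
      unfolding norm_scaleR
      by (intro sum_mono mult_mono C bounded_lipschitzD[OF V] C0) auto
    finally show ?thesis by (simp add: L_def)
  qed
  have cX: "continuous_on {0..1} X" and cY: "continuous_on {0..1} Y" using X Y by (auto simp: is_control_solution_def)
  have fint: "f Z integrable_on {0..s}" if "is_control_solution u V x Z" "s \<in> {0..1}" for Z s
  proof -
    have "f Z integrable_on {0..1}"
      using that(1) unfolding is_control_solution_def f_def by (auto dest: set_lebesgue_integral_eq_integral(1))
    then show ?thesis by (rule integrable_on_subinterval) (use that(2) in auto)
  qed
  define e where "e = (\<lambda>s. norm (X s - Y s))"
  have ce: "continuous_on {0..1} e" unfolding e_def by (intro continuous_intros cX cY)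
  define E where "E = (\<lambda>s. integral {0..s} e)"
  have eint: "e integrable_on {0..s}" if "s \<in> {0..1}" for s
    using ce that by (intro integrable_continuous_interval) (auto intro: continuous_on_subset)
  have e_le: "e s \<le> L * E s" if s: "s \<in> {0..1}" for s
  proof -
    have "X s = x + integral {0..s} (f X)" "Y s = x + integral {0..s} (f Y)"
      using X Y s unfolding is_control_solution_def f_def by auto
    then have "X s - Y s = integral {0..s} (\<lambda>r. f X r - f Y r)"
      using Henstock_Kurzweil_Integration.integral_diff[OF fint[OF X s] fint[OF Y s]] by simp
    then have "e s = norm (integral {0..s} (\<lambda>r. f X r - f Y r))" by (simp add: e_def)
    also have "\<dots> \<le> integral {0..s} (\<lambda>r. L * e r)"
    proof (rule integral_norm_bound_integral)
      show "(\<lambda>r. f X r - f Y r) integrable_on {0..s}" by (intro integrable_diff fint X Y s)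
      show "(\<lambda>r. L * e r) integrable_on {0..s}" using integrable_on_cmult_left[OF eint[OF s], of L] by simp
      show "norm (f X r - f Y r) \<le> L * e r" for r using f_diff by (simp add: e_def)
    qed
    finally show ?thesis by (simp add: E_def)
  qed
  have dE: "(E has_real_derivative e s) (at s)" if "0 < s" "s < 1" for s
  proof -
    have "(E has_real_derivative e s) (at s within {0..1})"
      unfolding E_def using that by (intro integral_has_real_derivative ce) auto
    then show ?thesis using that by (subst (asm) at_within_interior) auto
  qed
  have "E t * exp (- L * t) \<le> E 0 * exp (- L * 0)"
  proof (rule DERIV_nonpos_imp_decreasing_open[where f="\<lambda>s. E s * exp (- L * s)" and a=0 and b=t])
    fix s assume s: "0 < s" "s < t"
    then have s': "0 < s" "s < 1" using t by auto
    have "((\<lambda>s. E s * exp (- L * s)) has_real_derivative (e s - L * E s) * exp (- L * s)) (at s)"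
      by (rule derivative_eq_intros dE[OF s'] refl)+ (simp add: algebra_simps)
    moreover have "(e s - L * E s) * exp (- L * s) \<le> 0"
      using e_le[of s] s' by (intro mult_nonpos_nonneg) auto
    ultimately show "\<exists>y. ((\<lambda>s. E s * exp (- L * s)) has_real_derivative y) (at s) \<and> y \<le> 0" by blast
  next
    have "continuous_on {0..1} E"
      unfolding E_def by (rule indefinite_integral_continuous_1[OF eint]) simp
    then show "continuous_on {0..t} (\<lambda>s. E s * exp (- L * s))"
      using t by (intro continuous_intros) (auto intro: continuous_on_subset)
  qed (use t in auto)
  then have "E t \<le> 0" by (simp add: E_def mult_le_0_iff)
  moreover have "L \<ge> 0" using C0 K0 by (simp add: L_def)
  ultimately have "L * E t \<le> 0" by (simp add: mult_nonneg_nonpos)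
  with e_le[OF t] have "e t \<le> 0" by linarith
  then show ?thesis by (simp add: e_def)
qed

text \<open>Uniqueness upgrades the curve built from the control to a statement about every
  solution, the form required by the theorem.\<close>

lemma flow_group_realized:
  fixes V :: "'d::finite \<Rightarrow> real^'m \<Rightarrow> real^'m"
  assumes V: "\<And>i. bounded_lipschitz K (V i)" and g: "g \<in> flow_group V"
  shows "\<exists>u. (\<forall>i. square_integrable_control (u i)) \<and>
    (\<forall>x. (\<exists>X. is_control_solution u V x X) \<and> (\<forall>X. is_control_solution u V x X \<longrightarrow> X 1 = g x))"
proof -
  obtain u C where u: "\<And>i. u i \<in> borel_measurable borel" "\<And>i s. \<bar>u i s\<bar> \<le> C"
    and sol: "\<And>x. \<exists>X S. X 0 = x \<and> X 1 = g x \<and> continuous_on {0..1} X \<and> finite S \<and>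
      (\<forall>t\<in>{0<..<1} - S. (X has_vector_derivative (\<Sum>i\<in>UNIV. u i t *\<^sub>R V i (X t))) (at t))"
    using flow_group_control[OF V g] by blast
  have C0: "C \<ge> 0" using u(2)[of undefined 0] by linarith
  have K0: "K \<ge> 0" using bounded_lipschitzD(3)[OF V[of undefined]] .
  have "square_integrable_control (u i)" for i
  proof -
    have [measurable]: "u i \<in> borel_measurable borel" by (rule u)
    have "set_integrable lborel {0..1} (\<lambda>t. (u i t)\<^sup>2)"
      unfolding set_integrable_def
    proof (rule integrableI_bounded_set_indicator[where B="C\<^sup>2"])
      show "AE t in lborel. t \<in> {0..1} \<longrightarrow> norm ((u i t)\<^sup>2) \<le> C\<^sup>2"
        using u(2)[of i] C0 by (auto simp: power_mono abs_le_square_iff[symmetric])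
    qed auto
    then show ?thesis unfolding square_integrable_control_def set_borel_measurable_def by simp
  qed
  moreover have "\<exists>X. is_control_solution u V x X \<and> X 1 = g x" for x
  proof -
    obtain X S where X: "X 0 = x" "X 1 = g x" "continuous_on {0..1} X" "finite S"
      "\<And>t. t \<in> {0<..<1} - S \<Longrightarrow> (X has_vector_derivative (\<Sum>i\<in>UNIV. u i t *\<^sub>R V i (X t))) (at t)"
      using sol[of x] by blast
    define f where "f = (\<lambda>s. \<Sum>i\<in>UNIV. u i s *\<^sub>R V i (X s))"
    have int: "(f has_integral X t - X 0) {0..t}" if "t \<in> {0..1}" for t
      using X that unfolding f_def
      by (intro fundamental_theorem_of_calculus_interior_strong[of S]) (auto intro: continuous_on_subset)
    have "f absolutely_integrable_on {0..1}"
    proof (rule absolutely_integrable_integrable_bound[where g="\<lambda>_. real CARD('d) * (C * K)"])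
      show "norm (f s) \<le> real CARD('d) * (C * K)" for s
      proof -
        have "norm (f s) \<le> (\<Sum>i\<in>(UNIV::'d set). norm (u i s *\<^sub>R V i (X s)))" unfolding f_def by (rule norm_sum)
        also have "\<dots> \<le> (\<Sum>i\<in>(UNIV::'d set). C * K)"
          unfolding norm_scaleR by (intro sum_mono mult_mono u bounded_lipschitzD[OF V] C0) auto
        finally show ?thesis by simp
      qed
      show "f integrable_on {0..1}" using int[of 1] by auto
    qed auto
    then have "is_control_solution u V x X"
      using X(1,3) integral_unique[OF int] unfolding is_control_solution_def f_def by auto
    then show ?thesis using X by blast
  qed
  ultimately show ?thesis
    using control_solution_unique[of K V u C _ _ _ 1, OF V u(2)]
    by (intro exI[of _ u]) (metis atLeastAtMost_iff order_refl zero_le_one)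
qed

section \<open>Smooth compactly supported fields\<close>

text \<open>The product rule leaves one factor undifferentiated, which is then needed one order
  lower.\<close>

lemma C_k_Suc_imp: "C_k (Suc k) f \<Longrightarrow> C_k k f"
proof (induction k arbitrary: f)
  case 0
  then show ?case
    by (auto intro!: continuous_at_imp_continuous_on differentiable_imp_continuous_within)
next
  case (Suc k)
  then show ?case using C_k.simps(2) by blast
qed

lemma C_k_const: "C_k k (\<lambda>_. c)"
proof (induction k arbitrary: c)
  case (Suc k)
  have "frechet_derivative (\<lambda>_. c) (at x) v = 0" for x :: 'a and v
    using frechet_derivative_at[OF has_derivative_const[of c "at x"]] by metis
  then show ?case using Suc[of 0] by simp
qed simp

lemma frechet_has_derivative:
  "f differentiable (at x) \<Longrightarrow> (f has_derivative frechet_derivative f (at x)) (at x)"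
  by (simp add: frechet_derivative_works)

lemma C_k_add: "C_k k f \<Longrightarrow> C_k k g \<Longrightarrow> C_k k (\<lambda>x. f x + g x)"
proof (induction k arbitrary: f g)
  case 0
  then show ?case by (simp add: continuous_on_add)
next
  case (Suc k)
  have fd: "frechet_derivative (\<lambda>x. f x + g x) (at x) = (\<lambda>v. frechet_derivative f (at x) v + frechet_derivative g (at x) v)" for x
    using Suc.prems by (intro frechet_derivative_at[symmetric] has_derivative_add frechet_has_derivative) auto
  show ?case unfolding C_k.simps fd using Suc.prems by (auto intro!: Suc.IH)
qed

lemma C_k_linear:
  assumes L: "bounded_linear L"
  shows "C_k k f \<Longrightarrow> C_k k (\<lambda>x. L (f x))"
proof (induction k arbitrary: f)
  case 0
  then show ?case using bounded_linear.continuous_on[OF L] by simp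
next
  case (Suc k)
  have d: "((\<lambda>x. L (f x)) has_derivative (\<lambda>v. L (frechet_derivative f (at x) v))) (at x)" for x
    using Suc.prems by (intro bounded_linear.has_derivative[OF L] frechet_has_derivative) auto
  show ?case unfolding C_k.simps frechet_derivative_at[OF d, symmetric]
    using Suc.prems d by (auto intro!: Suc.IH simp: differentiable_def)
qed

lemma C_k_scaleR:
  fixes a :: "'a::real_normed_vector \<Rightarrow> real"
  shows "C_k k a \<Longrightarrow> C_k k f \<Longrightarrow> C_k k (\<lambda>x. a x *\<^sub>R f x)"
proof (induction k arbitrary: a f)
  case 0
  then show ?case by (simp add: continuous_on_scaleR)
next
  case (Suc k)
  have d: "((\<lambda>x. a x *\<^sub>R f x) has_derivative
      (\<lambda>v. a x *\<^sub>R frechet_derivative f (at x) v + frechet_derivative a (at x) v *\<^sub>R f x)) (at x)" for x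
    using Suc.prems by (intro has_derivative_scaleR frechet_has_derivative) auto
  have "C_k k a" "C_k k f" using Suc.prems by (auto intro: C_k_Suc_imp)
  then show ?case unfolding C_k.simps frechet_derivative_at[OF d, symmetric]
    using Suc.prems d by (auto intro!: Suc.IH C_k_add simp: differentiable_def)
qed

lemma smooth_add: "smooth f \<Longrightarrow> smooth g \<Longrightarrow> smooth (\<lambda>x. f x + g x)"
  by (simp add: smooth_def C_k_add)

lemma smooth_linear: "bounded_linear L \<Longrightarrow> smooth f \<Longrightarrow> smooth (\<lambda>x. L (f x))"
  by (simp add: smooth_def C_k_linear)

lemma smooth_scaleR: "smooth a \<Longrightarrow> smooth f \<Longrightarrow> smooth (\<lambda>x. a x *\<^sub>R f x)" for a :: "_ \<Rightarrow> real"
  by (simp add: smooth_def C_k_scaleR)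

lemma smooth_sum: "finite I \<Longrightarrow> (\<And>i. i \<in> I \<Longrightarrow> smooth (f i)) \<Longrightarrow> smooth (\<lambda>x. \<Sum>i\<in>I. f i x)"
  by (induction I rule: finite_induct) (simp_all add: smooth_add, simp add: smooth_def C_k_const)

lemma smooth_differentiable: "smooth f \<Longrightarrow> f differentiable (at x)"
  unfolding smooth_def using C_k.simps(2) by blast

lemma smooth_has_derivative: "smooth f \<Longrightarrow> (f has_derivative frechet_derivative f (at x)) (at x)"
  by (intro frechet_has_derivative smooth_differentiable)

lemma smooth_continuous: "smooth f \<Longrightarrow> continuous_on S f"
  unfolding smooth_def using C_k.simps(1) continuous_on_subset by blast

lemma smooth_derivative: "smooth f \<Longrightarrow> smooth (\<lambda>x. frechet_derivative f (at x) v)"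
  unfolding smooth_def using C_k.simps(2) by blast

text \<open>A derivative in a direction depending on the point becomes a finite sum of derivatives
  in fixed directions, the only ones about which \<open>C_k\<close> and the power series lemmas
  speak.\<close>

lemma linear_axis_expansion:
  fixes L :: "real^'m \<Rightarrow> 'b::real_vector"
  assumes "linear L"
  shows "L v = (\<Sum>i\<in>UNIV. v $ i *\<^sub>R L (axis i 1))"
proof -
  have "L v = L (\<Sum>i\<in>UNIV. v $ i *\<^sub>R axis i 1)"
    using basis_expansion[of v] by (simp add: scalar_mult_eq_scaleR)
  also have "\<dots> = (\<Sum>i\<in>UNIV. v $ i *\<^sub>R L (axis i 1))"
    by (simp add: linear_sum[OF assms] linear_scale[OF assms])
  finally show ?thesis .
qed

lemma smooth_linear_derivative: "smooth f \<Longrightarrow> linear (frechet_derivative f (at x))"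
  by (intro linear_frechet_derivative smooth_differentiable)

lemma smooth_lie_bracket:
  fixes U W :: "real^'m \<Rightarrow> real^'m"
  assumes U: "smooth U" and W: "smooth W"
  shows "smooth (lie_bracket U W)"
proof -
  have along: "smooth (\<lambda>x. frechet_derivative W (at x) (U x))" if U: "smooth U" and W: "smooth W"
    for U W :: "real^'m \<Rightarrow> real^'m"
  proof -
    have "smooth (\<lambda>x. \<Sum>i\<in>UNIV. (U x $ i) *\<^sub>R frechet_derivative W (at x) (axis i 1))"
      by (intro smooth_sum smooth_scaleR smooth_linear[OF bounded_linear_vec_nth U] smooth_derivative[OF W]) auto
    moreover have "frechet_derivative W (at x) (U x) =
        (\<Sum>i\<in>UNIV. (U x $ i) *\<^sub>R frechet_derivative W (at x) (axis i 1))" for x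
      by (rule linear_axis_expansion[OF smooth_linear_derivative[OF W]])
    ultimately show ?thesis by (simp only:)
  qed
  have "smooth (\<lambda>x. frechet_derivative W (at x) (U x) + (- 1) *\<^sub>R frechet_derivative U (at x) (W x))"
    by (intro smooth_add smooth_linear[OF bounded_linear_scaleR_right] along U W)
  then show ?thesis by (simp add: lie_bracket_def[abs_def])
qed

section \<open>Quantitative bounds from compact support\<close>

lemma compact_support_derivative:
  assumes "compact K" "\<And>x. x \<notin> K \<Longrightarrow> f x = 0" "x \<notin> K"
  shows "frechet_derivative f (at x) v = 0"
proof -
  have "(f has_derivative (\<lambda>_. 0)) (at x)"
  proof (rule has_derivative_transform_within_open[of "\<lambda>_. 0"])
    show "open (- K)" using assms(1) by (simp add: compact_imp_closed open_Compl)
  qed (use assms in auto)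
  then show ?thesis using frechet_derivative_at by metis
qed

lemma bounded_of_compact_support:
  fixes f :: "'a::topological_space \<Rightarrow> 'b::real_normed_vector"
  assumes "compact K" "\<And>x. x \<notin> K \<Longrightarrow> f x = 0" "continuous_on UNIV f"
  shows "\<exists>B. \<forall>x. norm (f x) \<le> B"
proof -
  have "bounded (f ` K)"
    using assms by (intro compact_imp_bounded compact_continuous_image) (auto intro: continuous_on_subset)
  then obtain B where B: "\<And>x. x \<in> K \<Longrightarrow> norm (f x) \<le> B" unfolding bounded_iff by blast
  have "norm (f x) \<le> \<bar>B\<bar>" for x
    using B[of x] assms(2)[of x] by (cases "x \<in> K") auto
  then show ?thesis by blast
qed

lemma smooth_compact_support_bounds:
  fixes f :: "real^'m \<Rightarrow> 'b::euclidean_space"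
  assumes K: "compact K" "\<And>x. x \<notin> K \<Longrightarrow> f x = 0" and f: "smooth f"
  shows "\<exists>B\<ge>0. (\<forall>x. norm (f x) \<le> B) \<and> (\<forall>x v. norm (frechet_derivative f (at x) v) \<le> B * norm v) \<and>
    (\<forall>x y. norm (f x - f y) \<le> B * norm (x - y))"
proof -
  obtain B0 where B0: "\<And>x. norm (f x) \<le> B0"
    using bounded_of_compact_support[OF K smooth_continuous[OF f]] by blast
  have "\<forall>i. \<exists>B. \<forall>x. norm (frechet_derivative f (at x) (axis i 1)) \<le> B"
  proof
    fix i :: 'm
    show "\<exists>B. \<forall>x. norm (frechet_derivative f (at x) (axis i 1)) \<le> B"
      by (rule bounded_of_compact_support[OF K(1)])
        (auto intro: compact_support_derivative[OF K] smooth_continuous[OF smooth_derivative[OF f]])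
  qed
  from choice[OF this] obtain B1 where B1: "\<And>i x. norm (frechet_derivative f (at x) (axis i 1)) \<le> B1 i"
    by blast
  have B1_nonneg: "0 \<le> B1 i" for i using B1[of 0 i] norm_ge_zero order_trans by blast
  define B where "B = max B0 (\<Sum>i\<in>UNIV. B1 i)"
  have B: "B \<ge> 0" using order_trans[OF norm_ge_zero B0[of 0]] by (simp add: B_def)
  have D: "norm (frechet_derivative f (at x) v) \<le> B * norm v" for x v
  proof -
    have "norm (frechet_derivative f (at x) v) = norm (\<Sum>i\<in>UNIV. v $ i *\<^sub>R frechet_derivative f (at x) (axis i 1))"
      using linear_axis_expansion[OF smooth_linear_derivative[OF f]] by metis
    also have "\<dots> \<le> (\<Sum>i\<in>UNIV. norm (v $ i *\<^sub>R frechet_derivative f (at x) (axis i 1)))" by (rule norm_sum)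
    also have "\<dots> \<le> (\<Sum>i\<in>UNIV. norm v * B1 i)"
      unfolding norm_scaleR real_norm_def
      by (intro sum_mono mult_mono B1 component_le_norm_cart) auto
    also have "\<dots> = (\<Sum>i\<in>UNIV. B1 i) * norm v" by (simp add: sum_distrib_left mult.commute)
    also have "\<dots> \<le> B * norm v" unfolding B_def by (intro mult_right_mono) auto
    finally show ?thesis .
  qed
  have "norm (f x - f y) \<le> B * norm (x - y)" for x y
  proof (rule differentiable_bound[of UNIV f "\<lambda>x. frechet_derivative f (at x)"])
    show "onorm (frechet_derivative f (at x)) \<le> B" for x by (rule onorm_le[OF D])
  qed (use smooth_has_derivative[OF f] in auto)
  moreover have "norm (f x) \<le> B" for x using B0[of x] by (simp add: B_def)
  ultimately show ?thesis using B D by blast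
qed

text \<open>Every larger constant works as well, so that finitely many fields can share one.\<close>

lemma smooth_compact_support_c2_field:
  fixes V :: "real^'m \<Rightarrow> real^'m"
  assumes K: "compact K" "\<And>x. x \<notin> K \<Longrightarrow> V x = 0" and V: "smooth V"
  shows "\<exists>C0. \<forall>C\<ge>C0. c2_field C V (\<lambda>x. frechet_derivative V (at x))"
proof -
  define DV where "DV = (\<lambda>x. frechet_derivative V (at x))"
  have lin: "linear (DV x)" for x unfolding DV_def by (rule smooth_linear_derivative[OF V])
  obtain B where B: "B \<ge> 0" "\<And>x. norm (V x) \<le> B" "\<And>x v. norm (DV x v) \<le> B * norm v"
    "\<And>x y. norm (V x - V y) \<le> B * norm (x - y)"
    using smooth_compact_support_bounds[OF K V] unfolding DV_def by blast
  have "\<forall>i. \<exists>B. \<forall>x y. norm (DV x (axis i 1) - DV y (axis i 1)) \<le> B * norm (x - y)"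
  proof
    fix i :: 'm
    show "\<exists>B. \<forall>x y. norm (DV x (axis i 1) - DV y (axis i 1)) \<le> B * norm (x - y)"
      unfolding DV_def
      using smooth_compact_support_bounds[OF K(1) compact_support_derivative[OF K] smooth_derivative[OF V]] by blast
  qed
  from choice[OF this] obtain B1 where B1: "\<And>i x y. norm (DV x (axis i 1) - DV y (axis i 1)) \<le> B1 i * norm (x - y)"
    by blast
  define L where "L = (\<Sum>i\<in>UNIV. \<bar>B1 i\<bar>)"
  have L0: "L \<ge> 0" unfolding L_def by (intro sum_nonneg) auto
  have L: "norm (DV x v - DV y v) \<le> L * norm (x - y) * norm v" for x y v
  proof -
    have "norm (DV x v - DV y v) = norm (\<Sum>i\<in>UNIV. v $ i *\<^sub>R (DV x (axis i 1) - DV y (axis i 1)))"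
      using linear_axis_expansion[OF lin, of x v] linear_axis_expansion[OF lin, of y v]
      by (simp add: sum_subtractf scaleR_diff_right)
    also have "\<dots> \<le> (\<Sum>i\<in>UNIV. norm (v $ i *\<^sub>R (DV x (axis i 1) - DV y (axis i 1))))" by (rule norm_sum)
    also have "\<dots> \<le> (\<Sum>i\<in>UNIV. norm v * (\<bar>B1 i\<bar> * norm (x - y)))"
      unfolding norm_scaleR real_norm_def
      by (intro sum_mono mult_mono component_le_norm_cart order_trans[OF B1] mult_right_mono) auto
    also have "\<dots> = L * norm (x - y) * norm v"
      by (simp add: L_def sum_distrib_left sum_distrib_right mult_ac)
    finally show ?thesis .
  qed
  have R: "norm (V y - V x - DV x (y - x)) \<le> L * (norm (y - x))\<^sup>2" for x y
  proof -
    define w where "w = y - x"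
    \<comment> \<open>The remainder along the segment from \<open>x\<close> to \<open>y\<close>; its
      derivative at \<open>s\<close> is bounded by the Lipschitz constant of the derivative times
      \<open>s * (norm w)\<^sup>2\<close>.\<close>
    define g where "g = (\<lambda>s::real. V (x + s *\<^sub>R w) - V x - s *\<^sub>R DV x w)"
    have "norm (g 1) \<le> L * (norm w)\<^sup>2 / 2 * \<bar>1\<bar>\<^sup>2"
    proof (rule norm_le_of_derivative_bound[where D=g and D'="\<lambda>s. DV (x + s *\<^sub>R w) w - DV x w"
          and G="\<lambda>s. L * (norm w)\<^sup>2 / 2 * s\<^sup>2" and g="\<lambda>s. L * (norm w)\<^sup>2 * s"])
      fix s :: real
      have "((\<lambda>s. x + s *\<^sub>R w) has_derivative (\<lambda>t. t *\<^sub>R w)) (at s)"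
        by (auto intro!: derivative_eq_intros)
      from diff_chain_at[OF this smooth_has_derivative[OF V]]
      have "((\<lambda>s. V (x + s *\<^sub>R w)) has_derivative (\<lambda>t. DV (x + s *\<^sub>R w) (t *\<^sub>R w))) (at s)"
        by (simp add: o_def DV_def)
      then have "((\<lambda>s. V (x + s *\<^sub>R w)) has_vector_derivative DV (x + s *\<^sub>R w) w) (at s)"
        unfolding has_vector_derivative_def by (simp add: linear_scale[OF lin])
      then show "(g has_vector_derivative DV (x + s *\<^sub>R w) w - DV x w) (at s)"
        unfolding g_def by (auto intro!: derivative_eq_intros)
      show "norm (DV (x + s *\<^sub>R w) w - DV x w) \<le> L * (norm w)\<^sup>2 * \<bar>s\<bar>"
        using L[of "x + s *\<^sub>R w" w x] by (simp add: power2_eq_square mult_ac)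
    qed (auto intro!: derivative_eq_intros simp: g_def)
    also have "\<dots> \<le> L * (norm w)\<^sup>2" using L0 by simp
    finally show ?thesis by (simp add: g_def w_def)
  qed
  show ?thesis
  proof (intro exI[of _ "max 1 (max B L)"] allI impI)
    fix C assume C: "max 1 (max B L) \<le> C"
    then have C': "1 \<le> C" "B \<le> C" "L \<le> C" by auto
    have "bounded_lipschitz C V"
      unfolding bounded_lipschitz_def using B C'
      by (meson mult_right_mono norm_ge_zero order_trans)
    moreover have "norm (V y - V x - DV x (y - x)) \<le> C * (norm (y - x))\<^sup>2" for x y
      using R[of y x] C' by (meson mult_right_mono zero_le_power2 order_trans)
    moreover have "norm (DV x v) \<le> C * norm v" for x v
      using B(3)[of x v] C' by (meson mult_right_mono norm_ge_zero order_trans)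
    moreover have "norm (DV x v - DV y v) \<le> C * norm (x - y) * norm v" for x y v
      using L[of x v y] C' by (meson mult_right_mono norm_ge_zero order_trans)
    ultimately show "c2_field C V (\<lambda>x. frechet_derivative V (at x))"
      unfolding c2_field_def DV_def[symmetric] using lin by blast
  qed
qed

text \<open>A bracket vanishes wherever both fields vanish, since derivatives are linear. Hence
  \<open>K\<close> may be any set, and \<open>K = UNIV\<close> gives plain smoothness.\<close>

lemma lie_algebra_smooth:
  fixes V :: "'d \<Rightarrow> real^'m \<Rightarrow> real^'m"
  assumes V: "\<And>i. smooth (V i)" "\<And>i x. x \<notin> K \<Longrightarrow> V i x = 0" and L: "L \<in> lie_algebra_gen V"
  shows "smooth L \<and> (\<forall>x. x \<notin> K \<longrightarrow> L x = 0)"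
  using L
proof (induction rule: lie_algebra_gen.induct)
  case (bracket U W)
  then have "lie_bracket U W x = 0" if "x \<notin> K" for x
    using that by (simp add: lie_bracket_def linear_0[OF smooth_linear_derivative])
  then show ?case using bracket smooth_lie_bracket by blast
qed (use V in \<open>auto intro: smooth_add smooth_linear[OF bounded_linear_scaleR_right]\<close>)

text \<open>All members of the Lie algebra are smooth with support in the same compact set, which
  supplies the constants for each closure step.\<close>

lemma lie_algebra_approximable:
  fixes V :: "'d \<Rightarrow> real^'m \<Rightarrow> real^'m"
  assumes K: "compact K" and V: "\<And>i. smooth (V i)" "\<And>i x. x \<notin> K \<Longrightarrow> V i x = 0"
    and L: "L \<in> lie_algebra_gen V"
  shows "approximable V L"
  using L
proof (induction rule: lie_algebra_gen.induct)
  note c2 = smooth_compact_support_c2_field[OF K]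
  have sm: "smooth L \<and> (\<forall>x. x \<notin> K \<longrightarrow> L x = 0)" if "L \<in> lie_algebra_gen V" for L
    using lie_algebra_smooth[of V K L] V that by blast
  have c2L: "\<exists>C0. \<forall>C\<ge>C0. c2_field C L (\<lambda>x. frechet_derivative L (at x))" if "L \<in> lie_algebra_gen V" for L
    using c2 sm[OF that] by blast
  have bl: "\<exists>C. bounded_lipschitz C L" if "L \<in> lie_algebra_gen V" for L
    using c2L[OF that] c2_fieldD(1) by blast
  have c2_pair: "\<exists>C. c2_field C U (\<lambda>x. frechet_derivative U (at x)) \<and> c2_field C W (\<lambda>x. frechet_derivative W (at x))"
    if "U \<in> lie_algebra_gen V" "W \<in> lie_algebra_gen V" for U W
    using c2L[OF that(1)] c2L[OF that(2)] by (meson max.cobounded1 max.cobounded2)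
  {
    case (gen i)
    obtain C where "bounded_lipschitz C (V i)" using bl[OF lie_algebra_gen.gen[of V i]] by blast
    then show ?case by (rule approximable_generator)
  next
    case (add U W)
    obtain C where C: "c2_field C U (\<lambda>x. frechet_derivative U (at x))" "c2_field C W (\<lambda>x. frechet_derivative W (at x))"
      using c2_pair[OF add.hyps] by blast
    obtain C' where "bounded_lipschitz C' (\<lambda>x. U x + W x)" using bl[OF lie_algebra_gen.add[OF add.hyps]] by blast
    then show ?case by (rule approximable_add[OF C(1) add.IH(1) C(2) add.IH(2)])
  next
    case (scale U c)
    obtain C where C: "bounded_lipschitz C U" using bl[OF scale.hyps] by blast
    obtain C' where "bounded_lipschitz C' (\<lambda>x. c *\<^sub>R U x)" using bl[OF lie_algebra_gen.scale[OF scale.hyps, of c]] by blast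
    then show ?case by (rule approximable_scale[OF scale.IH C])
  next
    case (bracket U W)
    obtain C where C: "c2_field C U (\<lambda>x. frechet_derivative U (at x))" "c2_field C W (\<lambda>x. frechet_derivative W (at x))"
      using c2_pair[OF bracket.hyps] by blast
    obtain C' where "bounded_lipschitz C' (lie_bracket U W)" using bl[OF lie_algebra_gen.bracket[OF bracket.hyps]] by blast
    then show ?case
      by (rule approximable_bracket[OF C(1) bracket.IH(1) C(2) bracket.IH(2) lie_bracket_def])
  }
qed

text \<open>The zero field is not a constructor case of \<open>lie_algebra_gen\<close>, hence the
  nonempty index set.\<close>

lemma lie_algebra_sum:
  assumes "finite I" "I \<noteq> {}" "\<And>i. i \<in> I \<Longrightarrow> L i \<in> lie_algebra_gen V"
  shows "(\<lambda>x. \<Sum>i\<in>I. c i *\<^sub>R L i x) \<in> lie_algebra_gen V"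
  using assms
proof (induction I rule: finite_ne_induct)
  case (singleton i)
  then show ?case using lie_algebra_gen.scale[of "L i" V "c i"] by simp
next
  case (insert i I)
  then show ?case
    using lie_algebra_gen.add[OF lie_algebra_gen.scale[of "L i" V "c i"], of "\<lambda>x. \<Sum>i\<in>I. c i *\<^sub>R L i x"] by simp
qed

section \<open>Multivariate power series\<close>

definition monom_at :: "('n::finite \<Rightarrow> nat) \<Rightarrow> ('n \<Rightarrow> real) \<Rightarrow> real" where
  "monom_at a u = (\<Prod>i\<in>UNIV. u i ^ a i)"

definition mdeg :: "('n::finite \<Rightarrow> nat) \<Rightarrow> nat" where
  "mdeg a = (\<Sum>i\<in>UNIV. a i)"

text \<open>Absolute summability is required at the radius itself, on a closed polydisc: products
  and termwise derivatives are then estimated by one numerical series, and the radius may be shrunk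
  freely.\<close>

definition analytic_fun :: "(('n::finite \<Rightarrow> real) \<Rightarrow> real) \<Rightarrow> ('n \<Rightarrow> real) \<Rightarrow> bool" where
  "analytic_fun f p \<longleftrightarrow> (\<exists>\<rho>>0. \<exists>c. (\<lambda>a. \<bar>c a\<bar> * \<rho> ^ mdeg a) summable_on UNIV \<and>
     (\<forall>u. (\<forall>i. \<bar>u i\<bar> \<le> \<rho>) \<longrightarrow> ((\<lambda>a. c a * monom_at a u) has_sum f (\<lambda>i. p i + u i)) UNIV))"

lemma monom_at_bound:
  assumes "\<And>i. \<bar>u i\<bar> \<le> s"
  shows "\<bar>monom_at a u\<bar> \<le> s ^ mdeg a"
proof -
  have "\<bar>monom_at a u\<bar> = (\<Prod>i\<in>UNIV. \<bar>u i\<bar> ^ a i)" by (simp add: monom_at_def abs_prod power_abs)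
  also have "\<dots> \<le> (\<Prod>i\<in>UNIV. s ^ a i)"
    by (intro prod_mono) (auto intro: power_mono assms)
  also have "\<dots> = s ^ mdeg a" by (simp add: mdeg_def power_sum)
  finally show ?thesis .
qed

lemma monom_at_mult: "monom_at a u * monom_at b u = monom_at (\<lambda>i. a i + b i) u"
  by (simp add: monom_at_def power_add prod.distrib)

lemma mdeg_add: "mdeg (\<lambda>i. a i + b i) = mdeg a + mdeg b"
  by (simp add: mdeg_def sum.distrib)

lemma monom_at_scale: "monom_at a (\<lambda>i. t * u i) = t ^ mdeg a * monom_at a u"
  by (simp add: monom_at_def mdeg_def power_mult_distrib prod.distrib power_sum)

lemma finite_exponents_le: "finite {a :: 'n::finite \<Rightarrow> nat. \<forall>i. a i \<le> b i}"
proof -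
  have "{a :: 'n::finite \<Rightarrow> nat. \<forall>i. a i \<le> b i} \<subseteq> Pi\<^sub>E UNIV (\<lambda>i. {..b i})" by auto
  then show ?thesis by (rule finite_subset) (intro finite_PiE, auto)
qed

lemma finite_mdeg: "finite {a :: 'n::finite \<Rightarrow> nat. mdeg a = n}"
proof (rule finite_subset[OF _ finite_exponents_le[of "\<lambda>_. n"]])
  show "{a :: 'n \<Rightarrow> nat. mdeg a = n} \<subseteq> {a. \<forall>i. a i \<le> n}"
    by (auto simp: mdeg_def intro!: member_le_sum)
qed

text \<open>Regrouping with finite groups: it collects a product of series by exponent, and a series
  in several variables by total degree.\<close>

lemma has_sum_fibers:
  fixes f :: "'a \<Rightarrow> real"
  assumes f: "(f has_sum s) UNIV" and fin: "\<And>b. finite (h -` {b})"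
  shows "((\<lambda>b. \<Sum>a\<in>h -` {b}. f a) has_sum s) UNIV"
proof -
  have "((\<lambda>(b, a). f a) has_sum s) (Sigma UNIV (\<lambda>b. h -` {b}))"
    using f by (subst has_sum_reindex_bij_witness[of _ "\<lambda>a. (h a, a)" snd UNIV f _ s s]) auto
  then show ?thesis
    by (rule has_sum_SigmaD) (auto simp: fin)
qed

lemma analytic_funE:
  assumes "analytic_fun f p"
  obtains \<rho>0 c where "\<rho>0 > 0" "\<And>\<rho>. 0 \<le> \<rho> \<Longrightarrow> \<rho> \<le> \<rho>0 \<Longrightarrow> (\<lambda>a. \<bar>c a\<bar> * \<rho> ^ mdeg a) summable_on UNIV"
    "\<And>u. (\<And>i. \<bar>u i\<bar> \<le> \<rho>0) \<Longrightarrow> ((\<lambda>a. c a * monom_at a u) has_sum f (\<lambda>i. p i + u i)) UNIV"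
proof -
  obtain \<rho>0 c where *: "\<rho>0 > 0" "(\<lambda>a. \<bar>c a\<bar> * \<rho>0 ^ mdeg a) summable_on UNIV"
     "\<And>u. (\<And>i. \<bar>u i\<bar> \<le> \<rho>0) \<Longrightarrow> ((\<lambda>a. c a * monom_at a u) has_sum f (\<lambda>i. p i + u i)) UNIV"
    using assms unfolding analytic_fun_def by blast
  have "(\<lambda>a. \<bar>c a\<bar> * \<rho> ^ mdeg a) summable_on UNIV" if "0 \<le> \<rho>" "\<rho> \<le> \<rho>0" for \<rho>
    using that by (intro summable_on_comparison_test[OF *(2)]) (auto intro!: mult_left_mono power_mono)
  with * show thesis using that by blast
qed

lemma analytic_funI:
  assumes "\<rho> > 0" "(\<lambda>a. \<bar>c a\<bar> * \<rho> ^ mdeg a) summable_on UNIV"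
    "\<And>u. (\<And>i. \<bar>u i\<bar> \<le> \<rho>) \<Longrightarrow> ((\<lambda>a. c a * monom_at a u) has_sum f (\<lambda>i. p i + u i)) UNIV"
  shows "analytic_fun f p"
  unfolding analytic_fun_def using assms by (intro exI[of _ \<rho>] conjI exI[of _ c]) auto

lemma analytic_fun_cong:
  fixes f g :: "('n::finite \<Rightarrow> real) \<Rightarrow> real"
  assumes f: "analytic_fun f p" and r: "r > 0"
    and eq: "\<And>u. (\<And>i. \<bar>u i\<bar> \<le> r) \<Longrightarrow> f (\<lambda>i. p i + u i) = g (\<lambda>i. p i + u i)"
  shows "analytic_fun g p"
proof -
  obtain \<rho>0 c where c: "\<rho>0 > 0" "\<And>\<rho>. 0 \<le> \<rho> \<Longrightarrow> \<rho> \<le> \<rho>0 \<Longrightarrow> (\<lambda>a. \<bar>c a\<bar> * \<rho> ^ mdeg a) summable_on UNIV"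
    "\<And>u. (\<And>i. \<bar>u i\<bar> \<le> \<rho>0) \<Longrightarrow> ((\<lambda>a. c a * monom_at a u) has_sum f (\<lambda>i. p i + u i)) UNIV"
    using analytic_funE[OF f] by blast
  show ?thesis
  proof (rule analytic_funI)
    show "min \<rho>0 r > 0" using c(1) r by simp
    show "(\<lambda>a. \<bar>c a\<bar> * min \<rho>0 r ^ mdeg a) summable_on UNIV" using c(1) r by (intro c(2)) auto
    fix u :: "'n \<Rightarrow> real" assume u: "\<And>i. \<bar>u i\<bar> \<le> min \<rho>0 r"
    then have "\<And>i. \<bar>u i\<bar> \<le> \<rho>0" "\<And>i. \<bar>u i\<bar> \<le> r" by auto
    then show "((\<lambda>a. c a * monom_at a u) has_sum g (\<lambda>i. p i + u i)) UNIV" using c(3) eq by metis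
  qed
qed

lemma analytic_fun_const:
  fixes p :: "'n::finite \<Rightarrow> real"
  shows "analytic_fun (\<lambda>_. k) p"
proof (rule analytic_funI[of 1 "\<lambda>a. if a = (\<lambda>_. 0) then k else 0"])
  have *: "((\<lambda>a. (if a = (\<lambda>_. 0) then k else 0) * w a) has_sum k * w (\<lambda>_. 0)) UNIV" for k and w :: "('n \<Rightarrow> nat) \<Rightarrow> real"
    by (rule has_sum_finite_neutralI[of "{\<lambda>_. 0}"]) auto
  show "((\<lambda>a. (if a = (\<lambda>_. 0) then k else 0) * monom_at a u) has_sum k) UNIV" for u :: "'n \<Rightarrow> real"
    using *[of k "\<lambda>a. monom_at a u"] by (simp add: monom_at_def)
  show "(\<lambda>a::'n \<Rightarrow> nat. \<bar>if a = (\<lambda>_. 0) then k else 0\<bar> * 1 ^ mdeg a) summable_on UNIV"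
    using has_sum_imp_summable[OF *[of "\<bar>k\<bar>" "\<lambda>_. 1"]] by (simp add: if_distrib cong: if_cong)
qed simp

lemma analytic_fun_add:
  fixes f g :: "('n::finite \<Rightarrow> real) \<Rightarrow> real"
  assumes "analytic_fun f p" "analytic_fun g p"
  shows "analytic_fun (\<lambda>x. f x + g x) p"
proof -
  obtain \<rho>0 c where c: "\<rho>0 > 0" "\<And>\<rho>. 0 \<le> \<rho> \<Longrightarrow> \<rho> \<le> \<rho>0 \<Longrightarrow> (\<lambda>a. \<bar>c a\<bar> * \<rho> ^ mdeg a) summable_on UNIV"
    "\<And>u. (\<And>i. \<bar>u i\<bar> \<le> \<rho>0) \<Longrightarrow> ((\<lambda>a. c a * monom_at a u) has_sum f (\<lambda>i. p i + u i)) UNIV"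
    using analytic_funE[OF assms(1)] by blast
  obtain \<rho>1 d where d: "\<rho>1 > 0" "\<And>\<rho>. 0 \<le> \<rho> \<Longrightarrow> \<rho> \<le> \<rho>1 \<Longrightarrow> (\<lambda>a. \<bar>d a\<bar> * \<rho> ^ mdeg a) summable_on UNIV"
    "\<And>u. (\<And>i. \<bar>u i\<bar> \<le> \<rho>1) \<Longrightarrow> ((\<lambda>a. d a * monom_at a u) has_sum g (\<lambda>i. p i + u i)) UNIV"
    using analytic_funE[OF assms(2)] by blast
  define \<rho> where "\<rho> = min \<rho>0 \<rho>1"
  have \<rho>: "\<rho> > 0" "\<rho> \<le> \<rho>0" "\<rho> \<le> \<rho>1" using c d by (auto simp: \<rho>_def)
  show ?thesis
  proof (rule analytic_funI[OF \<rho>(1), of "\<lambda>a. c a + d a"])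
    have "(\<lambda>a. \<bar>c a\<bar> * \<rho> ^ mdeg a + \<bar>d a\<bar> * \<rho> ^ mdeg a) summable_on UNIV"
      using \<rho> by (intro summable_on_add c d) auto
    then show "(\<lambda>a. \<bar>c a + d a\<bar> * \<rho> ^ mdeg a) summable_on UNIV"
    proof (rule summable_on_comparison_test)
      fix a
      have "\<bar>c a + d a\<bar> * \<rho> ^ mdeg a \<le> (\<bar>c a\<bar> + \<bar>d a\<bar>) * \<rho> ^ mdeg a"
        using \<rho>(1) by (intro mult_right_mono) auto
      then show "\<bar>c a + d a\<bar> * \<rho> ^ mdeg a \<le> \<bar>c a\<bar> * \<rho> ^ mdeg a + \<bar>d a\<bar> * \<rho> ^ mdeg a"
        by (simp add: distrib_right)
    qed (use \<rho>(1) in auto)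
    fix u :: "'n \<Rightarrow> real" assume u: "\<And>i. \<bar>u i\<bar> \<le> \<rho>"
    have "((\<lambda>a. c a * monom_at a u + d a * monom_at a u) has_sum f (\<lambda>i. p i + u i) + g (\<lambda>i. p i + u i)) UNIV"
      using u \<rho> by (intro has_sum_add c(3) d(3)) (auto intro: order_trans)
    then show "((\<lambda>a. (c a + d a) * monom_at a u) has_sum f (\<lambda>i. p i + u i) + g (\<lambda>i. p i + u i)) UNIV"
      by (simp add: distrib_right)
  qed
qed

lemma has_sum_product_real:
  fixes f :: "'a \<Rightarrow> real" and g :: "'b \<Rightarrow> real"
  assumes f: "(f has_sum s) UNIV" and g: "(g has_sum t) UNIV"
  shows "((\<lambda>(a, b). f a * g b) has_sum s * t) UNIV"
proof -
  have af: "(\<lambda>a. \<bar>f a\<bar>) summable_on UNIV" and ag: "(\<lambda>a. \<bar>g a\<bar>) summable_on UNIV"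
    using summable_on_iff_abs_summable_on_real[THEN iffD1, OF has_sum_imp_summable[OF f]]
      summable_on_iff_abs_summable_on_real[THEN iffD1, OF has_sum_imp_summable[OF g]] by simp_all
  have "(\<lambda>(a, b). \<bar>f a\<bar> * \<bar>g b\<bar>) summable_on Sigma UNIV (\<lambda>_. UNIV)"
  proof (rule summable_on_SigmaI)
    show "((\<lambda>b. case (a, b) of (a, b) \<Rightarrow> \<bar>f a\<bar> * \<bar>g b\<bar>) has_sum \<bar>f a\<bar> * infsum (\<lambda>b. \<bar>g b\<bar>) UNIV) UNIV" for a
      using has_sum_cmult_right[OF has_sum_infsum[OF ag]] by simp
    show "(\<lambda>a. \<bar>f a\<bar> * infsum (\<lambda>b. \<bar>g b\<bar>) UNIV) summable_on UNIV"
      by (rule summable_on_cmult_left[OF af])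
  qed auto
  then have "(\<lambda>p. norm (case p of (a, b) \<Rightarrow> f a * g b)) summable_on Sigma UNIV (\<lambda>_. UNIV)"
    by (simp add: case_prod_unfold abs_mult)
  then have "(\<lambda>(a, b). f a * g b) summable_on Sigma UNIV (\<lambda>_. UNIV)"
    by (rule abs_summable_summable)
  then have "((\<lambda>(a, b). f a * g b) has_sum s * t) (Sigma UNIV (\<lambda>_. UNIV))"
    by (intro has_sum_SigmaI[where g="\<lambda>a. f a * t"])
      (auto intro: has_sum_cmult_right[OF g] has_sum_cmult_left[OF f])
  then show ?thesis by simp
qed

lemma analytic_fun_mult:
  fixes f g :: "('n::finite \<Rightarrow> real) \<Rightarrow> real"
  assumes "analytic_fun f p" "analytic_fun g p"
  shows "analytic_fun (\<lambda>x. f x * g x) p"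
proof -
  obtain \<rho>0 c where c: "\<rho>0 > 0" "\<And>\<rho>. 0 \<le> \<rho> \<Longrightarrow> \<rho> \<le> \<rho>0 \<Longrightarrow> (\<lambda>a. \<bar>c a\<bar> * \<rho> ^ mdeg a) summable_on UNIV"
    "\<And>u. (\<And>i. \<bar>u i\<bar> \<le> \<rho>0) \<Longrightarrow> ((\<lambda>a. c a * monom_at a u) has_sum f (\<lambda>i. p i + u i)) UNIV"
    using analytic_funE[OF assms(1)] by blast
  obtain \<rho>1 d where d: "\<rho>1 > 0" "\<And>\<rho>. 0 \<le> \<rho> \<Longrightarrow> \<rho> \<le> \<rho>1 \<Longrightarrow> (\<lambda>a. \<bar>d a\<bar> * \<rho> ^ mdeg a) summable_on UNIV"
    "\<And>u. (\<And>i. \<bar>u i\<bar> \<le> \<rho>1) \<Longrightarrow> ((\<lambda>a. d a * monom_at a u) has_sum g (\<lambda>i. p i + u i)) UNIV"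
    using analytic_funE[OF assms(2)] by blast
  define \<rho> where "\<rho> = min \<rho>0 \<rho>1"
  have \<rho>: "\<rho> > 0" "\<rho> \<le> \<rho>0" "\<rho> \<le> \<rho>1" using c d by (auto simp: \<rho>_def)
  \<comment> \<open>Cauchy product: a pair of exponents contributes to its sum, and each exponent is
    a sum in finitely many ways.\<close>
  define h :: "('n \<Rightarrow> nat) \<times> ('n \<Rightarrow> nat) \<Rightarrow> 'n \<Rightarrow> nat" where "h = (\<lambda>(a, b) i. a i + b i)"
  have h_fin: "finite (h -` {e})" for e :: "'n \<Rightarrow> nat"
  proof (rule finite_subset)
    show "h -` {e} \<subseteq> {a. \<forall>i. a i \<le> e i} \<times> {a. \<forall>i. a i \<le> e i}" by (auto simp: h_def)
    show "finite ({a. \<forall>i. a i \<le> e i} \<times> {a. \<forall>i. a i \<le> e i})"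
      by (intro finite_cartesian_product finite_exponents_le)
  qed
  define k where "k = (\<lambda>e. \<Sum>(a, b)\<in>h -` {e}. c a * d b)"
  show ?thesis
  proof (rule analytic_funI[OF \<rho>(1), of k])
    have "((\<lambda>(a, b). (\<bar>c a\<bar> * \<rho> ^ mdeg a) * (\<bar>d b\<bar> * \<rho> ^ mdeg b)) has_sum
        infsum (\<lambda>a. \<bar>c a\<bar> * \<rho> ^ mdeg a) UNIV * infsum (\<lambda>a. \<bar>d a\<bar> * \<rho> ^ mdeg a) UNIV) UNIV"
      using \<rho> by (intro has_sum_product_real has_sum_infsum c d) auto
    from has_sum_fibers[OF this, of h, OF h_fin]
    have "(\<lambda>e. \<Sum>(a, b)\<in>h -` {e}. (\<bar>c a\<bar> * \<rho> ^ mdeg a) * (\<bar>d b\<bar> * \<rho> ^ mdeg b)) summable_on UNIV"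
      by (rule has_sum_imp_summable)
    then show "(\<lambda>e. \<bar>k e\<bar> * \<rho> ^ mdeg e) summable_on UNIV"
    proof (rule summable_on_comparison_test)
      fix e :: "'n \<Rightarrow> nat"
      have "\<bar>k e\<bar> * \<rho> ^ mdeg e \<le> (\<Sum>(a, b)\<in>h -` {e}. \<bar>c a * d b\<bar>) * \<rho> ^ mdeg e"
        unfolding k_def case_prod_unfold using \<rho>(1) by (intro mult_right_mono sum_abs) auto
      also have "\<dots> = (\<Sum>(a, b)\<in>h -` {e}. (\<bar>c a\<bar> * \<rho> ^ mdeg a) * (\<bar>d b\<bar> * \<rho> ^ mdeg b))"
        unfolding sum_distrib_right
        by (intro sum.cong refl) (auto simp: h_def mdeg_add power_add abs_mult)
      finally show "\<bar>k e\<bar> * \<rho> ^ mdeg e \<le> (\<Sum>(a, b)\<in>h -` {e}. (\<bar>c a\<bar> * \<rho> ^ mdeg a) * (\<bar>d b\<bar> * \<rho> ^ mdeg b))" .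
    qed (use \<rho>(1) in auto)
    fix u :: "'n \<Rightarrow> real" assume u: "\<And>i. \<bar>u i\<bar> \<le> \<rho>"
    have "((\<lambda>(a, b). (c a * monom_at a u) * (d b * monom_at b u)) has_sum
        f (\<lambda>i. p i + u i) * g (\<lambda>i. p i + u i)) UNIV"
      using u \<rho> by (intro has_sum_product_real c(3) d(3)) (auto intro: order_trans)
    from has_sum_fibers[OF this, of h, OF h_fin]
    have "((\<lambda>e. \<Sum>(a, b)\<in>h -` {e}. (c a * monom_at a u) * (d b * monom_at b u)) has_sum
        f (\<lambda>i. p i + u i) * g (\<lambda>i. p i + u i)) UNIV" .
    also have "(\<lambda>e. \<Sum>(a, b)\<in>h -` {e}. (c a * monom_at a u) * (d b * monom_at b u)) = (\<lambda>e. k e * monom_at e u)"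
      unfolding k_def sum_distrib_right
      by (intro ext sum.cong refl) (auto simp: h_def monom_at_mult[symmetric])
    finally show "((\<lambda>e. k e * monom_at e u) has_sum f (\<lambda>i. p i + u i) * g (\<lambda>i. p i + u i)) UNIV" .
  qed
qed

lemma analytic_fun_sum:
  "finite I \<Longrightarrow> (\<And>i. i \<in> I \<Longrightarrow> analytic_fun (f i) p) \<Longrightarrow> analytic_fun (\<lambda>x. \<Sum>i\<in>I. f i x) p"
  by (induction I rule: finite_induct) (simp_all add: analytic_fun_const analytic_fun_add)

lemma analytic_fun_diff:
  assumes "analytic_fun f p" "analytic_fun g p"
  shows "analytic_fun (\<lambda>x. f x - g x) p"
  using analytic_fun_add[OF assms(1) analytic_fun_mult[OF analytic_fun_const[of "-1"] assms(2)]] by simp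

text \<open>On a line through \<open>p\<close> the homogeneous parts of the series become the
  coefficients of a power series in one variable.\<close>

lemma analytic_fun_line:
  fixes f :: "('a::finite \<Rightarrow> real) \<Rightarrow> real"
  assumes "analytic_fun f p"
  shows "\<exists>F. (\<lambda>t. f (\<lambda>i. p i + t * v i)) has_fps_expansion F"
proof -
  obtain \<rho> c where \<rho>: "\<rho> > 0" and c:
    "\<And>u. (\<And>i. \<bar>u i\<bar> \<le> \<rho>) \<Longrightarrow> ((\<lambda>a. c a * monom_at a u) has_sum f (\<lambda>i. p i + u i)) UNIV"
    using analytic_funE[OF assms] by metis
  define M where "M = 1 + (\<Sum>i\<in>UNIV. \<bar>v i\<bar>)"
  have vM: "\<bar>v i\<bar> \<le> M" for i
    using member_le_sum[of i UNIV "\<lambda>i. \<bar>v i\<bar>"] by (simp add: M_def)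
  have M: "M > 0" unfolding M_def by (simp add: add_pos_nonneg sum_nonneg)
  define r where "r = \<rho> / M"
  have r: "r > 0" using \<rho> M by (simp add: r_def)
  define b where "b = (\<lambda>n. \<Sum>a | mdeg a = n. c a * monom_at a v)"
  have sums: "(\<lambda>n. b n * t ^ n) sums f (\<lambda>i. p i + t * v i)" if t: "\<bar>t\<bar> \<le> r" for t
  proof -
    have "\<bar>t * v i\<bar> \<le> \<rho>" for i
    proof -
      have "\<bar>t * v i\<bar> \<le> r * M" unfolding abs_mult using t vM r by (intro mult_mono) auto
      then show ?thesis using M by (simp add: r_def)
    qed
    then have "((\<lambda>a. c a * monom_at a (\<lambda>i. t * v i)) has_sum f (\<lambda>i. p i + t * v i)) UNIV" by (rule c)
    moreover have "finite (mdeg -` {n} :: ('a \<Rightarrow> nat) set)" for n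
      using finite_mdeg[of n, where 'n='a] by (simp add: vimage_def)
    ultimately have "((\<lambda>n. \<Sum>a\<in>mdeg -` {n}. c a * monom_at a (\<lambda>i. t * v i)) has_sum f (\<lambda>i. p i + t * v i)) UNIV"
      by (rule has_sum_fibers)
    also have "(\<lambda>n. \<Sum>a\<in>mdeg -` {n}. c a * monom_at a (\<lambda>i. t * v i)) = (\<lambda>n. b n * t ^ n)"
      unfolding b_def sum_distrib_right by (intro ext sum.cong) (auto simp: monom_at_scale)
    finally show ?thesis by (rule has_sum_imp_sums)
  qed
  have "norm r \<le> conv_radius b"
    using sums[of r] r by (intro conv_radius_geI) (auto simp: sums_iff)
  then have "fps_conv_radius (Abs_fps b) > 0"
    using r by (simp add: fps_conv_radius_def) (metis ereal_less(2) less_le_trans abs_of_pos)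
  moreover have "eventually (\<lambda>t. eval_fps (Abs_fps b) t = f (\<lambda>i. p i + t * v i)) (nhds 0)"
  proof -
    have "eventually (\<lambda>t. t \<in> {-r<..<r}) (nhds 0)"
      using r by (intro eventually_nhds_in_open) auto
    then show ?thesis
    proof (rule eventually_mono)
      fix t assume "t \<in> {-r<..<r}"
      then have "(\<lambda>n. b n * t ^ n) sums f (\<lambda>i. p i + t * v i)" by (intro sums) auto
      then show "eval_fps (Abs_fps b) t = f (\<lambda>i. p i + t * v i)" by (simp add: eval_fps_def sums_iff)
    qed
  qed
  ultimately show ?thesis unfolding has_fps_expansion_def by blast
qed

text \<open>The constant terms cancel, and every monomial of positive degree \<open>n\<close> is at
  most \<open>s / \<rho>\<close> times \<open>\<rho> ^ n\<close>, so the whole difference is at most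
  \<open>s / \<rho>\<close> times the absolute sum at \<open>\<rho>\<close>.\<close>

lemma analytic_fun_lipschitz:
  assumes "analytic_fun f p"
  obtains \<rho> C where "\<rho> > 0" "\<And>u s. (\<And>i. \<bar>u i\<bar> \<le> s) \<Longrightarrow> 0 \<le> s \<Longrightarrow> s \<le> \<rho> \<Longrightarrow> \<bar>f (\<lambda>i. p i + u i) - f p\<bar> \<le> C * s"
proof -
  obtain \<rho> c where \<rho>: "\<rho> > 0" "\<And>s. 0 \<le> s \<Longrightarrow> s \<le> \<rho> \<Longrightarrow> (\<lambda>a. \<bar>c a\<bar> * s ^ mdeg a) summable_on UNIV"
    and c: "\<And>u. (\<And>i. \<bar>u i\<bar> \<le> \<rho>) \<Longrightarrow> ((\<lambda>a. c a * monom_at a u) has_sum f (\<lambda>i. p i + u i)) UNIV"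
    using analytic_funE[OF assms] by blast
  define T where "T = infsum (\<lambda>a. \<bar>c a\<bar> * \<rho> ^ mdeg a) UNIV"
  have T: "((\<lambda>a. \<bar>c a\<bar> * \<rho> ^ mdeg a) has_sum T) UNIV"
    unfolding T_def using \<rho> by (intro has_sum_infsum) auto
  have "\<bar>f (\<lambda>i. p i + u i) - f p\<bar> \<le> (T / \<rho>) * s" if u: "\<And>i. \<bar>u i\<bar> \<le> s" and s: "0 \<le> s" "s \<le> \<rho>" for u s
  proof -
    have "((\<lambda>a. c a * monom_at a u) has_sum f (\<lambda>i. p i + u i)) UNIV"
      using u s by (intro c) (meson order_trans)
    moreover have "((\<lambda>a. c a * monom_at a (\<lambda>_. 0)) has_sum f p) UNIV"
      using c[of "\<lambda>_. 0"] \<rho>(1) by simp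
    ultimately have D: "((\<lambda>a. c a * monom_at a u - c a * monom_at a (\<lambda>_. 0)) has_sum f (\<lambda>i. p i + u i) - f p) UNIV"
      using has_sum_add[OF _ has_sum_cmult_right[of _ UNIV "f p" "-1"]] by fastforce
    have B: "\<bar>c a * monom_at a u - c a * monom_at a (\<lambda>_. 0)\<bar> \<le> (\<bar>c a\<bar> * \<rho> ^ mdeg a) * (s / \<rho>)" for a
    proof (cases "a = (\<lambda>_. 0)")
      case True
      then show ?thesis using s \<rho>(1) by (simp add: monom_at_def)
    next
      case False
      then obtain i where i: "a i > 0" by auto
      then have "mdeg a > 0" using member_le_sum[of i UNIV a] by (simp add: mdeg_def)
      then obtain m where m: "mdeg a = Suc m" using gr0_implies_Suc by blast
      have "monom_at a (\<lambda>_. 0) = 0" unfolding monom_at_def using i by (auto intro!: prod_zero bexI[of _ i])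
      moreover have "\<bar>monom_at a u\<bar> \<le> \<rho> ^ mdeg a * (s / \<rho>)"
      proof -
        have "\<bar>monom_at a u\<bar> \<le> s ^ mdeg a" by (rule monom_at_bound[OF u])
        also have "\<dots> = s * s ^ m" by (simp add: m)
        also have "\<dots> \<le> s * \<rho> ^ m" using s by (intro mult_left_mono power_mono) auto
        also have "\<dots> = \<rho> ^ mdeg a * (s / \<rho>)" using \<rho>(1) by (simp add: m)
        finally show ?thesis .
      qed
      ultimately show ?thesis
        using mult_left_mono[of "\<bar>monom_at a u\<bar>" "\<rho> ^ mdeg a * (s / \<rho>)" "\<bar>c a\<bar>"]
        by (simp add: abs_mult mult.assoc)
    qed
    have TT: "((\<lambda>a. (\<bar>c a\<bar> * \<rho> ^ mdeg a) * (s / \<rho>)) has_sum T * (s / \<rho>)) UNIV"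
      by (rule has_sum_cmult_left[OF T])
    have "f (\<lambda>i. p i + u i) - f p \<le> T * (s / \<rho>)"
      by (rule has_sum_mono[OF D TT]) (use B in \<open>auto simp: abs_le_iff\<close>)
    moreover have "((\<lambda>a. - (c a * monom_at a u - c a * monom_at a (\<lambda>_. 0))) has_sum - (f (\<lambda>i. p i + u i) - f p)) UNIV"
      using has_sum_cmult_right[OF D, of "-1"] by simp
    then have "- (f (\<lambda>i. p i + u i) - f p) \<le> T * (s / \<rho>)"
      by (rule has_sum_mono[OF _ TT]) (use B abs_le_D2 in blast)
    ultimately have "\<bar>f (\<lambda>i. p i + u i) - f p\<bar> \<le> T * (s / \<rho>)" by (rule abs_leI)
    then show ?thesis by simp
  qed
  with \<rho>(1) show thesis using that by blast
qed

section \<open>Termwise differentiation of multivariate series\<close>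

lemma bij_nat_exponents:
  obtains e :: "nat \<Rightarrow> ('n::finite \<Rightarrow> nat)" where "bij e"
proof -
  have "infinite (UNIV :: ('n \<Rightarrow> nat) set)"
    by (metis finite_fun_UNIVD2 infinite_UNIV_nat)
  then have "bij_betw (from_nat_into UNIV) UNIV (UNIV :: ('n \<Rightarrow> nat) set)"
    by (intro bij_betw_from_nat_into) auto
  then show thesis using that by blast
qed

lemma monom_at_update:
  fixes u :: "'n::finite \<Rightarrow> real"
  shows "monom_at a (u(i := x)) = x ^ a i * (\<Prod>j\<in>UNIV - {i}. u j ^ a j)"
proof -
  have "monom_at a (u(i := x)) = (\<Prod>j\<in>insert i (UNIV - {i}). (u(i := x)) j ^ a j)"
    by (simp add: monom_at_def insert_absorb)
  also have "\<dots> = x ^ a i * (\<Prod>j\<in>UNIV - {i}. (u(i := x)) j ^ a j)"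
    by (subst prod.insert) auto
  also have "(\<Prod>j\<in>UNIV - {i}. (u(i := x)) j ^ a j) = (\<Prod>j\<in>UNIV - {i}. u j ^ a j)"
    by (intro prod.cong) auto
  finally show ?thesis .
qed

text \<open>If \<open>a i = 0\<close>, the truncated exponent \<open>a i - 1\<close> is 0 and the
  factor \<open>real (a i)\<close> removes the term, as it should.\<close>

lemma monom_at_has_derivative:
  fixes u :: "'n::finite \<Rightarrow> real"
  shows "((\<lambda>x. monom_at a (u(i := x))) has_real_derivative
    real (a i) * monom_at (a(i := a i - 1)) (u(i := x))) (at x within S)"
proof -
  have "(\<Prod>j\<in>UNIV - {i}. u j ^ (a(i := a i - 1)) j) = (\<Prod>j\<in>UNIV - {i}. u j ^ a j)"
    by (intro prod.cong) auto
  then show ?thesis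
    unfolding monom_at_update by (auto intro!: derivative_eq_intros)
qed

lemma mdeg_update: "a i > 0 \<Longrightarrow> mdeg a = Suc (mdeg (a(i := a i - 1)))" for a :: "'n::finite \<Rightarrow> nat"
proof -
  assume a: "a i > 0"
  have "mdeg b = b i + (\<Sum>j\<in>UNIV - {i}. b j)" for b :: "'n \<Rightarrow> nat"
    unfolding mdeg_def by (rule sum.remove) auto
  from this[of a] this[of "a(i := a i - 1)"] show ?thesis using a by simp
qed

text \<open>One halving of the radius absorbs the exponents produced by differentiation, the second one
  leaves room to vary the differentiated variable.\<close>
lemma analytic_fun_partial:
  fixes f g :: "('n::finite \<Rightarrow> real) \<Rightarrow> real"
  assumes f: "analytic_fun f p" and r: "r > 0"
    and deriv: "\<And>u. (\<And>j. \<bar>u j\<bar> \<le> r) \<Longrightarrow>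
      ((\<lambda>x. f (\<lambda>j. p j + (u(i := x)) j)) has_real_derivative g (\<lambda>j. p j + u j)) (at (u i))"
  shows "analytic_fun g p"
proof -
  obtain \<rho> c where \<rho>: "\<rho> > 0" "\<And>s. 0 \<le> s \<Longrightarrow> s \<le> \<rho> \<Longrightarrow> (\<lambda>a. \<bar>c a\<bar> * s ^ mdeg a) summable_on UNIV"
    and c: "\<And>u. (\<And>i. \<bar>u i\<bar> \<le> \<rho>) \<Longrightarrow> ((\<lambda>a. c a * monom_at a u) has_sum f (\<lambda>i. p i + u i)) UNIV"
    using analytic_funE[OF f] by blast
  define \<sigma> where "\<sigma> = \<rho> / 2"
  have \<sigma>: "\<sigma> > 0" "\<sigma> \<le> \<rho>" using \<rho>(1) by (auto simp: \<sigma>_def)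
  obtain e :: "nat \<Rightarrow> ('n \<Rightarrow> nat)" where e: "bij e" using bij_nat_exponents by blast
  define dec where "dec = (\<lambda>a::'n \<Rightarrow> nat. a(i := a i - 1))"
  define B where "B = (\<lambda>a. (\<bar>c a\<bar> * \<rho> ^ mdeg a) * (1 / \<sigma>))"
  have B: "B summable_on UNIV" unfolding B_def using \<rho> by (intro summable_on_cmult_left) auto
  have bound: "\<bar>c a\<bar> * real (a i) * s ^ mdeg (dec a) \<le> B a" if s: "0 \<le> s" "s \<le> \<sigma>" for a s
  proof (cases "a i = 0")
    case True
    then show ?thesis using \<rho>(1) \<sigma>(1) by (simp add: B_def)
  next
    case False
    then have m: "mdeg a = Suc (mdeg (dec a))" unfolding dec_def by (intro mdeg_update) auto
    have "a i \<le> mdeg a" unfolding mdeg_def by (rule member_le_sum) auto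
    \<comment> \<open>As \<open>\<sigma> = \<rho> / 2\<close>, the powers of 2 turn powers of
      \<open>\<sigma>\<close> into powers of \<open>\<rho>\<close>, leaving one factor
      \<open>1 / \<sigma>\<close> for the lowered degree.\<close>
    then have "real (a i) \<le> 2 ^ mdeg a" using of_nat_less_two_power[of "mdeg a", where 'a=real] by linarith
    then have "real (a i) * s ^ mdeg (dec a) \<le> 2 ^ mdeg a * \<sigma> ^ mdeg (dec a)"
      using s by (intro mult_mono power_mono) auto
    also have "\<dots> = \<rho> ^ mdeg a * (1 / \<sigma>)"
      using \<sigma>(1) by (simp add: m \<sigma>_def power_divide)
    finally show ?thesis unfolding B_def mult.assoc by (intro mult_left_mono) auto
  qed
  define D where "D = (\<lambda>u a. c a * (real (a i) * monom_at (dec a) u))"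
  have D_bound: "\<bar>D u a\<bar> \<le> B a" if "\<And>j. \<bar>u j\<bar> \<le> \<sigma>" for u a
  proof -
    have "\<bar>D u a\<bar> = \<bar>c a\<bar> * real (a i) * \<bar>monom_at (dec a) u\<bar>" by (simp add: D_def abs_mult)
    also have "\<dots> \<le> \<bar>c a\<bar> * real (a i) * \<sigma> ^ mdeg (dec a)"
      by (intro mult_left_mono monom_at_bound that) auto
    also have "\<dots> \<le> B a" using \<sigma>(1) by (intro bound) auto
    finally show ?thesis .
  qed
  have D_sum: "(D u has_sum g (\<lambda>j. p j + u j)) UNIV" if u: "\<And>j. \<bar>u j\<bar> \<le> min r (\<sigma> / 2)" for u
  proof -
    have u': "\<bar>u j\<bar> \<le> r" "\<bar>u j\<bar> \<le> \<sigma> / 2" for j using u[of j] by auto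
    define S where "S = {-\<sigma><..<\<sigma>}"
    have uS: "\<bar>(u(i := x)) j\<bar> \<le> \<sigma>" if "x \<in> S" for x j
      using u'(2)[of j] that \<sigma>(1) by (auto simp: S_def)
    have ui: "u i \<in> S" using u'(2)[of i] \<sigma>(1) by (auto simp: S_def)
    \<comment> \<open>The criterion for termwise differentiation is about sequences, hence the
      enumeration \<open>e\<close> of the exponents.\<close>
    define F where "F = (\<lambda>n x. c (e n) * monom_at (e n) (u(i := x)))"
    have F_sums: "(\<lambda>n. F n x) sums f (\<lambda>j. p j + (u(i := x)) j)" if "x \<in> S" for x
    proof -
      have "((\<lambda>a. c a * monom_at a (u(i := x))) has_sum f (\<lambda>j. p j + (u(i := x)) j)) UNIV"
        using uS[OF that] \<sigma>(2) by (intro c) (meson order_trans)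
      then have "((\<lambda>n. F n x) has_sum f (\<lambda>j. p j + (u(i := x)) j)) UNIV"
        unfolding F_def using has_sum_reindex_bij_betw[OF e, of "\<lambda>a. c a * monom_at a (u(i := x))"] by blast
      then show ?thesis by (rule has_sum_imp_sums)
    qed
    have "((\<lambda>x. \<Sum>n. F n x) has_real_derivative (\<Sum>n. D (u(i := u i)) (e n))) (at (u i))"
    proof (rule has_field_derivative_series'(2)[where S=S and x0="u i" and f'="\<lambda>n x. D (u(i := x)) (e n)"])
      show "convex S" by (simp add: S_def)
      show "(F n has_real_derivative D (u(i := x)) (e n)) (at x within S)" for n x
        unfolding F_def D_def dec_def by (intro DERIV_cmult monom_at_has_derivative)
      show "uniformly_convergent_on S (\<lambda>n x. \<Sum>k<n. D (u(i := x)) (e k))"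
      proof (rule Weierstrass_m_test')
        show "norm (D (u(i := x)) (e n)) \<le> B (e n)" if "x \<in> S" for n x
          unfolding real_norm_def by (rule D_bound) (rule uS[OF that])
        have "(\<lambda>n. B (e n)) summable_on UNIV" using B summable_on_reindex_bij_betw[OF e] by blast
        then show "summable (\<lambda>n. B (e n))" by (rule summable_on_imp_summable)
      qed
      show "u i \<in> S" by (rule ui)
      show "u i \<in> interior S" using ui by (simp add: S_def)
      show "summable (\<lambda>n. F n (u i))" using F_sums[OF ui] by (simp add: sums_iff)
    qed
    then have "((\<lambda>x. f (\<lambda>j. p j + (u(i := x)) j)) has_real_derivative (\<Sum>n. D (u(i := u i)) (e n))) (at (u i))"
    proof (rule DERIV_cong_ev[THEN iffD1, rotated 3])
      have "eventually (\<lambda>x. x \<in> S) (nhds (u i))"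
        using ui by (intro eventually_nhds_in_open) (auto simp: S_def)
      then show "eventually (\<lambda>x. (\<Sum>n. F n x) = f (\<lambda>j. p j + (u(i := x)) j)) (nhds (u i))"
        by (rule eventually_mono) (use F_sums in \<open>auto simp: sums_iff\<close>)
    qed auto
    \<comment> \<open>The function \<open>g\<close> is known only as the partial derivative;
      uniqueness of derivatives identifies it with the differentiated series.\<close>
    from DERIV_unique[OF deriv[OF u'(1)] this] have g_eq: "g (\<lambda>j. p j + u j) = (\<Sum>n. D u (e n))"
      by (simp only: fun_upd_triv)
    have u\<sigma>: "\<bar>u j\<bar> \<le> \<sigma>" for j using u'(2)[of j] \<sigma>(1) by linarith
    have "D u summable_on UNIV"
    proof -
      have "(\<lambda>a. norm (D u a)) summable_on UNIV"
        by (rule Infinite_Sum.abs_summable_on_comparison_test'[OF B]) (unfold real_norm_def, rule D_bound, rule u\<sigma>)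
      then show ?thesis by (rule abs_summable_summable)
    qed
    then have s: "(D u has_sum infsum (D u) UNIV) UNIV" by (rule has_sum_infsum)
    then have "((\<lambda>n. D u (e n)) has_sum infsum (D u) UNIV) UNIV"
      using has_sum_reindex_bij_betw[OF e, of "D u"] by blast
    then have "(\<lambda>n. D u (e n)) sums infsum (D u) UNIV" by (rule has_sum_imp_sums)
    then show ?thesis using s g_eq by (simp add: sums_iff)
  qed
  \<comment> \<open>The differentiated series is still indexed by the old exponents. Those with
    \<open>a i = 0\<close> contribute nothing, and \<open>inc\<close> reindexes the others by the
    exponent of the differentiated monomial.\<close>
  define inc where "inc = (\<lambda>a::'n \<Rightarrow> nat. a(i := a i + 1))"
  have inc_inj: "inj inc"
  proof (rule injI)
    fix a b assume "inc a = inc b"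
    then have "dec (inc a) = dec (inc b)" by simp
    then show "a = b" by (simp add: dec_def inc_def fun_upd_idem_iff)
  qed
  have dec_inc: "dec (inc a) = a" for a by (simp add: dec_def inc_def)
  define d where "d = (\<lambda>a. c (inc a) * real (inc a i))"
  define \<tau> where "\<tau> = min r (\<sigma> / 2)"
  show ?thesis
  proof (rule analytic_funI[of \<tau> d])
    show \<tau>: "\<tau> > 0" using r \<sigma>(1) by (simp add: \<tau>_def)
    have "B summable_on (range inc)" by (rule summable_on_subset_banach[OF B]) auto
    then have "(\<lambda>a. B (inc a)) summable_on UNIV"
      using summable_on_reindex[OF inc_inj, of B] by (simp add: o_def)
    then show "(\<lambda>a. \<bar>d a\<bar> * \<tau> ^ mdeg a) summable_on UNIV"
    proof (rule summable_on_comparison_test)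
      show "\<bar>d a\<bar> * \<tau> ^ mdeg a \<le> B (inc a)" for a
        using bound[of \<tau> "inc a"] \<tau> \<sigma>(1) by (simp add: d_def dec_inc abs_mult \<tau>_def)
    qed (use \<tau> in auto)
    fix u :: "'n \<Rightarrow> real" assume u: "\<And>j. \<bar>u j\<bar> \<le> \<tau>"
    have "(D u has_sum g (\<lambda>j. p j + u j)) UNIV" using u unfolding \<tau>_def by (rule D_sum)
    also have "?this \<longleftrightarrow> (D u has_sum g (\<lambda>j. p j + u j)) (range inc)"
    proof (rule has_sum_cong_neutral)
      fix a assume "a \<in> UNIV - range inc"
      moreover have "a = inc (dec a)" if "a i \<noteq> 0" using that by (auto simp: inc_def dec_def)
      ultimately have "a i = 0" by blast
      then show "D u a = 0" by (simp add: D_def)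
    qed auto
    also have "\<dots> \<longleftrightarrow> ((D u \<circ> inc) has_sum g (\<lambda>j. p j + u j)) UNIV"
      by (rule has_sum_reindex[OF inc_inj])
    also have "D u \<circ> inc = (\<lambda>a. d a * monom_at a u)"
      by (simp add: D_def d_def dec_inc fun_eq_iff)
    finally show "((\<lambda>a. d a * monom_at a u) has_sum g (\<lambda>j. p j + u j)) UNIV" .
  qed
qed

text \<open>Point and parameter are merged into one family over a sum type, so that joint
  analyticity is a statement about a single family of variables and a derivative in \<open>x\<close>
  is a partial derivative in an \<open>Inl\<close> coordinate.\<close>

definition coords_of :: "real^'m::finite \<Rightarrow> real^'l::finite \<Rightarrow> 'm + 'l \<Rightarrow> real" where
  "coords_of x z = case_sum (\<lambda>i. x $ i) (\<lambda>j. z $ j)"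

definition on_coords :: "(real^'m::finite \<Rightarrow> real^'l::finite \<Rightarrow> real) \<Rightarrow> ('m + 'l \<Rightarrow> real) \<Rightarrow> real" where
  "on_coords h w = h (\<chi> i. w (Inl i)) (\<chi> j. w (Inr j))"

lemma on_coords_join: "on_coords h (coords_of x z) = h x z"
  by (simp add: on_coords_def coords_of_def)

lemma real_analytic_at_imp_analytic_fun:
  fixes h :: "real^'m::finite \<Rightarrow> real^'l::finite \<Rightarrow> real"
  assumes "real_analytic_at (\<lambda>(x, z). h x z) (x, z)"
  shows "analytic_fun (on_coords h) (coords_of x z)"
proof -
  obtain e c where e: "e > 0" and c: "\<And>q. dist q (x, z) < e \<Longrightarrow>
      ((\<lambda>(\<alpha>, \<beta>). c (\<alpha>, \<beta>) * (\<Prod>i\<in>UNIV. (fst q $ i - x $ i) ^ \<alpha> i)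
                            * (\<Prod>j\<in>UNIV. (snd q $ j - z $ j) ^ \<beta> j))
             has_sum (\<lambda>(x, z). h x z) q) UNIV"
    using assms unfolding real_analytic_at_def fst_conv snd_conv by blast
  define split :: "('m + 'l \<Rightarrow> nat) \<Rightarrow> ('m \<Rightarrow> nat) \<times> ('l \<Rightarrow> nat)" where "split = (\<lambda>a. (a \<circ> Inl, a \<circ> Inr))"
  have split: "bij split"
    by (rule o_bij[of "\<lambda>(\<alpha>, \<beta>). case_sum \<alpha> \<beta>"]) (auto simp: split_def fun_eq_iff split: sum.splits)
  define n where "n = real CARD('m) + real CARD('l)"
  have n: "n > 0" by (simp add: n_def add_pos_pos)
  \<comment> \<open>The norm of the increment is at most the sum of its \<open>n\<close>
    coordinates; the 2 makes the comparison with \<open>e\<close> strict.\<close>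
  define \<rho> where "\<rho> = e / (2 * n)"
  have \<rho>: "\<rho> > 0" using e n by (simp add: \<rho>_def)
  have S: "((\<lambda>a. c (split a) * monom_at a u) has_sum on_coords h (\<lambda>k. coords_of x z k + u k)) UNIV"
    if u: "\<And>k. \<bar>u k\<bar> \<le> \<rho>" for u
  proof -
    define q where "q = (x + (\<chi> i. u (Inl i)), z + (\<chi> j. u (Inr j)))"
    have "norm (q - (x, z)) = norm ((\<chi> i. u (Inl i)) :: real^'m, (\<chi> j. u (Inr j)) :: real^'l)"
      by (simp add: q_def)
    also have "\<dots> \<le> norm ((\<chi> i. u (Inl i)) :: real^'m) + norm ((\<chi> j. u (Inr j)) :: real^'l)"
      by (rule norm_Pair_le)
    also have "\<dots> \<le> (\<Sum>i\<in>(UNIV::'m set). \<bar>u (Inl i)\<bar>) + (\<Sum>j\<in>(UNIV::'l set). \<bar>u (Inr j)\<bar>)"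
      using norm_le_l1_cart[of "(\<chi> i. u (Inl i)) :: real^'m"] norm_le_l1_cart[of "(\<chi> j. u (Inr j)) :: real^'l"]
      by (intro add_mono) auto
    also have "\<dots> \<le> (\<Sum>i\<in>(UNIV::'m set). \<rho>) + (\<Sum>j\<in>(UNIV::'l set). \<rho>)"
      by (intro add_mono sum_mono u)
    also have "\<dots> = n * \<rho>" by (simp add: n_def algebra_simps)
    also have "\<dots> < e" using e n by (simp add: \<rho>_def)
    finally have "dist q (x, z) < e" by (simp add: dist_norm)
    from c[OF this] have "((\<lambda>(\<alpha>, \<beta>). c (\<alpha>, \<beta>) * (\<Prod>i\<in>UNIV. u (Inl i) ^ \<alpha> i)
        * (\<Prod>j\<in>UNIV. u (Inr j) ^ \<beta> j)) has_sum h (x + (\<chi> i. u (Inl i))) (z + (\<chi> j. u (Inr j)))) UNIV"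
      by (simp add: q_def)
    then have "((\<lambda>a. (\<lambda>(\<alpha>, \<beta>). c (\<alpha>, \<beta>) * (\<Prod>i\<in>UNIV. u (Inl i) ^ \<alpha> i)
        * (\<Prod>j\<in>UNIV. u (Inr j) ^ \<beta> j)) (split a)) has_sum h (x + (\<chi> i. u (Inl i))) (z + (\<chi> j. u (Inr j)))) UNIV"
      using has_sum_reindex_bij_betw[OF split] by blast
    also have "(\<lambda>a. (\<lambda>(\<alpha>, \<beta>). c (\<alpha>, \<beta>) * (\<Prod>i\<in>UNIV. u (Inl i) ^ \<alpha> i)
        * (\<Prod>j\<in>UNIV. u (Inr j) ^ \<beta> j)) (split a)) = (\<lambda>a. c (split a) * monom_at a u)"
    proof
      fix a
      have "monom_at a u = (\<Prod>i\<in>UNIV. u (Inl i) ^ a (Inl i)) * (\<Prod>j\<in>UNIV. u (Inr j) ^ a (Inr j))"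
        unfolding monom_at_def UNIV_Plus_UNIV[symmetric] by (subst prod.Plus) auto
      then show "(\<lambda>(\<alpha>, \<beta>). c (\<alpha>, \<beta>) * (\<Prod>i\<in>UNIV. u (Inl i) ^ \<alpha> i)
        * (\<Prod>j\<in>UNIV. u (Inr j) ^ \<beta> j)) (split a) = c (split a) * monom_at a u"
        by (simp add: split_def)
    qed
    also have "h (x + (\<chi> i. u (Inl i))) (z + (\<chi> j. u (Inr j))) = on_coords h (\<lambda>k. coords_of x z k + u k)"
      unfolding on_coords_def by (intro arg_cong2[of _ _ _ _ h]) (auto simp: vec_eq_iff coords_of_def)
    finally show ?thesis .
  qed
  show ?thesis
  proof (rule analytic_funI[OF \<rho> _ S])
    \<comment> \<open>At the corner of the polydisc, where every coordinate is
      \<open>\<rho>\<close>, unconditional summability of a real series is already the absolute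
      summability required.\<close>
    have "(\<lambda>a. c (split a) * monom_at a (\<lambda>_. \<rho>)) summable_on UNIV"
      using \<rho> by (intro has_sum_imp_summable[OF S]) auto
    from summable_on_iff_abs_summable_on_real[THEN iffD1, OF this]
    show "(\<lambda>a. \<bar>c (split a)\<bar> * \<rho> ^ mdeg a) summable_on UNIV"
      using \<rho> by (simp add: abs_mult monom_at_def mdeg_def flip: power_sum)
  qed
qed

section \<open>Zero sets of analytic functions\<close>

text \<open>Weaker than analyticity but sufficient for zero sets, and closed under products and
  differences by one-variable rules. Continuity is included because it makes the zero sets
  Borel.\<close>

definition line_analytic_at :: "('p::real_normed_vector \<Rightarrow> real) \<Rightarrow> 'p \<Rightarrow> bool" where
  "line_analytic_at h p \<longleftrightarrow> isCont h p \<and> (\<forall>v. \<exists>F. (\<lambda>t. h (p + t *\<^sub>R v)) has_fps_expansion F)"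

lemma line_analytic_at_const: "line_analytic_at (\<lambda>_. c) p"
  unfolding line_analytic_at_def by auto

lemma line_analytic_at_mult:
  assumes "line_analytic_at f p" "line_analytic_at g p"
  shows "line_analytic_at (\<lambda>x. f x * g x) p"
  unfolding line_analytic_at_def
proof (intro conjI allI)
  show "isCont (\<lambda>x. f x * g x) p" using assms unfolding line_analytic_at_def by (intro isCont_mult) auto
  fix v
  obtain F G where "(\<lambda>t. f (p + t *\<^sub>R v)) has_fps_expansion F" "(\<lambda>t. g (p + t *\<^sub>R v)) has_fps_expansion G"
    using assms unfolding line_analytic_at_def by blast
  from has_fps_expansion_mult[OF this]
  show "\<exists>F. (\<lambda>t. f (p + t *\<^sub>R v) * g (p + t *\<^sub>R v)) has_fps_expansion F" by blast
qed

lemma line_analytic_at_diff: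
  assumes "line_analytic_at f p" "line_analytic_at g p"
  shows "line_analytic_at (\<lambda>x. f x - g x) p"
  unfolding line_analytic_at_def
proof (intro conjI allI)
  show "isCont (\<lambda>x. f x - g x) p" using assms unfolding line_analytic_at_def by (intro isCont_diff) auto
  fix v
  obtain F G where "(\<lambda>t. f (p + t *\<^sub>R v)) has_fps_expansion F" "(\<lambda>t. g (p + t *\<^sub>R v)) has_fps_expansion G"
    using assms unfolding line_analytic_at_def by blast
  from has_fps_expansion_diff[OF this]
  show "\<exists>F. (\<lambda>t. f (p + t *\<^sub>R v) - g (p + t *\<^sub>R v)) has_fps_expansion F" by blast
qed

text \<open>The estimate and the line expansion are obtained in joint coordinates; an increment 0 in
  \<open>z\<close> or in \<open>x\<close> then gives the two separate claims.\<close>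

lemma analytic_fun_imp_line_analytic_at:
  fixes h :: "real^'m::finite \<Rightarrow> real^'l::finite \<Rightarrow> real"
  assumes h: "analytic_fun (on_coords h) (coords_of x z)"
  shows "line_analytic_at (\<lambda>x. h x z) x" "line_analytic_at (\<lambda>z. h x z) z"
proof -
  obtain \<rho> C where \<rho>: "\<rho> > 0" and C: "\<And>u s. (\<And>i. \<bar>u i\<bar> \<le> s) \<Longrightarrow> 0 \<le> s \<Longrightarrow> s \<le> \<rho> \<Longrightarrow>
      \<bar>on_coords h (\<lambda>i. coords_of x z i + u i) - on_coords h (coords_of x z)\<bar> \<le> C * s"
    using analytic_fun_lipschitz[OF h] by blast
  have shift: "on_coords h (\<lambda>i. coords_of x z i + coords_of v w i) = h (x + v) (z + w)" for v w
    unfolding on_coords_def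
    by (intro arg_cong2[of _ _ _ _ h]) (auto simp: coords_of_def vec_eq_iff)
  have est: "\<bar>h (x + v) (z + w) - h x z\<bar> \<le> C * s" if "norm v \<le> s" "norm w \<le> s" "s \<le> \<rho>" for v w s
  proof -
    have "\<bar>v $ i\<bar> \<le> s" "\<bar>w $ j\<bar> \<le> s" for i j
      using that component_le_norm_cart[of v i] component_le_norm_cart[of w j] by auto
    then have "\<bar>coords_of v w k\<bar> \<le> s" for k by (cases k) (auto simp: coords_of_def)
    moreover have "0 \<le> s" using that(1) norm_ge_zero order_trans by blast
    ultimately show ?thesis
      using C[OF _ _ that(3), of "coords_of v w"] by (simp only: shift on_coords_join)
  qed
  have lim: "((\<lambda>s. C * norm (s - a)) \<longlongrightarrow> 0) (at a)" for a :: "'b::real_normed_vector"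
    using tendsto_mult_right_zero[OF tendsto_norm_zero[OF LIM_zero[OF tendsto_ident_at]]] by blast
  have near: "eventually (\<lambda>s. norm (s - a) \<le> \<rho>) (at a)" for a :: "'b::real_normed_vector"
    unfolding eventually_at dist_norm using \<rho> by (intro exI[of _ \<rho>]) auto
  have "((\<lambda>y. h y z - h x z) \<longlongrightarrow> 0) (at x)"
  proof (rule Lim_null_comparison[OF _ lim])
    show "eventually (\<lambda>y. norm (h y z - h x z) \<le> C * norm (y - x)) (at x)"
      using near[of x] by (rule eventually_mono) (use est[of "_ - x" _ 0] in auto)
  qed
  then have "isCont (\<lambda>x. h x z) x" unfolding isCont_def by (rule LIM_zero_cancel)
  moreover have "((\<lambda>y. h x y - h x z) \<longlongrightarrow> 0) (at z)"
  proof (rule Lim_null_comparison[OF _ lim])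
    show "eventually (\<lambda>y. norm (h x y - h x z) \<le> C * norm (y - z)) (at z)"
      using near[of z] by (rule eventually_mono) (use est[of 0 _ "_ - z"] in auto)
  qed
  then have "isCont (\<lambda>z. h x z) z" unfolding isCont_def by (rule LIM_zero_cancel)
  moreover have "\<exists>F. (\<lambda>t. h (x + t *\<^sub>R v) (z + t *\<^sub>R w)) has_fps_expansion F" for v w
  proof -
    have "t * coords_of v w i = coords_of (t *\<^sub>R v) (t *\<^sub>R w) i" for t i by (simp add: coords_of_def split: sum.splits)
    then show ?thesis using analytic_fun_line[OF h, of "coords_of v w"] by (simp add: shift)
  qed
  from this[of _ 0] this[of 0 _]
  have "\<exists>F. (\<lambda>t. h (x + t *\<^sub>R v) z) has_fps_expansion F" "\<exists>F. (\<lambda>t. h x (z + t *\<^sub>R w)) has_fps_expansion F" for v w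
    by simp_all
  ultimately show "line_analytic_at (\<lambda>x. h x z) x" "line_analytic_at (\<lambda>z. h x z) z"
    unfolding line_analytic_at_def by blast+
qed

text \<open>Unless all coefficients vanish, the function is near 0 a power of \<open>t\<close> times
  a continuous function that is nonzero at 0.\<close>

lemma fps_expansion_dichotomy:
  fixes g :: "real \<Rightarrow> real"
  assumes "g has_fps_expansion F"
  shows "eventually (\<lambda>t. g t = 0) (nhds 0) \<or> eventually (\<lambda>t. g t \<noteq> 0) (at 0)"
proof (cases "F = 0")
  case True
  then show ?thesis using assms by (auto simp: has_fps_expansion_def elim: eventually_mono)
next
  case False
  define n where "n = subdegree F"
  define G where "G = fps_shift n F"
  have r: "fps_conv_radius F > 0" and ev: "eventually (\<lambda>t. eval_fps F t = g t) (nhds 0)"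
    using assms by (auto simp: has_fps_expansion_def)
  have rG: "fps_conv_radius G > 0" using r by (simp add: G_def)
  have "eval_fps G 0 \<noteq> 0" using False by (simp add: eval_fps_at_0 G_def n_def)
  moreover have "isCont (eval_fps G) 0" using rG by (intro continuous_eval_fps) (simp add: zero_ereal_def)
  ultimately have "eventually (\<lambda>t. eval_fps G t \<noteq> 0) (at 0)"
    unfolding isCont_def by (rule tendsto_imp_eventually_ne[rotated])
  moreover have "eventually (\<lambda>t. eval_fps F t = g t) (at 0)"
    using ev by (simp add: eventually_nhds_conv_at)
  moreover have "eventually (\<lambda>t::real. norm t < fps_conv_radius F) (at 0)"
  proof -
    obtain r' where r': "0 < ereal r'" "ereal r' < fps_conv_radius F"
      using r ereal_dense2 by blast
    then have "eventually (\<lambda>t. t \<in> {-r'<..<r'}) (at (0::real))"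
      by (intro eventually_at_in_open') auto
    then show ?thesis
      by (rule eventually_mono) (use r' in \<open>auto intro!: le_less_trans[OF _ r'(2)]\<close>)
  qed
  moreover have "eventually (\<lambda>t::real. t \<noteq> 0) (at 0)" by (rule eventually_neq_at_within)
  ultimately have "eventually (\<lambda>t. g t \<noteq> 0) (at 0)"
  proof eventually_elim
    case (elim t)
    then show ?case using eval_fps_shift[of n F t] by (auto simp: G_def n_def)
  qed
  then show ?thesis by blast
qed

lemma fps_expansion_dichotomy_at:
  fixes g :: "real \<Rightarrow> real"
  assumes "(\<lambda>s. g (t + s)) has_fps_expansion F"
  shows "eventually (\<lambda>s. g s = 0) (nhds t) \<or> eventually (\<lambda>s. g s \<noteq> 0) (at t)"
proof -
  have "nhds t = filtermap (\<lambda>s. t + s) (nhds 0)" "at t = filtermap (\<lambda>s. t + s) (at 0)"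
    using filtermap_nhds_shift[of "-t" 0] filtermap_at_shift[of "-t" 0] by (simp_all add: add.commute)
  then show ?thesis using fps_expansion_dichotomy[OF assms] by (simp add: eventually_filtermap)
qed

text \<open>The points near which \<open>g\<close> vanishes identically form an open set with open
  complement in \<open>J\<close>, hence the empty set. All zeros are therefore isolated.\<close>

lemma countable_zeros_on_line:
  fixes g :: "real \<Rightarrow> real"
  assumes J: "open J" "connected J" and g: "\<And>t. t \<in> J \<Longrightarrow> \<exists>F. (\<lambda>s. g (t + s)) has_fps_expansion F"
    and t0: "t0 \<in> J" "g t0 \<noteq> 0"
  shows "countable {t\<in>J. g t = 0}"
proof -
  define A where "A = {t\<in>J. eventually (\<lambda>s. g s = 0) (nhds t)}"
  have dich: "t \<in> A \<or> eventually (\<lambda>s. g s \<noteq> 0) (at t)" if "t \<in> J" for t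
    using g[OF that] fps_expansion_dichotomy_at that unfolding A_def by blast
  have "open A"
  proof (subst open_subopen, intro ballI)
    fix t assume t: "t \<in> A"
    then obtain S where S: "open S" "t \<in> S" "\<And>s. s \<in> S \<Longrightarrow> g s = 0"
      unfolding A_def eventually_nhds by blast
    then have "S \<inter> J \<subseteq> A" unfolding A_def eventually_nhds by blast
    then show "\<exists>T. open T \<and> t \<in> T \<and> T \<subseteq> A" using S t J(1) unfolding A_def by (intro exI[of _ "S \<inter> J"]) auto
  qed
  moreover have "open (J - A)"
  proof (subst open_subopen, intro ballI)
    fix t assume t: "t \<in> J - A"
    then obtain S where S: "open S" "t \<in> S" "\<And>s. s \<in> S \<Longrightarrow> s \<noteq> t \<Longrightarrow> g s \<noteq> 0"
      using dich[of t] unfolding eventually_at_topological by blast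
    have "s \<notin> A" if s: "s \<in> S" for s
    proof (cases "s = t")
      case False
      then have "g s \<noteq> 0" using S s by blast
      then show ?thesis unfolding A_def using eventually_nhds_x_imp_x by force
    qed (use t in auto)
    then show "\<exists>T. open T \<and> t \<in> T \<and> T \<subseteq> J - A" using S t J(1) by (intro exI[of _ "S \<inter> J"]) auto
  qed
  moreover have "J \<subseteq> A \<union> (J - A)" "A \<inter> (J - A) \<inter> J = {}" by auto
  ultimately have "A \<inter> J = {} \<or> (J - A) \<inter> J = {}" using connectedD[OF J(2)] by blast
  moreover have "t0 \<notin> A" unfolding A_def using t0(2) eventually_nhds_x_imp_x by force
  ultimately have "A = {}" using t0(1) unfolding A_def by blast
  then have sparse: "{t. g t = 0} sparse_in J"
    unfolding sparse_in_eventually_iff[OF J(1)] using dich by simp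
  have eq: "{t\<in>J. g t = 0} = J \<inter> {t. g t = 0}" by blast
  show ?thesis unfolding eq by (rule sparse_imp_countable[OF J(1) sparse])
qed

text \<open>Every ray through a non-zero of \<open>h\<close> meets the zero set in a countable set, so by Fubini in
  the scaling factor \<open>c\<close> almost every dilate of the zero set about that point is null.\<close>
lemma negligible_zeros_convex:
  fixes h :: "'a::euclidean_space \<Rightarrow> real"
  assumes S: "open S" "convex S" and h: "\<And>p. p \<in> S \<Longrightarrow> line_analytic_at h p" and q: "q \<in> S" "h q \<noteq> 0"
  shows "negligible {p\<in>S. h p = 0}"
proof -
  define Z where "Z = {p\<in>S. h p = 0}"
  have cont: "continuous_on S h"
    using h unfolding line_analytic_at_def by (simp add: continuous_at_imp_continuous_on)
  have "open (S \<inter> h -` (- {0}))"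
    by (rule continuous_open_preimage[OF cont S(1)]) auto
  moreover have "Z = S - (S \<inter> h -` (- {0}))" unfolding Z_def by auto
  ultimately have Z[measurable]: "Z \<in> sets borel" using S(1) by auto
  have line: "countable {c. q + c *\<^sub>R w \<in> Z}" for w
  proof -
    define J where "J = (\<lambda>c. q + c *\<^sub>R w) -` S"
    have "open J" unfolding J_def using S(1) by (intro open_vimage continuous_intros)
    moreover have "convex J"
      unfolding J_def
    proof (rule convexI)
      fix x y u v :: real assume *: "x \<in> (\<lambda>c. q + c *\<^sub>R w) -` S" "y \<in> (\<lambda>c. q + c *\<^sub>R w) -` S" "0 \<le> u" "0 \<le> v" "u + v = 1"
      have "u *\<^sub>R (q + x *\<^sub>R w) + v *\<^sub>R (q + y *\<^sub>R w) \<in> S"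
        using * by (intro convexD[OF S(2)]) auto
      also have "u *\<^sub>R (q + x *\<^sub>R w) + v *\<^sub>R (q + y *\<^sub>R w) = (u + v) *\<^sub>R q + (u *\<^sub>R x + v *\<^sub>R y) *\<^sub>R w"
        by (simp add: algebra_simps)
      finally show "u *\<^sub>R x + v *\<^sub>R y \<in> (\<lambda>c. q + c *\<^sub>R w) -` S" using *(5) by simp
    qed
    moreover have "\<exists>F. (\<lambda>s. h (q + (t + s) *\<^sub>R w)) has_fps_expansion F" if "t \<in> J" for t
    proof -
      have "line_analytic_at h (q + t *\<^sub>R w)" using that h by (simp add: J_def)
      then have "\<exists>F. (\<lambda>s. h (q + t *\<^sub>R w + s *\<^sub>R w)) has_fps_expansion F"
        unfolding line_analytic_at_def by blast
      then show ?thesis by (simp add: scaleR_add_left add.assoc)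
    qed
    moreover have "0 \<in> J" "h (q + 0 *\<^sub>R w) \<noteq> 0" using q by (auto simp: J_def)
    ultimately have "countable {t\<in>J. h (q + t *\<^sub>R w) = 0}"
      by (intro countable_zeros_on_line convex_connected)
    then show ?thesis by (simp add: J_def Z_def)
  qed
  \<comment> \<open>The interval from 1 to 2 has positive measure and avoids 0: some factor
    \<open>c\<close> in it is good for almost every \<open>w\<close>, and the dilation by that
    \<open>c\<close> is invertible.\<close>
  define P where "P = (\<lambda>(c::real) w. \<not> (c \<in> {1..2} \<and> q + c *\<^sub>R w \<in> Z))"
  have "AE c in lborel. AE w in lborel. P c w"
  proof (subst lborel_pair.AE_commute)
    have "(\<lambda>x::real \<times> 'a. q + fst x *\<^sub>R snd x) \<in> borel_measurable borel"
      by (intro borel_measurable_continuous_onI continuous_intros)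
    then have [measurable]: "(\<lambda>x::real \<times> 'a. q + fst x *\<^sub>R snd x) \<in> borel_measurable (lborel \<Otimes>\<^sub>M lborel)"
      by (simp add: lborel_prod)
    show "{x \<in> space (lborel \<Otimes>\<^sub>M lborel). P (fst x) (snd x)} \<in> sets (lborel \<Otimes>\<^sub>M lborel)"
      unfolding P_def by measurable
    have "AE c in lborel. P c w" for w
    proof (rule AE_I'[OF countable_imp_null_set_lborel[OF line[of w]]])
      show "{c \<in> space lborel. \<not> P c w} \<subseteq> {c. q + c *\<^sub>R w \<in> Z}" by (auto simp: P_def)
    qed
    then show "AE w in lborel. AE c in lborel. P c w" by simp
  qed
  have "\<exists>c\<in>{1..2::real}. AE w in lborel. P c w"
  proof (rule ccontr)
    assume "\<not> ?thesis"
    with \<open>AE c in lborel. AE w in lborel. P c w\<close> have "AE c in lborel. (c::real) \<notin> {1..2}"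
      by (auto elim!: eventually_mono)
    then have "{1..2::real} \<in> null_sets lborel" by (subst (asm) AE_iff_null_sets[symmetric]) auto
    then show False by (auto simp: null_sets_def)
  qed
  then obtain c where c: "c \<in> {1..2::real}" "AE w in lborel. q + c *\<^sub>R w \<notin> Z"
    by (auto simp: P_def)
  define Zc where "Zc = {w. q + c *\<^sub>R w \<in> Z}"
  have "(\<lambda>w. q + c *\<^sub>R w) \<in> borel_measurable borel"
    by (intro borel_measurable_continuous_onI continuous_intros)
  then have "Zc \<in> sets lborel" unfolding Zc_def using measurable_sets[OF _ Z] by (auto simp: vimage_def)
  moreover have "AE w in lborel. w \<notin> Zc" using c(2) by (simp add: Zc_def)
  ultimately have "Zc \<in> null_sets lborel" by (subst (asm) AE_iff_null_sets[symmetric]) auto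
  then have neg: "negligible Zc" unfolding negligible_iff_null_sets by (rule null_sets_completionI)
  have "Z = (\<lambda>w. q + c *\<^sub>R w) ` Zc"
  proof (intro set_eqI iffI)
    fix p assume "p \<in> Z"
    then have "(1 / c) *\<^sub>R (p - q) \<in> Zc" "p = q + c *\<^sub>R ((1 / c) *\<^sub>R (p - q))" using c(1) by (auto simp: Zc_def)
    then show "p \<in> (\<lambda>w. q + c *\<^sub>R w) ` Zc" by blast
  qed (auto simp: Zc_def)
  moreover have "negligible ((\<lambda>w. q + c *\<^sub>R w) ` Zc)"
    by (rule negligible_differentiable_image_negligible[OF order_refl neg])
      (auto intro!: derivative_intros)
  ultimately show ?thesis unfolding Z_def by simp
qed

text \<open>In several variables zeros are not isolated; instead, a ball about a point outside
  \<open>A\<close> has a null zero set by the convex case, so it cannot contain a nonempty open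
  piece of \<open>A\<close>. Thus \<open>A\<close> is open with open complement in \<open>D\<close>,
  hence empty, and the zero set is locally null.\<close>

lemma AE_nonzero_of_line_analytic:
  fixes h :: "'a::euclidean_space \<Rightarrow> real"
  assumes D: "open D" "connected D" and h: "\<And>p. p \<in> D \<Longrightarrow> line_analytic_at h p" and p0: "p0 \<in> D" "h p0 \<noteq> 0"
  shows "AE p in lborel. p \<in> D \<longrightarrow> h p \<noteq> 0"
proof -
  define A where "A = {p\<in>D. eventually (\<lambda>s. h s = 0) (nhds p)}"
  have ball_neg: "negligible {s\<in>ball p r. h s = 0}" if "ball p r \<subseteq> D" "p \<notin> A" "r > 0" "p \<in> D" for p r
  proof -
    have "\<exists>q\<in>ball p r. h q \<noteq> 0"
    proof (rule ccontr)
      assume "\<not> ?thesis"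
      then have "eventually (\<lambda>s. h s = 0) (nhds p)"
        unfolding eventually_nhds using that by (intro exI[of _ "ball p r"]) auto
      then show False using that unfolding A_def by blast
    qed
    then obtain q where q: "q \<in> ball p r" "h q \<noteq> 0" by blast
    show ?thesis
    proof (rule negligible_zeros_convex[where S="ball p r" and q=q])
      show "line_analytic_at h s" if "s \<in> ball p r" for s using h that \<open>ball p r \<subseteq> D\<close> by blast
    qed (use q in auto)
  qed
  have "open A"
  proof (subst open_subopen, intro ballI)
    fix t assume t: "t \<in> A"
    then obtain S where S: "open S" "t \<in> S" "\<And>s. s \<in> S \<Longrightarrow> h s = 0"
      unfolding A_def eventually_nhds by blast
    then have "S \<inter> D \<subseteq> A" unfolding A_def eventually_nhds by blast
    then show "\<exists>T. open T \<and> t \<in> T \<and> T \<subseteq> A" using S t D(1) unfolding A_def by (intro exI[of _ "S \<inter> D"]) auto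
  qed
  moreover have "open (D - A)"
  proof (subst open_subopen, intro ballI)
    fix p assume p: "p \<in> D - A"
    then obtain r where r: "r > 0" "ball p r \<subseteq> D" using D(1) open_contains_ball by blast
    have neg: "negligible {s\<in>ball p r. h s = 0}" using ball_neg p r by blast
    have "A \<inter> ball p r \<subseteq> {s\<in>ball p r. h s = 0}"
      unfolding A_def using eventually_nhds_x_imp_x by force
    then have "negligible (A \<inter> ball p r)" using neg negligible_subset by blast
    then have "A \<inter> ball p r = {}"
      using open_not_negligible[OF open_Int[OF \<open>open A\<close> open_ball]] by blast
    then show "\<exists>T. open T \<and> p \<in> T \<and> T \<subseteq> D - A" using r by (intro exI[of _ "ball p r"]) auto
  qed
  moreover have "D \<subseteq> A \<union> (D - A)" "A \<inter> (D - A) \<inter> D = {}" by auto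
  ultimately have "A \<inter> D = {} \<or> (D - A) \<inter> D = {}" using connectedD[OF D(2)] by blast
  moreover have "p0 \<notin> A" unfolding A_def using p0(2) eventually_nhds_x_imp_x by force
  ultimately have A: "A = {}" using p0(1) unfolding A_def by blast
  have "negligible {p\<in>D. h p = 0}"
  proof (subst locally_negligible_alt, intro ballI)
    fix p assume p: "p \<in> {p\<in>D. h p = 0}"
    then obtain r where r: "r > 0" "ball p r \<subseteq> D" using D(1) open_contains_ball by blast
    have "negligible {s\<in>ball p r. h s = 0}" using ball_neg p r A by blast
    moreover have "{p\<in>D. h p = 0} \<inter> ball p r \<subseteq> {s\<in>ball p r. h s = 0}" by auto
    ultimately have "negligible ({p\<in>D. h p = 0} \<inter> ball p r)" using negligible_subset by blast
    then show "\<exists>U. openin (top_of_set {p\<in>D. h p = 0}) U \<and> p \<in> U \<and> negligible U"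
      using p r by (intro exI[of _ "{p\<in>D. h p = 0} \<inter> ball p r"]) (auto simp: openin_open)
  qed
  then have "AE p in lebesgue. p \<notin> {p\<in>D. h p = 0}"
    unfolding negligible_iff_null_sets by (rule AE_not_in)
  then show ?thesis unfolding AE_completion_iff by (auto elim: eventually_mono)
qed

section \<open>Elimination and product measures\<close>

text \<open>Fraction-free Gaussian elimination: the Schur complement of the identity matrix is again the
  identity, so the product \<open>d\<close> of the pivots does not vanish at \<open>p0\<close>, and it lies in every
  class of functions closed under products and differences.\<close>
lemma left_inverse_near_identity:
  fixes A :: "'p \<Rightarrow> 'i \<Rightarrow> 'i \<Rightarrow> real"
  assumes "finite I" and const: "P (\<lambda>_. 1)"
    and mult: "\<And>f g. P f \<Longrightarrow> P g \<Longrightarrow> P (\<lambda>p. f p * g p)"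
    and diff: "\<And>f g. P f \<Longrightarrow> P g \<Longrightarrow> P (\<lambda>p. f p - g p)"
    and "\<And>a b. a \<in> I \<Longrightarrow> b \<in> I \<Longrightarrow> P (\<lambda>p. A p a b)"
    and "\<And>a b. a \<in> I \<Longrightarrow> b \<in> I \<Longrightarrow> A p0 a b = (if a = b then 1 else 0)"
  shows "\<exists>d. P d \<and> d p0 \<noteq> 0 \<and> (\<forall>p. d p \<noteq> 0 \<longrightarrow>
    (\<exists>B. \<forall>a\<in>I. \<forall>b\<in>I. (\<Sum>e\<in>I. B a e * A p e b) = (if a = b then 1 else 0)))"
  using assms(1,5,6)
proof (induction I arbitrary: A rule: finite_induct)
  case empty
  then show ?case using const by (intro exI[of _ "\<lambda>_. 1"]) auto
next
  case (insert c I)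
  define A' where "A' = (\<lambda>p a b. A p c c * A p a b - A p a c * A p c b)"
  have "\<exists>d. P d \<and> d p0 \<noteq> 0 \<and> (\<forall>p. d p \<noteq> 0 \<longrightarrow>
    (\<exists>B. \<forall>a\<in>I. \<forall>b\<in>I. (\<Sum>e\<in>I. B a e * A' p e b) = (if a = b then 1 else 0)))"
  proof (rule insert.IH)
    show "P (\<lambda>p. A' p a b)" if "a \<in> I" "b \<in> I" for a b
      unfolding A'_def using that by (intro diff mult insert.prems(1)) auto
    show "A' p0 a b = (if a = b then 1 else 0)" if "a \<in> I" "b \<in> I" for a b
    proof -
      have "a \<noteq> c" "b \<noteq> c" using that insert.hyps by auto
      then show ?thesis using that insert.prems(2) by (simp add: A'_def)
    qed
  qed
  then obtain d where d: "P d" "d p0 \<noteq> 0" "\<And>p. d p \<noteq> 0 \<Longrightarrow>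
    (\<exists>B. \<forall>a\<in>I. \<forall>b\<in>I. (\<Sum>e\<in>I. B a e * A' p e b) = (if a = b then 1 else 0))" by blast
  show ?case
  proof (intro exI[of _ "\<lambda>p. A p c c * d p"] conjI allI impI)
    show "P (\<lambda>p. A p c c * d p)" by (intro mult insert.prems(1) d) auto
    show "A p0 c c * d p0 \<noteq> 0" using d(2) insert.prems(2)[of c c] by simp
    fix p assume p: "A p c c * d p \<noteq> 0"
    define \<kappa> where "\<kappa> = A p c c"
    have \<kappa>: "\<kappa> \<noteq> 0" using p by (simp add: \<kappa>_def)
    obtain B' where B': "\<And>a b. a \<in> I \<Longrightarrow> b \<in> I \<Longrightarrow> (\<Sum>e\<in>I. B' a e * A' p e b) = (if a = b then 1 else 0)"
      using d(3)[of p] p by auto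
    \<comment> \<open>A row of the left inverse of the Schur complement, extended by the entry at
      \<open>c\<close> that makes it annihilate column \<open>c\<close> of the full matrix.\<close>
    define E where "E = (\<lambda>a e. if e = c then - (\<Sum>e\<in>I. B' a e * A p e c) else B' a e * \<kappa>)"
    \<comment> \<open>The row for \<open>c\<close> is unit row \<open>c\<close> cleared by the rows
      already found and divided by the pivot.\<close>
    define B where "B = (\<lambda>a e. if a = c then ((if e = c then 1 else 0) - (\<Sum>a\<in>I. A p c a * E a e)) / \<kappa> else E a e)"
    have E_row: "(\<Sum>e\<in>insert c I. E a e * A p e b) = (\<Sum>e\<in>I. B' a e * A' p e b)" for a b
    proof -
      have "(\<Sum>e\<in>insert c I. E a e * A p e b) =
          - (\<Sum>e\<in>I. B' a e * A p e c) * A p c b + (\<Sum>e\<in>I. E a e * A p e b)"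
        using insert.hyps by (simp add: E_def)
      also have "(\<Sum>e\<in>I. E a e * A p e b) = (\<Sum>e\<in>I. B' a e * \<kappa> * A p e b)"
        using insert.hyps by (intro sum.cong) (auto simp: E_def)
      also have "- (\<Sum>e\<in>I. B' a e * A p e c) * A p c b + (\<Sum>e\<in>I. B' a e * \<kappa> * A p e b)
          = (\<Sum>e\<in>I. B' a e * A' p e b)"
        by (simp add: A'_def \<kappa>_def sum_distrib_left sum_distrib_right sum_subtractf algebra_simps)
      finally show ?thesis .
    qed
    have E: "(\<Sum>e\<in>insert c I. E a e * A p e b) = (if a = b then 1 else 0)" if a: "a \<in> I" and b: "b \<in> insert c I" for a b
    proof (cases "b = c")
      case True
      have "A' p e c = 0" for e by (simp add: A'_def)
      then show ?thesis unfolding E_row True using a insert.hyps by auto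
    next
      case False
      then show ?thesis unfolding E_row using B' a b by auto
    qed
    show "\<exists>B. \<forall>a\<in>insert c I. \<forall>b\<in>insert c I. (\<Sum>e\<in>insert c I. B a e * A p e b) = (if a = b then 1 else 0)"
    proof (intro exI[of _ B] ballI)
      fix a b assume a: "a \<in> insert c I" and b: "b \<in> insert c I"
      show "(\<Sum>e\<in>insert c I. B a e * A p e b) = (if a = b then 1 else 0)"
      proof (cases "a = c")
        case True
        have "B a e * A p e b = ((if e = c then 1 else 0) * A p e b - (\<Sum>a\<in>I. A p c a * E a e * A p e b)) / \<kappa>" for e
          unfolding B_def True by (simp add: left_diff_distrib sum_distrib_right)
        then have "(\<Sum>e\<in>insert c I. B a e * A p e b) =
            ((\<Sum>e\<in>insert c I. (if e = c then 1 else 0) * A p e b)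
              - (\<Sum>e\<in>insert c I. \<Sum>a\<in>I. A p c a * E a e * A p e b)) / \<kappa>"
          by (simp only: sum_subtractf sum_divide_distrib[symmetric])
        also have "(\<Sum>e\<in>insert c I. (if e = c then 1 else 0) * A p e b) = A p c b"
          using insert.hyps by (simp add: if_distrib[of "\<lambda>x. x * _"] cong: if_cong)
        also have "(\<Sum>e\<in>insert c I. \<Sum>a\<in>I. A p c a * E a e * A p e b) =
            (\<Sum>a\<in>I. A p c a * (\<Sum>e\<in>insert c I. E a e * A p e b))"
          by (subst sum.swap) (simp only: sum_distrib_left mult.assoc)
        also have "\<dots> = (\<Sum>a\<in>I. if a = b then A p c a else 0)"
          using E b by (intro sum.cong) auto
        also have "\<dots> = (if b \<in> I then A p c b else 0)"
          using insert.hyps by simp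
        finally show ?thesis using True b insert.hyps \<kappa> by (auto simp: \<kappa>_def)
      next
        case False
        then have "(\<Sum>e\<in>insert c I. B a e * A p e b) = (\<Sum>e\<in>insert c I. E a e * A p e b)"
          by (simp add: B_def)
        then show ?thesis using E a b False by auto
      qed
    qed
  qed
qed

text \<open>The reference configuration is replaced by the variable one coordinate at a time. For
  almost every choice of the first \<open>n\<close> points the mixed configuration is nonzero, so
  \<open>step\<close> permits almost every choice of the next one.\<close>

lemma AE_PiM_by_coordinates:
  fixes D :: "(nat \<Rightarrow> 'a::euclidean_space) \<Rightarrow> real"
  assumes D[measurable]: "D \<in> borel_measurable (Pi\<^sub>M {..<N} (\<lambda>_. lborel))" and S[measurable]: "S \<in> sets borel"
    and x0: "x0 \<in> Pi\<^sub>E {..<N} (\<lambda>_. S)" "D x0 \<noteq> 0"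
    and step: "\<And>x k. x \<in> Pi\<^sub>E {..<N} (\<lambda>_. S) \<Longrightarrow> k < N \<Longrightarrow> D x \<noteq> 0 \<Longrightarrow>
      AE y in lborel. y \<in> S \<longrightarrow> D (x(k := y)) \<noteq> 0"
  shows "AE x in Pi\<^sub>M {..<N} (\<lambda>_. lborel). (\<forall>k<N. x k \<in> S) \<longrightarrow> D x \<noteq> 0"
proof -
  interpret product_sigma_finite "\<lambda>_::nat. lborel :: 'a measure" by standard
  \<comment> \<open>The first \<open>n\<close> points come from \<open>x\<close> and the remaining
    ones still from \<open>x0\<close>.\<close>
  define m where "m = (\<lambda>n x k. if k < n then x k else x0 k)"
  have m[measurable]: "m n \<in> measurable (Pi\<^sub>M {..<n} (\<lambda>_. lborel)) (Pi\<^sub>M {..<N} (\<lambda>_. lborel))" if "n \<le> N" for n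
  proof (rule measurable_PiM_single')
    show "(\<lambda>x. m n x k) \<in> measurable (Pi\<^sub>M {..<n} (\<lambda>_. lborel)) lborel" if "k \<in> {..<N}" for k
      using that measurable_component_singleton[of k "{..<n}" "\<lambda>_. lborel :: 'a measure"]
      by (cases "k < n") (simp_all add: m_def)
    show "m n \<in> space (Pi\<^sub>M {..<n} (\<lambda>_. lborel)) \<rightarrow> Pi\<^sub>E {..<N} (\<lambda>_. space lborel)"
      using x0(1) \<open>n \<le> N\<close> by (auto simp: m_def PiE_def extensional_def space_PiM)
  qed
  have "n \<le> N \<Longrightarrow> AE x in Pi\<^sub>M {..<n} (\<lambda>_. lborel). (\<forall>k<n. x k \<in> S) \<longrightarrow> D (m n x) \<noteq> 0" for n
  proof (induction n)
    case 0
    have "m 0 x = x0" for x by (simp add: m_def)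
    then show ?case using x0(2) by simp
  next
    case (Suc n)
    then have n: "n < N" "n \<le> N" "Suc n \<le> N" by auto
    note [measurable] = m[OF n(3)] m[OF n(2)]
    define bad where "bad = {x \<in> space (Pi\<^sub>M {..<Suc n} (\<lambda>_. lborel :: 'a measure)). (\<forall>k<Suc n. x k \<in> S) \<and> D (m (Suc n) x) = 0}"
    have bad[measurable]: "bad \<in> sets (Pi\<^sub>M {..<Suc n} (\<lambda>_. lborel))"
    proof -
      have "{x \<in> space (Pi\<^sub>M {..<Suc n} (\<lambda>_. lborel :: 'a measure)). x k \<in> S} \<in> sets (Pi\<^sub>M {..<Suc n} (\<lambda>_. lborel))" if "k < Suc n" for k
        by (rule measurable_sets_Collect[OF measurable_component_singleton]) (use that in auto)
      then have all: "{x \<in> space (Pi\<^sub>M {..<Suc n} (\<lambda>_. lborel :: 'a measure)). \<forall>k\<in>{..<Suc n}. x k \<in> S} \<in> sets (Pi\<^sub>M {..<Suc n} (\<lambda>_. lborel))"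
        by (intro sets.sets_Collect_finite_All') auto
      have zero: "{x \<in> space (Pi\<^sub>M {..<Suc n} (\<lambda>_. lborel :: 'a measure)). D (m (Suc n) x) = 0} \<in> sets (Pi\<^sub>M {..<Suc n} (\<lambda>_. lborel))"
        by measurable
      have "bad = {x \<in> space (Pi\<^sub>M {..<Suc n} (\<lambda>_. lborel)). \<forall>k\<in>{..<Suc n}. x k \<in> S} \<inter>
          {x \<in> space (Pi\<^sub>M {..<Suc n} (\<lambda>_. lborel)). D (m (Suc n) x) = 0}"
        unfolding bad_def by blast
      then show ?thesis using sets.Int[OF all zero] by (simp only:)
    qed
    have eq: "{..<Suc n} = insert n {..<n}" by auto
    have "emeasure (Pi\<^sub>M {..<Suc n} (\<lambda>_. lborel)) bad = (\<integral>\<^sup>+x. indicator bad x \<partial>Pi\<^sub>M {..<Suc n} (\<lambda>_. lborel))"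
      by (rule nn_integral_indicator[symmetric, OF bad])
    \<comment> \<open>Fubini with the newest coordinate innermost: for almost every outer
      \<open>x\<close> the inner integral vanishes by the induction hypothesis and
      \<open>step\<close>.\<close>
    also have "\<dots> = (\<integral>\<^sup>+x. (\<integral>\<^sup>+y. indicator bad (x(n := y)) \<partial>lborel) \<partial>Pi\<^sub>M {..<n} (\<lambda>_. lborel))"
      unfolding eq by (rule product_nn_integral_insert) (use bad eq in auto)
    also have "\<dots> = (\<integral>\<^sup>+x. 0 \<partial>Pi\<^sub>M {..<n} (\<lambda>_. lborel :: 'a measure))"
    proof (rule nn_integral_cong_AE)
      have "AE x in Pi\<^sub>M {..<n} (\<lambda>_. lborel). (\<forall>k<n. x k \<in> S) \<longrightarrow> D (m n x) \<noteq> 0"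
        using Suc.IH n by simp
      then show "AE x in Pi\<^sub>M {..<n} (\<lambda>_. lborel). (\<integral>\<^sup>+y. indicator bad (x(n := y)) \<partial>lborel) = 0"
      proof (rule AE_mp, intro AE_I2 impI)
        fix x assume x: "x \<in> space (Pi\<^sub>M {..<n} (\<lambda>_. lborel :: 'a measure))"
          and *: "(\<forall>k<n. x k \<in> S) \<longrightarrow> D (m n x) \<noteq> 0"
        have "AE y in lborel. (indicator bad (x(n := y)) :: ennreal) = 0"
        proof (cases "\<forall>k<n. x k \<in> S")
          case True
          have "m n x \<in> Pi\<^sub>E {..<N} (\<lambda>_. S)"
            using True x0(1) n by (auto simp: m_def PiE_def extensional_def)
          from step[OF this n(1)] * True
          have "AE y in lborel. y \<in> S \<longrightarrow> D ((m n x)(n := y)) \<noteq> 0" by blast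
          moreover have "(m n x)(n := y) = m (Suc n) (x(n := y))" for y
            by (auto simp: m_def fun_eq_iff)
          ultimately show ?thesis
            by (auto elim!: eventually_mono simp: bad_def split: split_indicator)
        next
          case False
          then have "x(n := y) \<notin> bad" for y by (auto simp: bad_def)
          then show ?thesis by simp
        qed
        then show "(\<integral>\<^sup>+y. indicator bad (x(n := y)) \<partial>lborel) = 0"
          using nn_integral_cong_AE[of "\<lambda>y. indicator bad (x(n := y))" "\<lambda>_. 0" lborel] by simp
      qed
    qed
    finally have "bad \<in> null_sets (Pi\<^sub>M {..<Suc n} (\<lambda>_. lborel))" using bad by (simp add: null_sets_def)
    then show ?case
      by (rule AE_I') (auto simp: bad_def)
  qed
  from this[OF order_refl] have "AE x in Pi\<^sub>M {..<N} (\<lambda>_. lborel). (\<forall>k<N. x k \<in> S) \<longrightarrow> D (m N x) \<noteq> 0" .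
  moreover have "AE x in Pi\<^sub>M {..<N} (\<lambda>_. lborel :: 'a measure). m N x = x"
    using x0(1) by (intro AE_I2) (auto simp: m_def space_PiM PiE_def extensional_def fun_eq_iff)
  ultimately show ?thesis by eventually_elim auto
qed

section \<open>Interpolation by Lie polynomials\<close>

lemma analytic_fun_on_coords_partial:
  fixes G :: "real^'l \<Rightarrow> real^'m \<Rightarrow> real^'m"
  assumes G: "\<And>z. smooth (G z)" and an: "analytic_fun (on_coords (\<lambda>x z. G z x $ j)) (coords_of x z)"
  shows "analytic_fun (on_coords (\<lambda>x z. frechet_derivative (G z) (at x) (axis i 1) $ j)) (coords_of x z)"
\<comment> \<open>Any radius would do: \<open>G\<close> is smooth on the whole space for every
  parameter, so the derivative identity holds for all \<open>u\<close>.\<close>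
proof (rule analytic_fun_partial[OF an zero_less_one, of "Inl i"])
  fix u :: "'m + 'l \<Rightarrow> real"
  define y where "y = (\<chi> i. coords_of x z (Inl i) + u (Inl i))"
  define w where "w = (\<chi> j. coords_of x z (Inr j) + u (Inr j))"
  have "((\<lambda>s. y + (s - u (Inl i)) *\<^sub>R axis i 1) has_derivative (\<lambda>s. s *\<^sub>R axis i 1)) (at (u (Inl i)))"
    by (auto intro!: derivative_eq_intros)
  moreover have "(G w has_derivative frechet_derivative (G w) (at y)) (at (y + (u (Inl i) - u (Inl i)) *\<^sub>R axis i 1))"
    using smooth_has_derivative[OF G] by simp
  ultimately have "((\<lambda>s. G w (y + (s - u (Inl i)) *\<^sub>R axis i 1)) has_derivative
      (\<lambda>s. frechet_derivative (G w) (at y) (s *\<^sub>R axis i 1))) (at (u (Inl i)))"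
    using diff_chain_at by (fastforce simp: o_def)
  then have "((\<lambda>s. G w (y + (s - u (Inl i)) *\<^sub>R axis i 1) $ j) has_derivative
      (\<lambda>s. frechet_derivative (G w) (at y) (s *\<^sub>R axis i 1) $ j)) (at (u (Inl i)))"
    by (rule bounded_linear.has_derivative[OF bounded_linear_vec_nth])
  then have "((\<lambda>s. G w (y + (s - u (Inl i)) *\<^sub>R axis i 1) $ j) has_real_derivative
      frechet_derivative (G w) (at y) (axis i 1) $ j) (at (u (Inl i)))"
    unfolding has_field_derivative_def
    by (rule has_derivative_eq_rhs) (simp add: linear_scale[OF smooth_linear_derivative[OF G]] fun_eq_iff)
  moreover have "y + (s - u (Inl i)) *\<^sub>R axis i 1 = (\<chi> i'. coords_of x z (Inl i') + (u(Inl i := s)) (Inl i'))" for s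
    by (auto simp: y_def vec_eq_iff axis_def)
  moreover have "w = (\<chi> j. coords_of x z (Inr j) + (u(Inl i := s)) (Inr j))" for s
    by (simp add: w_def)
  ultimately show "((\<lambda>s. on_coords (\<lambda>x z. G z x $ j) (\<lambda>k. coords_of x z k + (u(Inl i := s)) k)) has_real_derivative
      on_coords (\<lambda>x z. frechet_derivative (G z) (at x) (axis i 1) $ j) (\<lambda>k. coords_of x z k + u k)) (at (u (Inl i)))"
    unfolding on_coords_def by (simp add: y_def w_def del: fun_upd_apply)
qed

text \<open>The bracket expression that produces \<open>L\<close> at \<open>zh\<close> is formed at
  every parameter. Analyticity is tracked jointly in \<open>x\<close> and \<open>z\<close>, because
  brackets differentiate in \<open>x\<close> whereas the family is later varied in
  \<open>z\<close>.\<close>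

lemma lie_algebra_family:
  fixes V :: "'d \<Rightarrow> real^'m \<Rightarrow> real^'l \<Rightarrow> real^'m"
  assumes V: "\<And>i z. smooth (\<lambda>x. V i x z)"
    and an: "\<And>i j x z. x \<in> \<Omega> \<Longrightarrow> analytic_fun (on_coords (\<lambda>x z. V i x z $ j)) (coords_of x z)"
    and L: "L \<in> lie_algebra_gen (\<lambda>i x. V i x zh)"
  shows "\<exists>H. H zh = L \<and> (\<forall>z. H z \<in> lie_algebra_gen (\<lambda>i x. V i x z)) \<and>
    (\<forall>x\<in>\<Omega>. \<forall>z j. analytic_fun (on_coords (\<lambda>x z. H z x $ j)) (coords_of x z))"
  using L
proof (induction rule: lie_algebra_gen.induct)
  case (gen i)
  show ?case
    by (rule exI[of _ "\<lambda>z x. V i x z"]) (use an lie_algebra_gen.gen[of "\<lambda>i x. V i x _"] in auto)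
next
  case (add U W)
  then obtain F G where "F zh = U" "\<And>z. F z \<in> lie_algebra_gen (\<lambda>i x. V i x z)"
      "\<And>x z j. x \<in> \<Omega> \<Longrightarrow> analytic_fun (on_coords (\<lambda>x z. F z x $ j)) (coords_of x z)"
    and "G zh = W" "\<And>z. G z \<in> lie_algebra_gen (\<lambda>i x. V i x z)"
      "\<And>x z j. x \<in> \<Omega> \<Longrightarrow> analytic_fun (on_coords (\<lambda>x z. G z x $ j)) (coords_of x z)" by metis
  then show ?case
    by (intro exI[of _ "\<lambda>z x. F z x + G z x"])
      (auto intro: lie_algebra_gen.add analytic_fun_add simp: on_coords_def[abs_def])
next
  case (scale U c)
  then obtain F where "F zh = U" "\<And>z. F z \<in> lie_algebra_gen (\<lambda>i x. V i x z)"
      "\<And>x z j. x \<in> \<Omega> \<Longrightarrow> analytic_fun (on_coords (\<lambda>x z. F z x $ j)) (coords_of x z)" by metis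
  then show ?case
    by (intro exI[of _ "\<lambda>z x. c *\<^sub>R F z x"])
      (auto intro: lie_algebra_gen.scale analytic_fun_mult analytic_fun_const simp: on_coords_def[abs_def])
next
  case (bracket U W)
  then obtain F G where F: "F zh = U" "\<And>z. F z \<in> lie_algebra_gen (\<lambda>i x. V i x z)"
      "\<And>x z j. x \<in> \<Omega> \<Longrightarrow> analytic_fun (on_coords (\<lambda>x z. F z x $ j)) (coords_of x z)"
    and G: "G zh = W" "\<And>z. G z \<in> lie_algebra_gen (\<lambda>i x. V i x z)"
      "\<And>x z j. x \<in> \<Omega> \<Longrightarrow> analytic_fun (on_coords (\<lambda>x z. G z x $ j)) (coords_of x z)" by metis
  have sm: "smooth (F z)" "smooth (G z)" for z
    using lie_algebra_smooth[of "\<lambda>i x. V i x z" UNIV] V F(2) G(2) by auto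
  have along: "analytic_fun (on_coords (\<lambda>x z. frechet_derivative (G z) (at x) (F z x) $ j)) (coords_of x z)"
    if x: "x \<in> \<Omega>" and sm: "\<And>z. smooth (G z)"
      and F: "\<And>j. analytic_fun (on_coords (\<lambda>x z. F z x $ j)) (coords_of x z)"
      and G: "\<And>j. analytic_fun (on_coords (\<lambda>x z. G z x $ j)) (coords_of x z)"
    for F G :: "real^'l \<Rightarrow> real^'m \<Rightarrow> real^'m" and x z j
  proof -
    have "frechet_derivative (G z) (at x) (F z x) $ j
        = (\<Sum>i\<in>UNIV. F z x $ i * frechet_derivative (G z) (at x) (axis i 1) $ j)" for x z
      by (subst linear_axis_expansion[OF smooth_linear_derivative[OF sm]]) simp
    then have "on_coords (\<lambda>x z. frechet_derivative (G z) (at x) (F z x) $ j) = (\<lambda>w. \<Sum>i\<in>UNIV.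
        on_coords (\<lambda>x z. F z x $ i) w * on_coords (\<lambda>x z. frechet_derivative (G z) (at x) (axis i 1) $ j) w)"
      by (simp add: on_coords_def[abs_def])
    then show ?thesis
      by (simp add: analytic_fun_sum analytic_fun_mult F analytic_fun_on_coords_partial[OF sm G])
  qed
  have "analytic_fun (on_coords (\<lambda>x z. lie_bracket (F z) (G z) x $ j)) (coords_of x z)" if x: "x \<in> \<Omega>" for x z j
  proof -
    have "analytic_fun (\<lambda>w. on_coords (\<lambda>x z. frechet_derivative (G z) (at x) (F z x) $ j) w -
        on_coords (\<lambda>x z. frechet_derivative (F z) (at x) (G z x) $ j) w) (coords_of x z)"
      by (intro analytic_fun_diff along[OF x] sm F G x)
    then show ?thesis by (simp add: on_coords_def[abs_def] lie_bracket_def)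
  qed
  then show ?case
    using F G by (intro exI[of _ "\<lambda>z. lie_bracket (F z) (G z)"]) (auto intro: lie_algebra_gen.bracket)
qed

lemma polynomial_function_m_poly: "polynomial_function_m (\<lambda>x::real^'m. poly p (x $ i0))"
proof -
  \<comment> \<open>The exponent of the pure power of coordinate \<open>i0\<close>; \<open>c\<close>
    is zero at every exponent not of this form, so its support is a copy of that of the coefficients
    of \<open>p\<close>.\<close>
  define e where "e = (\<lambda>n i. if i = i0 then n else (0::nat))"
  define c where "c = (\<lambda>a. if a = e (a i0) then coeff p (a i0) else 0)"
  have inj: "inj_on e S" for S by (rule inj_onI) (metis e_def)
  have supp: "{a. c a \<noteq> 0} = e ` {n. coeff p n \<noteq> 0}"
    by (auto simp: c_def e_def split: if_splits)
  have fin: "finite {n. coeff p n \<noteq> 0}"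
    by (rule finite_subset[of _ "{..degree p}"]) (auto intro: le_degree)
  have "poly p (x $ i0) = (\<Sum>a\<in>{a. c a \<noteq> 0}. c a * (\<Prod>i\<in>UNIV. (x $ i) ^ a i))" for x :: "real^'m"
  proof -
    have prod: "(\<Prod>i\<in>UNIV. (x $ i) ^ e n i) = (x $ i0) ^ n" for n
    proof -
      have "(\<Prod>i\<in>UNIV. (x $ i) ^ e n i) = (\<Prod>i\<in>UNIV. if i = i0 then (x $ i0) ^ n else 1)"
        by (intro prod.cong) (auto simp: e_def)
      then show ?thesis by simp
    qed
    have "poly p (x $ i0) = (\<Sum>n\<le>degree p. coeff p n * (x $ i0) ^ n)" by (rule poly_altdef)
    also have "\<dots> = (\<Sum>n | coeff p n \<noteq> 0. coeff p n * (x $ i0) ^ n)"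
      by (rule sum.mono_neutral_right) (auto intro: le_degree)
    also have "\<dots> = (\<Sum>n | coeff p n \<noteq> 0. c (e n) * (\<Prod>i\<in>UNIV. (x $ i) ^ e n i))"
    proof -
      have "e n i0 = n" for n by (simp add: e_def)
      then have "c (e n) = coeff p n" for n by (simp add: c_def)
      then show ?thesis by (simp only: prod)
    qed
    also have "\<dots> = (\<Sum>a\<in>{a. c a \<noteq> 0}. c a * (\<Prod>i\<in>UNIV. (x $ i) ^ a i))"
      unfolding supp by (subst sum.reindex[OF inj]) (simp add: o_def)
    finally show ?thesis .
  qed
  then show ?thesis
    unfolding polynomial_function_m_def using supp fin by (intro exI[of _ c]) auto
qed

text \<open>The base points lie on a line parallel to a coordinate axis, so that univariate Lagrange
  interpolation suffices.\<close>
lemma polynomial_fields_interpolate: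
  fixes \<Omega> :: "(real^'m) set"
  assumes "open \<Omega>" "\<Omega> \<noteq> {}"
  obtains x0 :: "nat \<Rightarrow> real^'m" and P where "\<And>k. k < N \<Longrightarrow> x0 k \<in> \<Omega>"
    "\<And>k b. polynomial_vector_field (P k b)"
    "\<And>k b k'. k < N \<Longrightarrow> k' < N \<Longrightarrow> P k b (x0 k') = (if k' = k then b else 0)"
proof -
  obtain q r where r: "r > 0" "ball q r \<subseteq> \<Omega>"
    using assms open_contains_ball by (metis ex_in_conv)
  define i0 :: 'm where "i0 = undefined"
  \<comment> \<open>Since \<open>k / (N + 1)\<close> is below 1, the points stay in the ball of
    radius \<open>r\<close>.\<close>
  define s where "s = (\<lambda>k::nat. q $ i0 + r * (real k / (real N + 1)))"
  define x0 where "x0 = (\<lambda>k. q + (s k - q $ i0) *\<^sub>R axis i0 1)"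
  have x0_i0: "x0 k $ i0 = s k" for k by (simp add: x0_def)
  have "x0 k \<in> \<Omega>" if "k < N" for k
  proof -
    have "dist q (x0 k) = \<bar>r * (real k / (real N + 1))\<bar>"
      by (simp add: x0_def dist_norm s_def)
    also have "\<dots> = r * (real k / (real N + 1))" using r by simp
    also have "\<dots> < r * 1" using r that by (intro mult_strict_left_mono) auto
    finally show ?thesis using r by auto
  qed
  moreover
  have s_inj: "s k = s k' \<longleftrightarrow> k = k'" for k k'
    using r by (simp add: s_def)
  define p where "p = (\<lambda>k. smult (inverse (\<Prod>k'\<in>{..<N} - {k}. s k - s k')) (\<Prod>k'\<in>{..<N} - {k}. [:- s k', 1:]))"
  have p: "poly (p k) (s k') = (if k' = k then 1 else 0)" if "k < N" "k' < N" for k k'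
  proof -
    have "poly (p k) (s k') = inverse (\<Prod>l\<in>{..<N} - {k}. s k - s l) * (\<Prod>l\<in>{..<N} - {k}. s k' - s l)"
      by (simp add: p_def poly_prod)
    moreover have "(\<Prod>l\<in>{..<N} - {k}. s k - s l) \<noteq> 0" by (auto simp: s_inj)
    moreover have "(\<Prod>l\<in>{..<N} - {k}. s k' - s l) = 0" if "k' \<noteq> k"
      using that \<open>k' < N\<close> by (intro prod_zero) auto
    ultimately show ?thesis by auto
  qed
  define P where "P = (\<lambda>k (b::real^'m) x. poly (p k) (x $ i0) *\<^sub>R b)"
  have "polynomial_vector_field (P k b)" for k b
  proof -
    have "(\<lambda>x. P k b x $ j) = (\<lambda>x. poly (smult (b $ j) (p k)) (x $ i0))" for j
      by (simp add: P_def fun_eq_iff)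
    then show ?thesis unfolding polynomial_vector_field_def by (simp only: polynomial_function_m_poly simp_thms)
  qed
  moreover have "P k b (x0 k') = (if k' = k then b else 0)" if "k < N" "k' < N" for k b k'
    using p[OF that] by (simp add: P_def x0_i0)
  ultimately show thesis using that[of x0 P] by blast
qed

text \<open>Fields of the Lie algebra dual to the coordinates of the points: index
  \<open>(k, b)\<close> has value \<open>b\<close> at point \<open>k\<close> and 0 at the
  others.\<close>

definition interpolates :: "('d \<Rightarrow> real^'m \<Rightarrow> real^'m) \<Rightarrow> nat \<Rightarrow> (nat \<Rightarrow> real^'m) \<Rightarrow> bool" where
  "interpolates V N x \<longleftrightarrow> (\<exists>E. \<forall>e\<in>{..<N} \<times> Basis. E e \<in> lie_algebra_gen V \<and>
     (\<forall>k<N. E e (x k) = (if k = fst e then snd e else 0)))"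

text \<open>Rows of a left inverse of the evaluation matrix are the coefficients that recombine
  \<open>F\<close> into dual fields.\<close>

lemma interpolates_of_left_inverse:
  fixes x :: "nat \<Rightarrow> real^'m" and F :: "nat \<times> (real^'m) \<Rightarrow> real^'m \<Rightarrow> real^'m"
  assumes F: "\<And>e. e \<in> {..<N} \<times> Basis \<Longrightarrow> F e \<in> lie_algebra_gen V"
    and B: "\<And>a b. a \<in> {..<N} \<times> Basis \<Longrightarrow> b \<in> {..<N} \<times> Basis \<Longrightarrow>
      (\<Sum>e\<in>{..<N} \<times> Basis. B a e * (F e (x (fst b)) \<bullet> snd b)) = (if a = b then 1 else 0)"
  shows "interpolates V N x"
  unfolding interpolates_def
proof (intro exI ballI conjI allI impI)
  fix a :: "nat \<times> (real^'m)" assume a: "a \<in> {..<N} \<times> Basis"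
  define I where "I = {..<N} \<times> (Basis :: (real^'m) set)"
  show "(\<lambda>y. \<Sum>e\<in>I. B a e *\<^sub>R F e y) \<in> lie_algebra_gen V"
    using a F by (intro lie_algebra_sum) (auto simp: I_def)
  fix k assume k: "k < N"
  show "(\<Sum>e\<in>I. B a e *\<^sub>R F e (x k)) = (if k = fst a then snd a else 0)"
  proof (rule euclidean_eqI)
    fix b :: "real^'m" assume b: "b \<in> Basis"
    have "(\<Sum>e\<in>I. B a e *\<^sub>R F e (x k)) \<bullet> b = (\<Sum>e\<in>I. B a e * (F e (x (fst (k, b))) \<bullet> snd (k, b)))"
      by (simp add: inner_sum_left)
    also have "\<dots> = (if a = (k, b) then 1 else 0)" unfolding I_def using a k b by (intro B) auto
    also have "\<dots> = (if k = fst a then snd a else 0) \<bullet> b"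
      using a b by (cases a) (auto simp: inner_Basis)
    finally show "(\<Sum>e\<in>I. B a e *\<^sub>R F e (x k)) \<bullet> b = (if k = fst a then snd a else 0) \<bullet> b" .
  qed
qed

section \<open>Genericity of interpolation in the parameter and in the points\<close>

lemma interpolatesE:
  assumes "interpolates V N x"
  obtains E where "\<And>e. e \<in> {..<N} \<times> Basis \<Longrightarrow> E e \<in> lie_algebra_gen V"
    "\<And>e k. e \<in> {..<N} \<times> Basis \<Longrightarrow> k < N \<Longrightarrow> E e (x k) = (if k = fst e then snd e else 0)"
proof -
  from assms obtain E where "\<forall>e\<in>{..<N} \<times> Basis. E e \<in> lie_algebra_gen V \<and>
     (\<forall>k<N. E e (x k) = (if k = fst e then snd e else 0))"
    unfolding interpolates_def by (rule exE)
  then show thesis by (intro that[of E]) (drule (1) bspec, simp)+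
qed

text \<open>With the points fixed, the evaluation matrix of the continued fields is the identity at
  \<open>zh\<close> and analytic in \<open>z\<close>, so its pivot product is nonzero for almost
  every \<open>z\<close>.\<close>

lemma AE_parameter_interpolates:
  fixes V :: "'d \<Rightarrow> real^'m \<Rightarrow> real^'l \<Rightarrow> real^'m"
  assumes V: "\<And>i z. smooth (\<lambda>x. V i x z)"
    and an: "\<And>i j x z. x \<in> \<Omega> \<Longrightarrow> analytic_fun (on_coords (\<lambda>x z. V i x z $ j)) (coords_of x z)"
    and x0: "\<And>k. k < N \<Longrightarrow> x0 k \<in> \<Omega>" and base: "interpolates (\<lambda>i x. V i x zh) N x0"
  shows "AE z in lborel. interpolates (\<lambda>i x. V i x z) N x0"
proof -
  define I where "I = {..<N} \<times> (Basis :: (real^'m) set)"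
  have finI: "finite I" by (simp add: I_def)
  obtain L where L: "\<And>e. e \<in> I \<Longrightarrow> L e \<in> lie_algebra_gen (\<lambda>i x. V i x zh)"
    "\<And>e k. e \<in> I \<Longrightarrow> k < N \<Longrightarrow> L e (x0 k) = (if k = fst e then snd e else 0)"
    by (rule interpolatesE[OF base, folded I_def]) (rule that)
  have "\<exists>H. H zh = L e \<and> (\<forall>z. H z \<in> lie_algebra_gen (\<lambda>i x. V i x z)) \<and>
    (\<forall>x\<in>\<Omega>. \<forall>z j. analytic_fun (on_coords (\<lambda>x z. H z x $ j)) (coords_of x z))" if "e \<in> I" for e
    by (rule lie_algebra_family[of V \<Omega>, OF V an L(1)[OF that]])
  then have "\<forall>e\<in>I. \<exists>H. H zh = L e \<and> (\<forall>z. H z \<in> lie_algebra_gen (\<lambda>i x. V i x z)) \<and>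
    (\<forall>x\<in>\<Omega>. \<forall>z j. analytic_fun (on_coords (\<lambda>x z. H z x $ j)) (coords_of x z))" by blast
  from bchoice[OF this] obtain H where H: "\<And>e. e \<in> I \<Longrightarrow> H e zh = L e"
    "\<And>e z. e \<in> I \<Longrightarrow> H e z \<in> lie_algebra_gen (\<lambda>i x. V i x z)"
    "\<And>e x z j. e \<in> I \<Longrightarrow> x \<in> \<Omega> \<Longrightarrow> analytic_fun (on_coords (\<lambda>x z. H e z x $ j)) (coords_of x z)"
    by blast
  have "\<exists>d. (\<forall>z. line_analytic_at d z) \<and> d zh \<noteq> 0 \<and> (\<forall>z. d z \<noteq> 0 \<longrightarrow>
    (\<exists>B. \<forall>a\<in>I. \<forall>b\<in>I. (\<Sum>e\<in>I. B a e * (H e z (x0 (fst b)) \<bullet> snd b)) = (if a = b then 1 else 0)))"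
  proof (rule left_inverse_near_identity[OF finI])
    show "\<forall>z. line_analytic_at (\<lambda>z. H a z (x0 (fst b)) \<bullet> snd b) z" if ab: "a \<in> I" "b \<in> I" for a b
    proof
      fix z
      obtain j where "snd b = axis j 1" using ab(2) by (auto simp: I_def Basis_vec_def)
      then show "line_analytic_at (\<lambda>z. H a z (x0 (fst b)) \<bullet> snd b) z"
        using ab x0 by (auto simp: I_def inner_axis intro!: analytic_fun_imp_line_analytic_at(2) H(3))
    qed
    show "H a zh (x0 (fst b)) \<bullet> snd b = (if a = b then 1 else 0)" if "a \<in> I" "b \<in> I" for a b
      using that L(2)[of a "fst b"] by (auto simp: H(1) I_def inner_Basis prod_eq_iff)
  qed (auto intro: line_analytic_at_const line_analytic_at_mult line_analytic_at_diff)
  then obtain d where d: "\<And>z. line_analytic_at d z" "d zh \<noteq> 0" and B: "\<And>z. d z \<noteq> 0 \<Longrightarrow>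
    (\<exists>B. \<forall>a\<in>I. \<forall>b\<in>I. (\<Sum>e\<in>I. B a e * (H e z (x0 (fst b)) \<bullet> snd b)) = (if a = b then 1 else 0))" by blast
  have "AE z in lborel. z \<in> UNIV \<longrightarrow> d z \<noteq> 0"
    by (rule AE_nonzero_of_line_analytic[of UNIV d zh]) (use d in auto)
  then show ?thesis
  proof (rule eventually_mono)
    fix z assume "z \<in> UNIV \<longrightarrow> d z \<noteq> 0"
    then obtain B where B: "\<forall>a\<in>I. \<forall>b\<in>I. (\<Sum>e\<in>I. B a e * (H e z (x0 (fst b)) \<bullet> snd b)) = (if a = b then 1 else 0)"
      using B by blast
    then show "interpolates (\<lambda>i x. V i x z) N x0"
      using B by (intro interpolates_of_left_inverse[where F="\<lambda>e. H e z" and B=B] H(2); fold I_def; blast)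
  qed
qed

text \<open>With the parameter fixed, the dual fields for \<open>x0\<close> are kept and evaluated
  at varying points; their evaluation matrix is the identity at \<open>x0\<close>.\<close>

lemma AE_points_interpolates:
  fixes V :: "'d \<Rightarrow> real^'m \<Rightarrow> real^'l \<Rightarrow> real^'m"
  assumes V: "\<And>i z. smooth (\<lambda>x. V i x z)"
    and an: "\<And>i j x z. x \<in> \<Omega> \<Longrightarrow> analytic_fun (on_coords (\<lambda>x z. V i x z $ j)) (coords_of x z)"
    and \<Omega>: "open \<Omega>" "connected \<Omega>"
    and x0: "\<And>k. k < N \<Longrightarrow> x0 k \<in> \<Omega>" and base: "interpolates (\<lambda>i x. V i x z) N x0"
  shows "AE x in Pi\<^sub>M {..<N} (\<lambda>_. lborel). (\<forall>k<N. x k \<in> \<Omega>) \<longrightarrow> interpolates (\<lambda>i x. V i x z) N x"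
proof -
  define I where "I = {..<N} \<times> (Basis :: (real^'m) set)"
  have finI: "finite I" by (simp add: I_def)
  obtain E where E: "\<And>e. e \<in> I \<Longrightarrow> E e \<in> lie_algebra_gen (\<lambda>i x. V i x z)"
    "\<And>e k. e \<in> I \<Longrightarrow> k < N \<Longrightarrow> E e (x0 k) = (if k = fst e then snd e else 0)"
    by (rule interpolatesE[OF base, folded I_def]) (rule that)
  have cont: "continuous_on UNIV (E e)" if "e \<in> I" for e
    using lie_algebra_smooth[of "\<lambda>i x. V i x z" UNIV "E e"] V E(1)[OF that] smooth_continuous by auto
  have an_E: "line_analytic_at (\<lambda>x. E e x $ j) x" if ex: "e \<in> I" "x \<in> \<Omega>" for e x j
  proof -
    obtain H where "H z = E e" "\<forall>x\<in>\<Omega>. \<forall>z j. analytic_fun (on_coords (\<lambda>x z. H z x $ j)) (coords_of x z)"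
      using lie_algebra_family[of V \<Omega>, OF V an E(1)[OF ex(1)]] by blast
    then show ?thesis
      using analytic_fun_imp_line_analytic_at(1)[of "\<lambda>x z. H z x $ j" x z] ex(2) by auto
  qed
  define X where "X = Pi\<^sub>E {..<N} (\<lambda>_. \<Omega>)"
  \<comment> \<open>Line analyticity is asked in each point separately, as the passage from point to
    point requires; measurability is asked in all points jointly, for Fubini.\<close>
  define P where "P = (\<lambda>d. d \<in> borel_measurable (Pi\<^sub>M {..<N} (\<lambda>_. lborel :: (real^'m) measure)) \<and>
    (\<forall>x\<in>X. \<forall>k<N. \<forall>y\<in>\<Omega>. line_analytic_at (\<lambda>y. d (x(k := y))) y))"
  \<comment> \<open>Elements of the product space take a fixed default value outside the index set,
    hence the restriction.\<close>
  define x1 where "x1 = restrict x0 {..<N}"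
  have x1: "x1 \<in> X" "\<And>k. k < N \<Longrightarrow> x1 k = x0 k" using x0 by (auto simp: x1_def X_def)
  have "\<exists>d. P d \<and> d x1 \<noteq> 0 \<and> (\<forall>x. d x \<noteq> 0 \<longrightarrow>
    (\<exists>B. \<forall>a\<in>I. \<forall>b\<in>I. (\<Sum>e\<in>I. B a e * (E e (x (fst b)) \<bullet> snd b)) = (if a = b then 1 else 0)))"
  proof (rule left_inverse_near_identity[OF finI])
    fix a b assume ab: "a \<in> I" "b \<in> I"
    have k: "fst b < N" using ab by (auto simp: I_def)
    show "P (\<lambda>x. E a (x (fst b)) \<bullet> snd b)"
      unfolding P_def
    proof (intro conjI ballI allI impI)
      have [measurable]: "E a \<in> borel_measurable borel"
        by (rule borel_measurable_continuous_onI[OF cont[OF ab(1)]])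
      have [measurable]: "(\<lambda>x. x (fst b)) \<in> measurable (Pi\<^sub>M {..<N} (\<lambda>_. lborel :: (real^'m) measure)) borel"
        using measurable_component_singleton[of "fst b" "{..<N}" "\<lambda>_. lborel :: (real^'m) measure"] k by simp
      show "(\<lambda>x. E a (x (fst b)) \<bullet> snd b) \<in> borel_measurable (Pi\<^sub>M {..<N} (\<lambda>_. lborel))" by measurable
      fix x l y assume "x \<in> X" "l < N" and y: "y \<in> \<Omega>"
      obtain j where j: "snd b = axis j 1" using ab(2) by (auto simp: I_def Basis_vec_def)
      show "line_analytic_at (\<lambda>y. E a ((x(l := y)) (fst b)) \<bullet> snd b) y"
        using an_E[OF ab(1) y] by (cases "fst b = l") (simp_all add: j inner_axis line_analytic_at_const)
    qed
    show "E a (x1 (fst b)) \<bullet> snd b = (if a = b then 1 else 0)"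
      using ab E(2)[of a "fst b"] k by (auto simp: x1 I_def inner_Basis prod_eq_iff)
  qed (auto simp: P_def intro: line_analytic_at_const line_analytic_at_mult line_analytic_at_diff)
  then obtain d where d: "P d" "d x1 \<noteq> 0" and B: "\<And>x. d x \<noteq> 0 \<Longrightarrow>
    (\<exists>B. \<forall>a\<in>I. \<forall>b\<in>I. (\<Sum>e\<in>I. B a e * (E e (x (fst b)) \<bullet> snd b)) = (if a = b then 1 else 0))" by blast
  have "AE x in Pi\<^sub>M {..<N} (\<lambda>_. lborel). (\<forall>k<N. x k \<in> \<Omega>) \<longrightarrow> d x \<noteq> 0"
  proof (rule AE_PiM_by_coordinates)
    show "d \<in> borel_measurable (Pi\<^sub>M {..<N} (\<lambda>_. lborel))" using d(1) by (simp add: P_def)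
    show "\<Omega> \<in> sets borel" using \<Omega> by simp
    show "x1 \<in> Pi\<^sub>E {..<N} (\<lambda>_. \<Omega>)" using x1 by (simp add: X_def)
    fix x k assume x: "x \<in> Pi\<^sub>E {..<N} (\<lambda>_. \<Omega>)" "k < N" "d x \<noteq> 0"
    have "line_analytic_at (\<lambda>y. d (x(k := y))) y" if "y \<in> \<Omega>" for y
      using d(1) x that unfolding P_def X_def by blast
    then show "AE y in lborel. y \<in> \<Omega> \<longrightarrow> d (x(k := y)) \<noteq> 0"
      using x by (intro AE_nonzero_of_line_analytic[OF \<Omega>, of _ "x k"]) auto
  qed (rule d)
  then show ?thesis
  proof (rule eventually_mono, intro impI)
    fix x assume "(\<forall>k<N. x k \<in> \<Omega>) \<longrightarrow> d x \<noteq> 0" "\<forall>k<N. x k \<in> \<Omega>"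
    then obtain B where B: "\<forall>a\<in>I. \<forall>b\<in>I. (\<Sum>e\<in>I. B a e * (E e (x (fst b)) \<bullet> snd b)) = (if a = b then 1 else 0)"
      using B by blast
    then show "interpolates (\<lambda>i x. V i x z) N x"
      using B by (intro interpolates_of_left_inverse[where F=E and B=B] E(1); fold I_def; blast)
  qed
qed

text \<open>The reached displacements are \<open>\<epsilon> *\<^sub>R y k\<close>, so
  \<open>lam\<close> is \<open>1 / \<epsilon>\<close>.\<close>

lemma interpolates_imp_controllable:
  fixes V :: "'d::finite \<Rightarrow> real^'m \<Rightarrow> real^'m" and x y :: "nat \<Rightarrow> real^'m"
  assumes K: "compact K" and V: "\<And>i. smooth (V i)" "\<And>i x. x \<notin> K \<Longrightarrow> V i x = 0"
    and int: "interpolates V N x"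
  shows "\<exists>u. \<exists>lam>0. (\<forall>i. square_integrable_control (u i)) \<and>
    (\<forall>k<N. (\<exists>X. is_control_solution u V (x k) X) \<and>
      (\<forall>X. is_control_solution u V (x k) X \<longrightarrow> y k = lam *\<^sub>R (X 1 - x k)))"
proof -
  have uniform: "\<exists>C. \<forall>i\<in>I. bounded_lipschitz C (F i)"
    if I: "finite I" and F: "\<And>i. i \<in> I \<Longrightarrow> F i \<in> lie_algebra_gen V" for I and F :: "'x \<Rightarrow> real^'m \<Rightarrow> real^'m"
  proof -
    have "\<exists>C0. \<forall>C\<ge>C0. bounded_lipschitz C (F i)" if "i \<in> I" for i
    proof -
      have F': "smooth (F i)" "\<And>x. x \<notin> K \<Longrightarrow> F i x = 0"
        using lie_algebra_smooth[of V K "F i"] V F[OF that] by auto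
      show ?thesis using smooth_compact_support_c2_field[OF K F'(2,1)] c2_fieldD(1) by blast
    qed
    then have "\<forall>i\<in>I. \<exists>C0. \<forall>C\<ge>C0. bounded_lipschitz C (F i)" by blast
    from bchoice[OF this] obtain C0 where C0: "\<And>i C. i \<in> I \<Longrightarrow> C0 i \<le> C \<Longrightarrow> bounded_lipschitz C (F i)" by blast
    have "C0 i \<le> (\<Sum>i\<in>I. \<bar>C0 i\<bar>)" if "i \<in> I" for i
      using member_le_sum[of i I "\<lambda>i. \<bar>C0 i\<bar>"] that I by auto
    then show ?thesis using C0 by blast
  qed
  define I where "I = {..<N} \<times> (Basis :: (real^'m) set)"
  obtain E where E: "\<And>e. e \<in> I \<Longrightarrow> E e \<in> lie_algebra_gen V"
    "\<And>e k. e \<in> I \<Longrightarrow> k < N \<Longrightarrow> E e (x k) = (if k = fst e then snd e else 0)"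
    by (rule interpolatesE[OF int, folded I_def]) (rule that)
  obtain \<iota> where \<iota>: "bij_betw \<iota> {..<card I} I"
    using ex_bij_betw_nat_finite[of I] by (auto simp: I_def atLeast0LessThan)
  have \<iota>I: "\<iota> c \<in> I" if "c < card I" for c using bij_betwE[OF \<iota>] that by blast
  have "\<exists>C. \<forall>c\<in>{..<card I}. bounded_lipschitz C (E (\<iota> c))"
    by (rule uniform) (simp_all add: E(1) \<iota>I)
  then obtain C where C: "\<forall>c\<in>{..<card I}. bounded_lipschitz C (E (\<iota> c))" by (rule exE)
  have "\<exists>\<epsilon>>0. \<exists>g\<in>flow_group V. \<forall>k<N. g (x k) = x k + \<epsilon> *\<^sub>R y k"
  proof (rule flow_group_hits[where E="\<lambda>c. E (\<iota> c)" and n="card I" and \<iota>=\<iota>])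
    show "approximable V (E (\<iota> c))" if "c < card I" for c
      using lie_algebra_approximable[OF K V E(1)[OF \<iota>I[OF that]]] .
    show "bij_betw \<iota> {..<card I} ({..<N} \<times> Basis)" using \<iota> by (simp add: I_def)
    show "bounded_lipschitz C (E (\<iota> c))" if "c < card I" for c using C that by simp
    show "E (\<iota> c) (x k) = (if k = fst (\<iota> c) then snd (\<iota> c) else 0)" if "c < card I" "k < N" for c k
      by (rule E(2)[OF \<iota>I[OF that(1)] that(2)])
  qed
  then obtain \<epsilon> g where g: "\<epsilon> > 0" "g \<in> flow_group V" "\<And>k. k < N \<Longrightarrow> g (x k) = x k + \<epsilon> *\<^sub>R y k" by blast
  obtain C' where C': "\<And>i. bounded_lipschitz C' (V i)"
    using uniform[of "UNIV :: 'd set" V] lie_algebra_gen.gen[of V] by auto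
  obtain u where u: "\<And>i. square_integrable_control (u i)"
    "\<And>x. \<exists>X. is_control_solution u V x X" "\<And>x X. is_control_solution u V x X \<Longrightarrow> X 1 = g x"
    using flow_group_realized[OF C' g(2)] by blast
  have "y k = (1 / \<epsilon>) *\<^sub>R (X 1 - x k)" if "k < N" "is_control_solution u V (x k) X" for k X
    using u(3)[OF that(2)] g(1) g(3)[OF that(1)] by simp
  then show ?thesis using u(1,2) g(1) by (intro exI[of _ u] exI[of _ "1 / \<epsilon>"]) auto
qed

theorem theorem2:
  fixes \<Omega> :: "(real^'m) set"
    and V :: "'d::finite \<Rightarrow> real^'m \<Rightarrow> real^'l \<Rightarrow> real^'m"
    and M :: "'w measure"
    and Z :: "'w \<Rightarrow> real^'l"
  assumes m2: "CARD('m) \<ge> 2"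
    and d5: "CARD('d) \<ge> 5"
    and Omega: "bounded \<Omega>" "open \<Omega>" "connected \<Omega>"
    and analytic: "\<exists>U W \<phi>. open U \<and> closure \<Omega> \<times> UNIV \<subseteq> U \<and>
        (\<forall>i j. \<forall>p\<in>U. real_analytic_at (\<lambda>(x, z). W i x z $ j) p) \<and>
        smooth (\<phi> :: real^'m \<Rightarrow> real) \<and> compact (closure {x. \<phi> x \<noteq> 0}) \<and>
        (\<forall>x\<in>\<Omega>. \<phi> x = 1) \<and>
        (\<forall>i x z. V i x z = \<phi> x *\<^sub>R W i x z)"
    and V_smooth: "\<forall>i z. smooth (\<lambda>x. V i x z)"
    and prob: "prob_space M"
    and density_Z: "\<exists>f. distributed M lborel Z f"
    and lie: "\<exists>zh. \<forall>P. polynomial_vector_field P \<longrightarrow>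
        (\<exists>L\<in>lie_algebra_gen (\<lambda>i x. V i x zh). \<forall>x\<in>\<Omega>. L x = P x)"
  shows "AE \<omega> in M.
     \<forall>N::nat. \<forall>g :: (nat \<Rightarrow> real^'m) \<Rightarrow> ennreal.
       g \<in> borel_measurable (PiM {..<N} (\<lambda>_. lborel)) \<and>
       prob_space (density (PiM {..<N} (\<lambda>_. lborel)) g) \<longrightarrow>
       (\<forall>y :: nat \<Rightarrow> real^'m.
          (\<forall>k<N. y k \<in> \<Omega>) \<and> (\<forall>k<N. \<forall>k'<N. k \<noteq> k' \<longrightarrow> y k \<noteq> y k') \<longrightarrow>
          (AE x in density (PiM {..<N} (\<lambda>_. lborel)) g.
             (\<forall>k<N. x k \<in> \<Omega>) \<longrightarrow>
             (\<exists>u :: 'd \<Rightarrow> real \<Rightarrow> real. \<exists>lam>0.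
                (\<forall>i. square_integrable_control (u i)) \<and>
                (\<forall>k<N. (\<exists>X. is_control_solution u (\<lambda>i p. V i p (Z \<omega>)) (x k) X) \<and>
                        (\<forall>X. is_control_solution u (\<lambda>i p. V i p (Z \<omega>)) (x k) X \<longrightarrow>
                             y k = lam *\<^sub>R (X 1 - x k))))))"
proof -
  from analytic obtain U W \<phi> where A: "open U \<and> closure \<Omega> \<times> UNIV \<subseteq> U \<and>
      (\<forall>i j. \<forall>p\<in>U. real_analytic_at (\<lambda>(x, z). W i x z $ j) p) \<and>
      smooth (\<phi> :: real^'m \<Rightarrow> real) \<and> compact (closure {x. \<phi> x \<noteq> 0}) \<and>
      (\<forall>x\<in>\<Omega>. \<phi> x = 1) \<and> (\<forall>i x z. V i x z = \<phi> x *\<^sub>R W i x z)"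
    by (elim exE)
  note U = A[THEN conjunct2, THEN conjunct1]
    and W = A[THEN conjunct2, THEN conjunct2, THEN conjunct1, rule_format]
    and \<phi> = A[THEN conjunct2, THEN conjunct2, THEN conjunct2, THEN conjunct2]
  note VW = \<phi>[THEN conjunct2, THEN conjunct2, rule_format]
  define K where "K = closure {x. \<phi> x \<noteq> 0}"
  have K: "compact K" using \<phi> by (simp add: K_def)
  have supp: "V i x z = 0" if "x \<notin> K" for i x z
    using that closure_subset[of "{x. \<phi> x \<noteq> 0}"] by (auto simp: K_def VW)
  have smV: "smooth (\<lambda>x. V i x z)" for i z using V_smooth by blast
  have an: "analytic_fun (on_coords (\<lambda>x z. V i x z $ j)) (coords_of x z)" if x: "x \<in> \<Omega>" for i j x z
  proof -
    have "analytic_fun (on_coords (\<lambda>x z. W i x z $ j)) (coords_of x z)"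
      using x U closure_subset[of \<Omega>] by (intro real_analytic_at_imp_analytic_fun W) auto
    \<comment> \<open>\<open>V\<close> and \<open>W\<close> agree only where \<open>\<phi>\<close>
      is 1. A small polydisc around \<open>x\<close> stays in the open set \<open>\<Omega>\<close>,
      so there they have the same series.\<close>
    obtain r where r: "r > 0" "ball x r \<subseteq> \<Omega>" using Omega(2) x open_contains_ball by blast
    define s where "s = r / (2 * real CARD('m))"
    have s: "s > 0" using r by (simp add: s_def)
    show ?thesis
    proof (rule analytic_fun_cong[OF \<open>analytic_fun (on_coords (\<lambda>x z. W i x z $ j)) (coords_of x z)\<close> s])
      fix u :: "'m + 'l \<Rightarrow> real" assume u: "\<And>k. \<bar>u k\<bar> \<le> s"
      define v :: "real^'m" where "v = (\<chi> i. u (Inl i))"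
      have "norm v \<le> (\<Sum>i\<in>UNIV. \<bar>v $ i\<bar>)" by (rule norm_le_l1_cart)
      also have "\<dots> \<le> (\<Sum>i\<in>(UNIV :: 'm set). s)" by (intro sum_mono) (simp add: v_def u)
      also have "\<dots> < r" using r by (simp add: s_def)
      finally have "x + v \<in> \<Omega>" using r by (auto simp: dist_norm)
      moreover have "(\<chi> i. coords_of x z (Inl i) + u (Inl i)) = x + v" by (simp add: coords_of_def v_def vec_eq_iff)
      ultimately show "on_coords (\<lambda>x z. W i x z $ j) (\<lambda>k. coords_of x z k + u k)
          = on_coords (\<lambda>x z. V i x z $ j) (\<lambda>k. coords_of x z k + u k)"
        by (simp add: on_coords_def VW \<phi>)
    qed
  qed
  obtain zh where zh: "\<And>P. polynomial_vector_field P \<Longrightarrow>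
      \<exists>L\<in>lie_algebra_gen (\<lambda>i x. V i x zh). \<forall>x\<in>\<Omega>. L x = P x"
    using lie by blast
  \<comment> \<open>Neither \<open>g\<close> nor \<open>y\<close> occurs here, so the exceptional
    parameters depend on \<open>N\<close> alone and are collected over countably many
    \<open>N\<close>.\<close>
  define good where "good = (\<lambda>N z. AE x in Pi\<^sub>M {..<N} (\<lambda>_. lborel).
    (\<forall>k<N. x k \<in> \<Omega>) \<longrightarrow> interpolates (\<lambda>i x. V i x z) N x)"
  have good: "AE z in lborel. good N z" for N
  \<comment> \<open>Without points or without room for them the condition is vacuous; otherwise
    reference points exist.\<close>
  proof (cases "N = 0 \<or> \<Omega> = {}")
    case True
    then show ?thesis unfolding good_def interpolates_def by auto
  next
    case False
    then have "\<Omega> \<noteq> {}" by blast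
    then obtain x0 P where x0: "\<And>k. k < N \<Longrightarrow> x0 k \<in> \<Omega>" and P: "\<And>k b. polynomial_vector_field (P k b)"
      "\<And>k b k'. k < N \<Longrightarrow> k' < N \<Longrightarrow> P k b (x0 k') = (if k' = k then b else 0)"
      using polynomial_fields_interpolate[OF Omega(2)] by blast
    have "\<forall>e. \<exists>L. L \<in> lie_algebra_gen (\<lambda>i x. V i x zh) \<and> (\<forall>x\<in>\<Omega>. L x = P (fst e) (snd e) x)"
      using zh P(1) by blast
    from choice[OF this] obtain L where
      L: "\<forall>e. L e \<in> lie_algebra_gen (\<lambda>i x. V i x zh) \<and> (\<forall>x\<in>\<Omega>. L e x = P (fst e) (snd e) x)"
      by (rule exE)
    have int0: "interpolates (\<lambda>i x. V i x zh) N x0"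
      unfolding interpolates_def
    proof (intro exI[of _ L] ballI conjI allI impI)
      fix e :: "nat \<times> (real^'m)" assume e: "e \<in> {..<N} \<times> Basis"
      show "L e \<in> lie_algebra_gen (\<lambda>i x. V i x zh)" using spec[OF L, of e] by (rule conjunct1)
      fix k assume k: "k < N"
      \<comment> \<open>The Lie algebra element agrees with the polynomial field on
        \<open>\<Omega>\<close>, where the reference points lie.\<close>
      have "L e (x0 k) = P (fst e) (snd e) (x0 k)" using spec[OF L, of e] x0[OF k] by simp
      also have "\<dots> = (if k = fst e then snd e else 0)" using e k by (intro P(2)) auto
      finally show "L e (x0 k) = (if k = fst e then snd e else 0)" .
    qed
    have "AE z in lborel. interpolates (\<lambda>i x. V i x z) N x0"
      by (rule AE_parameter_interpolates[OF smV an x0 int0])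
    then show ?thesis
      unfolding good_def
    proof (rule eventually_mono)
      fix z assume int_z: "interpolates (\<lambda>i x. V i x z) N x0"
      show "AE x in Pi\<^sub>M {..<N} (\<lambda>_. lborel). (\<forall>k<N. x k \<in> \<Omega>) \<longrightarrow> interpolates (\<lambda>i x. V i x z) N x"
        by (rule AE_points_interpolates[OF smV an Omega(2,3) x0 int_z])
    qed
  qed
  then have all_good: "AE z in lborel. \<forall>N. good N z" by (simp add: AE_all_countable)
  obtain f where f: "distributed M lborel Z f" using density_Z by blast
  \<comment> \<open>A law with a density gives measure zero to every Lebesgue null set of
    parameters; the density \<open>g\<close> of the points is treated likewise below.\<close>
  have "AE z in density lborel f. \<forall>N. good N z"
    using all_good distributed_borel_measurable[OF f] by (subst AE_density) (auto elim: eventually_mono)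
  then have "AE z in distr M lborel Z. \<forall>N. good N z"
    unfolding distributed_distr_eq_density[OF f] .
  then have "AE \<omega> in M. \<forall>N. good N (Z \<omega>)"
    by (rule AE_distrD[OF distributed_measurable[OF f]])
  then show ?thesis
  proof (rule eventually_mono, intro allI impI, goal_cases)
    case (1 \<omega> N g y)
    have "AE x in Pi\<^sub>M {..<N} (\<lambda>_. lborel). (\<forall>k<N. x k \<in> \<Omega>) \<longrightarrow> interpolates (\<lambda>i x. V i x (Z \<omega>)) N x"
      using 1(1) unfolding good_def by blast
    then have "AE x in density (Pi\<^sub>M {..<N} (\<lambda>_. lborel)) g.
        (\<forall>k<N. x k \<in> \<Omega>) \<longrightarrow> interpolates (\<lambda>i x. V i x (Z \<omega>)) N x"
      using 1(3) by (subst AE_density) (auto elim: eventually_mono)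
    then show ?case
    proof (rule eventually_mono, intro impI)
      fix x assume "(\<forall>k<N. x k \<in> \<Omega>) \<longrightarrow> interpolates (\<lambda>i x. V i x (Z \<omega>)) N x" "\<forall>k<N. x k \<in> \<Omega>"
      then have int_x: "interpolates (\<lambda>i x. V i x (Z \<omega>)) N x" by blast
      show "\<exists>u. \<exists>lam>0. (\<forall>i. square_integrable_control (u i)) \<and>
          (\<forall>k<N. (\<exists>X. is_control_solution u (\<lambda>i p. V i p (Z \<omega>)) (x k) X) \<and>
            (\<forall>X. is_control_solution u (\<lambda>i p. V i p (Z \<omega>)) (x k) X \<longrightarrow> y k = lam *\<^sub>R (X 1 - x k)))"
        by (rule interpolates_imp_controllable[OF K smV supp int_x])
    qed
  qed
qed

end
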